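(* Let $\alpha>0$ and let $\gamma:\mathbb{N}\to(0,+\infty)$ satisfy $\gamma(n)\to+\infty$ as $n\to+\infty$. Let $(X^n)_{n\in\mathbb{N}}$, $X^n=(X^n_t)_{t\in[0,1]}$, be a family of continuous centered Gaussian processes which is exponentially tight at the speed $\gamma(n)$ and such that, for every $\lambda\in\mathscr{M}[0,1]$, $$\lim_{n\to+\infty}\gamma(n)\,\mathrm{Var}\big(\langle\lambda,X^n\rangle\big)=\int_0^1\int_0^1\bar k(t,s)\,d\lambda(t)\,d\lambda(s),$$ where $\bar k$ is a continuous, symmetric, positive definite function which is the covariance function of a continuous Gaussian process. Let $\bar{\mathscr{H}}$ be the reproducing kernel Hilbert space associated with $\bar k$. Let $(Y^n)_{n\in\mathbb{N}}=(Y^n_1,Y^n_2)_{n\in\mathbb{N}}$ be a family of processes with paths in $\mathscr{C}_\alpha([0,1])\times\mathscr{C}([0,1])$, independent of $(X^n)_{n\in\mathbb{N}}$, and suppose that $(Y^n)_{n\in\mathbb{N}}$ satisfies a large deviation principle on $\mathscr{C}_\alpha([0,1])\times\mathscr{C}([0,1])$ with the speed $\gamma(n)$ and the good rate function $I_Y$. For $n\in\mathbb{N}$ put $Z^n_t=X^n_t\,Y^n_1(t)+Y^n_2(t)$, $t\in[0,1]$. For $z\in\mathscr{C}([0,1])$ and $y=(y_1,y_2)\in\mathscr{C}_\alpha([0,1])\times\mathscr{C}([0,1])$ let $$J(z|y)=\begin{cases}\dfrac12\left\|\dfrac{z-y_2}{y_1}\right\|_{\bar{\mathscr{H}}}^2,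 & \dfrac{z-y_2}{y_1}\in\bar{\mathscr{H}},\\[2mm] +\infty, & \text{otherwise.}\end{cases}$$ Then $(Y^n,Z^n)_{n\in\mathbb{N}}$ satisfies a weak large deviation principle on $\big(\mathscr{C}_\alpha([0,1])\times\mathscr{C}([0,1])\big)\times\mathscr{C}([0,1])$ with the speed $\gamma(n)$ and the rate function $$I(y,z)=I_Y(y)+J(z|y),$$ and $(Z^n)_{n\in\mathbb{N}}$ satisfies a large deviation principle on $\mathscr{C}([0,1])$ with the speed $\gamma(n)$ and the rate function $$I_Z(z)=\inf_{y\in\mathscr{C}_\alpha([0,1])\times\mathscr{C}([0,1])}\big\{I_Y(y)+J(z|y)\big\}.$$
   Context: $\mathscr{C}([0,1])$ is the space of continuous real functions on $[0,1]$ with the sup-norm $\|\cdot\|_\infty$; $\mathscr{M}[0,1]$ is its dual, the space of signed Borel measures on $[0,1]$, with $\langle\lambda,h\rangle=\int_0^1h\,d\lambda$. $\mathscr{C}_\alpha([0,1])=\{y\in\mathscr{C}([0,1]): y(t)\ge\alpha\ \text{for all } t\in[0,1]\}$ with the uniform topology. All processes are defined on a common probability space $(\Omega,\mathscr{F},\mathbb{P})$. A rate function on a topological space $E$ is a lower semicontinuous map $I:E\to[0,+\infty]$; it is good if $\{I\le a\}$ is compact for every $a\ge0$. A family $(\mu_n)$ of Borel probability measures on $E$ satisfies a large deviation principle (LDP) with speed $\gamma(n)$ and rate function $I$ if $-\inf_{\Theta}I\le\liminf_n\frac1{\gamma(n)}\log\mu_n(\Theta)$ for every open $\Theta\subset E$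 and $\limsup_n\frac1{\gamma(n)}\log\mu_n(\Gamma)\le-\inf_\Gamma I$ for every closed $\Gamma\subset E$. It satisfies a weak LDP if the lower bound holds for all open sets and the upper bound holds for all compact sets. A family of random elements satisfies an LDP (weak LDP) if the family of its laws does. A family $(X^n)$ of continuous processes is exponentially tight at the speed $\gamma(n)$ if for every $R>0$ there is a compact set $K_R\subset\mathscr{C}([0,1])$ with $\limsup_n\frac1{\gamma(n)}\log\mathbb{P}(X^n\notin K_R)\le-R$. Reproducing kernel Hilbert space: if $U=(U_t)_{t\in[0,1]}$ is a continuous centered Gaussian process with covariance function $k$, let $H$ be the closure in $L^2(\mathbb{P})$ of the linear span of $\{U_t: t\in[0,1]\}$. The map $\mathscr{S}:H\to\mathscr{C}([0,1])$, $(\mathscr{S}Y)(t)=\mathbb{E}[U_tY]$, is injective; the RKHS associated with $k$ is $\mathscr{H}=\mathscr{S}(H)$ with norm $\|\mathscr{S}Y\|_{\mathscr{H}}=\|Y\|_{L^2(\mathbb{P})}$ (it depends only on $k$). *)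

theory Defs
  imports "HOL-Probability.Probability"
begin

typedef unit_ivl = "{0..1::real}"
  morphisms time_of Abs_unit_ivl
  by (rule exI[of _ 0]) simp

instantiation unit_ivl :: metric_space
begin

definition dist_unit_ivl :: "unit_ivl \<Rightarrow> unit_ivl \<Rightarrow> real" where
  "dist s t = dist (time_of s) (time_of t)"

definition uniformity_unit_ivl :: "(unit_ivl \<times> unit_ivl) filter" where
  "uniformity_unit_ivl = (INF e\<in>{0<..}. principal {(s, t). dist s t < e})"

definition open_unit_ivl :: "unit_ivl set \<Rightarrow> bool" where
  "open_unit_ivl U \<longleftrightarrow> (\<forall>s\<in>U. \<forall>\<^sub>F (s', t) in uniformity. s' = s \<longrightarrow> t \<in> U)"

instance
proof
  fix r s t :: unit_ivl and U :: "unit_ivl set"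
  show "dist s t = 0 \<longleftrightarrow> s = t"
    by (simp add: dist_unit_ivl_def time_of_inject)
  show "dist r s \<le> dist r t + dist s t"
    unfolding dist_unit_ivl_def by (rule dist_triangle2)
qed (rule uniformity_unit_ivl_def open_unit_ivl_def)+

end

lemma compact_UNIV_unit_ivl: "compact (UNIV :: unit_ivl set)"
proof -
  have "continuous_on {0..1} Abs_unit_ivl"
    by (auto simp: continuous_on_iff dist_unit_ivl_def Abs_unit_ivl_inverse)
  then have "compact (Abs_unit_ivl ` {0..1})"
    by (rule compact_continuous_image) simp
  moreover have "Abs_unit_ivl ` {0..1} = UNIV"
    by (metis type_definition.Abs_image type_definition_unit_ivl)
  ultimately show ?thesis by simp
qed

text \<open>Bounded continuous functions on \<^typ>\<open>unit_ivl\<close> are all continuous functions, by compactness.\<close>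

lemma bcontfun_unit_ivl_iff:
  fixes f :: "unit_ivl \<Rightarrow> real"
  shows "f \<in> bcontfun \<longleftrightarrow> continuous_on UNIV f"
  using compact_imp_bounded[OF compact_continuous_image[OF _ compact_UNIV_unit_ivl]]
  by (auto simp: bcontfun_def)

type_synonym C01 = "unit_ivl \<Rightarrow>\<^sub>C real"

definition C_ge :: "real \<Rightarrow> C01 set" where
  "C_ge \<alpha> = {y :: C01. \<forall>t. \<alpha> \<le> y t}"

definition env_space :: "real \<Rightarrow> (C01 \<times> C01) topology" where
  "env_space \<alpha> = prod_topology (top_of_set (C_ge \<alpha>)) euclidean"

definition signed_borel_measure :: "(unit_ivl set \<Rightarrow> real) \<Rightarrow> bool" where
  "signed_borel_measure \<nu> \<longleftrightarrow>
     (\<forall>A :: nat \<Rightarrow> unit_ivl set. range A \<subseteq> sets borel \<longrightarrow> disjoint_family A \<longrightarrow>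
        (\<lambda>i. \<nu> (A i)) sums \<nu> (\<Union>i. A i))"

definition jordan_decomposition ::
  "(unit_ivl set \<Rightarrow> real) \<Rightarrow> unit_ivl measure \<times> unit_ivl measure \<Rightarrow> bool" where
  "jordan_decomposition \<nu> = (\<lambda>(p, q).
     finite_measure p \<and> sets p = sets borel \<and> finite_measure q \<and> sets q = sets borel \<and>
     (\<forall>A\<in>sets borel. \<nu> A = measure p A - measure q A) \<and>
     (\<exists>P\<in>sets borel. measure p (- P) = 0 \<and> measure q P = 0))"

text \<open>By the Hahn--Jordan theorem the pair chosen below exists and is unique
  for every signed Borel measure.\<close>

definition signed_integral :: "(unit_ivl set \<Rightarrow> real) \<Rightarrow> (unit_ivl \<Rightarrow> real) \<Rightarrow> real" where
  "signed_integral \<nu> h =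
     (let (p, q) = (SOME pq. jordan_decomposition \<nu> pq) in (\<integral>t. h t \<partial>p) - (\<integral>t. h t \<partial>q))"

text \<open>Almost surely vanishing variables count as centered Gaussian.\<close>

definition centered_gaussian_rv :: "'w measure \<Rightarrow> ('w \<Rightarrow> real) \<Rightarrow> bool" where
  "centered_gaussian_rv M V \<longleftrightarrow> V \<in> borel_measurable M \<and>
     ((AE \<omega> in M. V \<omega> = 0) \<or> (\<exists>\<sigma>>0. distributed M lborel V (normal_density 0 \<sigma>)))"

definition continuous_centered_gaussian_process :: "'w measure \<Rightarrow> ('w \<Rightarrow> C01) \<Rightarrow> bool" where
  "continuous_centered_gaussian_process M U \<longleftrightarrow>
     (\<forall>F c. finite F \<longrightarrow> centered_gaussian_rv M (\<lambda>\<omega>. \<Sum>t\<in>F. c t * U \<omega> t))"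

definition covariance_function :: "'w measure \<Rightarrow> ('w \<Rightarrow> C01) \<Rightarrow> unit_ivl \<Rightarrow> unit_ivl \<Rightarrow> real" where
  "covariance_function M U t s =
     (\<integral>\<omega>. (U \<omega> t - (\<integral>\<eta>. U \<eta> t \<partial>M)) * (U \<omega> s - (\<integral>\<eta>. U \<eta> s \<partial>M)) \<partial>M)"

text \<open>Positive definiteness is meant in the non-strict sense, as for every covariance function.\<close>

definition positive_definite :: "('t \<Rightarrow> 't \<Rightarrow> real) \<Rightarrow> bool" where
  "positive_definite k \<longleftrightarrow>
     (\<forall>F c. finite F \<longrightarrow> 0 \<le> (\<Sum>t\<in>F. \<Sum>s\<in>F. c t * c s * k t s))"

definition L2_norm :: "'w measure \<Rightarrow> ('w \<Rightarrow> real) \<Rightarrow> real" where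
  "L2_norm M V = sqrt (\<integral>\<omega>. (V \<omega>)\<^sup>2 \<partial>M)"

text \<open>The closed linear span of the process in \<open>L\<^sup>2\<close>. Its elements are square integrable
  functions rather than classes modulo null sets.\<close>

definition gaussian_space :: "'w measure \<Rightarrow> ('w \<Rightarrow> C01) \<Rightarrow> ('w \<Rightarrow> real) set" where
  "gaussian_space M U =
     {V. V \<in> borel_measurable M \<and> integrable M (\<lambda>\<omega>. (V \<omega>)\<^sup>2) \<and>
         (\<forall>e>0. \<exists>F c. finite F \<and> L2_norm M (\<lambda>\<omega>. V \<omega> - (\<Sum>t\<in>F. c t * U \<omega> t)) < e)}"

definition rkhs_map :: "'w measure \<Rightarrow> ('w \<Rightarrow> C01) \<Rightarrow> ('w \<Rightarrow> real) \<Rightarrow> unit_ivl \<Rightarrow> real" where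
  "rkhs_map M U V = (\<lambda>t. \<integral>\<omega>. U \<omega> t * V \<omega> \<partial>M)"

text \<open>The space below and its norm depend on the process only through its covariance function.\<close>

definition rkhs :: "'w measure \<Rightarrow> ('w \<Rightarrow> C01) \<Rightarrow> (unit_ivl \<Rightarrow> real) set" where
  "rkhs M U = rkhs_map M U ` gaussian_space M U"

text \<open>The description is proper since \<^const>\<open>rkhs_map\<close> is injective modulo null sets.\<close>

definition rkhs_norm :: "'w measure \<Rightarrow> ('w \<Rightarrow> C01) \<Rightarrow> (unit_ivl \<Rightarrow> real) \<Rightarrow> real" where
  "rkhs_norm M U h =
     (THE r. \<exists>V\<in>gaussian_space M U. rkhs_map M U V = h \<and> r = L2_norm M V)"

definition borel_of :: "'a topology \<Rightarrow> 'a measure" where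
  "borel_of T = sigma (topspace T) {U. openin T U}"

definition rate_function :: "'a topology \<Rightarrow> ('a \<Rightarrow> ennreal) \<Rightarrow> bool" where
  "rate_function T I \<longleftrightarrow> (\<forall>a. closedin T {x \<in> topspace T. I x \<le> a})"

definition good_rate_function :: "'a topology \<Rightarrow> ('a \<Rightarrow> ennreal) \<Rightarrow> bool" where
  "good_rate_function T I \<longleftrightarrow>
     rate_function T I \<and> (\<forall>a<\<infinity>. compactin T {x \<in> topspace T. I x \<le> a})"

text \<open>\<open>log 0 = -\<infinity>\<close>, unlike \<^const>\<open>ln\<close>.\<close>

definition log_prob :: "real \<Rightarrow> ereal" where
  "log_prob p = (if p = 0 then -\<infinity> else ereal (ln p))"

definition borel_probability :: "'a topology \<Rightarrow> 'a measure \<Rightarrow> bool" where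
  "borel_probability T \<mu> \<longleftrightarrow> prob_space \<mu> \<and> sets \<mu> = sets (borel_of T)"

definition ldp_lower ::
  "'a topology \<Rightarrow> (nat \<Rightarrow> 'a measure) \<Rightarrow> (nat \<Rightarrow> real) \<Rightarrow> ('a \<Rightarrow> ennreal) \<Rightarrow> 'a set \<Rightarrow> bool" where
  "ldp_lower T \<mu> \<gamma> I A \<longleftrightarrow>
     - enn2ereal (INF x\<in>A. I x) \<le> liminf (\<lambda>n. ereal (1 / \<gamma> n) * log_prob (measure (\<mu> n) A))"

definition ldp_upper ::
  "'a topology \<Rightarrow> (nat \<Rightarrow> 'a measure) \<Rightarrow> (nat \<Rightarrow> real) \<Rightarrow> ('a \<Rightarrow> ennreal) \<Rightarrow> 'a set \<Rightarrow> bool" where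
  "ldp_upper T \<mu> \<gamma> I A \<longleftrightarrow>
     limsup (\<lambda>n. ereal (1 / \<gamma> n) * log_prob (measure (\<mu> n) A)) \<le> - enn2ereal (INF x\<in>A. I x)"

definition LDP ::
  "'a topology \<Rightarrow> (nat \<Rightarrow> 'a measure) \<Rightarrow> (nat \<Rightarrow> real) \<Rightarrow> ('a \<Rightarrow> ennreal) \<Rightarrow> bool" where
  "LDP T \<mu> \<gamma> I \<longleftrightarrow> (\<forall>n. borel_probability T (\<mu> n)) \<and> rate_function T I \<and>
     (\<forall>A. openin T A \<longrightarrow> ldp_lower T \<mu> \<gamma> I A) \<and> (\<forall>A. closedin T A \<longrightarrow> ldp_upper T \<mu> \<gamma> I A)"

definition weak_LDP ::
  "'a topology \<Rightarrow> (nat \<Rightarrow> 'a measure) \<Rightarrow> (nat \<Rightarrow> real) \<Rightarrow> ('a \<Rightarrow> ennreal) \<Rightarrow> bool" where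
  "weak_LDP T \<mu> \<gamma> I \<longleftrightarrow> (\<forall>n. borel_probability T (\<mu> n)) \<and> rate_function T I \<and>
     (\<forall>A. openin T A \<longrightarrow> ldp_lower T \<mu> \<gamma> I A) \<and> (\<forall>A. compactin T A \<longrightarrow> ldp_upper T \<mu> \<gamma> I A)"

definition random_LDP ::
  "'w measure \<Rightarrow> 'a topology \<Rightarrow> (nat \<Rightarrow> 'w \<Rightarrow> 'a) \<Rightarrow> (nat \<Rightarrow> real) \<Rightarrow> ('a \<Rightarrow> ennreal) \<Rightarrow> bool" where
  "random_LDP M T Z \<gamma> I \<longleftrightarrow>
     (\<forall>n. Z n \<in> measurable M (borel_of T)) \<and> LDP T (\<lambda>n. distr M (borel_of T) (Z n)) \<gamma> I"

definition random_weak_LDP ::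
  "'w measure \<Rightarrow> 'a topology \<Rightarrow> (nat \<Rightarrow> 'w \<Rightarrow> 'a) \<Rightarrow> (nat \<Rightarrow> real) \<Rightarrow> ('a \<Rightarrow> ennreal) \<Rightarrow> bool" where
  "random_weak_LDP M T Z \<gamma> I \<longleftrightarrow>
     (\<forall>n. Z n \<in> measurable M (borel_of T)) \<and> weak_LDP T (\<lambda>n. distr M (borel_of T) (Z n)) \<gamma> I"

definition exponentially_tight ::
  "'w measure \<Rightarrow> (nat \<Rightarrow> 'w \<Rightarrow> C01) \<Rightarrow> (nat \<Rightarrow> real) \<Rightarrow> bool" where
  "exponentially_tight M X \<gamma> \<longleftrightarrow>
     (\<forall>R>0. \<exists>K. compact K \<and>
        limsup (\<lambda>n. ereal (1 / \<gamma> n) * log_prob (measure M {\<omega> \<in> space M. X n \<omega> \<notin> K})) \<le> ereal (- R))"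

text \<open>Independence of two families, as independence of the sigma-algebras which the whole
  families generate. (The library's \<open>indep_var\<close> forces both variables to have the same type.)\<close>

definition indep_families ::
  "'w measure \<Rightarrow> 'a topology \<Rightarrow> (nat \<Rightarrow> 'w \<Rightarrow> 'a) \<Rightarrow> 'b topology \<Rightarrow> (nat \<Rightarrow> 'w \<Rightarrow> 'b) \<Rightarrow> bool" where
  "indep_families M S X T Y \<longleftrightarrow>
     prob_space.indep_set M
       (sigma_sets (space M) {X n -` A \<inter> space M | n A. A \<in> sets (borel_of S)})
       (sigma_sets (space M) {Y n -` A \<inter> space M | n A. A \<in> sets (borel_of T)})"

definition cond_rate ::
  "'v measure \<Rightarrow> ('v \<Rightarrow> C01) \<Rightarrow> C01 \<Rightarrow> C01 \<times> C01 \<Rightarrow> ennreal" where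
  "cond_rate N U z = (\<lambda>(y1, y2).
     let h = (\<lambda>t. (z t - y2 t) / y1 t)
     in if h \<in> rkhs N U then ennreal (1 / 2 * (rkhs_norm N U h)\<^sup>2) else \<infinity>)"

end

theory Submission
  imports Defs
begin

text \<open>
  Since \<open>y\<^sub>1 \<ge> \<alpha> > 0\<close>, the map \<open>(x, y) \<mapsto> (y, x y\<^sub>1 + y\<^sub>2)\<close> is a continuous bijection, and the value
  \<open>J(z|y)\<close> is the Gaussian rate of the unique \<open>x\<close> with \<open>x y\<^sub>1 + y\<^sub>2 = z\<close>. Both claims therefore follow from the
  contraction principle once the independent pair \<open>(X, Y)\<close> is known to satisfy a full large deviation
  principle with the good rate function \<open>\<parallel>x\<parallel>\<^sup>2 / 2 + I\<^sub>Y(y)\<close>. The upper bound for the pair needs no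
  exponential tightness of \<open>Y\<close>: compact level sets of both rates are covered by finitely many
  rectangles on which independence applies, and the upper bounds of the marginals control the rest.

  For the Gaussian part, polarization of the variances for the measures \<open>\<delta>\<^sub>t\<close> and \<open>\<delta>\<^sub>t + \<delta>\<^sub>s\<close> yields
  convergence of the rescaled covariances. The rate \<open>\<parallel>x\<parallel>\<^sup>2 / 2\<close> is the supremum over finite combinations of
  \<open>\<Sum>c\<^sub>t x(t) - \<Sum>\<Sum>c\<^sub>t c\<^sub>s k(t,s) / 2\<close>, so Chernoff bounds give the upper estimate on compact sets. For the
  lower estimate \<open>x\<close> is approximated by \<open>\<Sum>c\<^sub>s k(s,\<cdot>)\<close>, around which the law of \<open>X\<^sup>n\<close> tilted by
  \<open>exp (\<gamma>(n) \<Sum>c\<^sub>s X\<^sup>n\<^sub>s)\<close> concentrates pointwise; exponential tightness makes this uniform.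
\<close>

subsection \<open>Exponential rates\<close>

text \<open>Limits of scaled logarithms are traded for eventual bounds by
  \<open>exp (- (\<gamma> n * b))\<close> with a strict gap between exponents. Since \<gamma> tends
  to infinity, the gap absorbs the size of a finite cover or a factor 1/2, and infinite rates stay
  out of the real arithmetic. In the product bound a closed set is not a rectangle, and level sets
  are compact only at finite levels. Fixing one finite level and fitting an open rectangle around
  the product of the two level sets leaves a remainder made of two cylinders, each seen by a single
  marginal. The limiting kernel may be degenerate, so no covariance matrix is inverted. The Gaussian
  rate is handled as a Legendre transform instead: each finite combination gives one continuous
  affine functional of x, and membership in the Hilbert space is recovered from boundedness of the
  supremum. Compactness of the Gaussian level sets comes from playing the lower bound against
  exponential tightness.\<close>

lemma scaled_log_prob_less_iff:
  assumes "0 < c" "0 \<le> p"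
  shows "ereal (1 / c) * log_prob p < ereal y \<longleftrightarrow> p < exp (c * y)"
proof (cases "p = 0")
  case True
  then show ?thesis using assms by (simp add: log_prob_def)
next
  case False
  then have "0 < p" using assms by simp
  then have "p < exp (c * y) \<longleftrightarrow> ln p < c * y"
    by (metis exp_gt_zero ln_exp ln_less_cancel_iff)
  then show ?thesis using assms False by (simp add: log_prob_def field_simps)
qed

lemma less_scaled_log_prob_iff:
  assumes "0 < c" "0 \<le> p"
  shows "ereal y < ereal (1 / c) * log_prob p \<longleftrightarrow> exp (c * y) < p"
proof (cases "p = 0")
  case True
  then show ?thesis using assms by (simp add: log_prob_def)
next
  case False
  then have "0 < p" using assms by simp
  then have "exp (c * y) < p \<longleftrightarrow> c * y < ln p"
    by (metis exp_gt_zero ln_exp ln_less_cancel_iff)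
  then show ?thesis using assms False by (simp add: log_prob_def field_simps)
qed

lemma ennreal_le_iff_ereal_le: "0 \<le> a \<Longrightarrow> ennreal a \<le> L \<longleftrightarrow> ereal a \<le> enn2ereal L"
  by (metis e2ennreal_enn2ereal e2ennreal_ereal enn2ereal_ennreal less_eq_ennreal.rep_eq)

lemma ennreal_less_iff_ereal_less: "0 \<le> a \<Longrightarrow> L < ennreal a \<longleftrightarrow> enn2ereal L < ereal a"
  using ennreal_le_iff_ereal_le[of a L] by (auto simp: not_le[symmetric])

text \<open>A limsup bound controls the probabilities eventually with any exponent strictly below
  the infimum, not with the infimum itself; hence two constants. Real a also covers an infinite
  infimum. For infimum 0 the right side is vacuous, and the upper bound holds because probabilities
  are at most 1.\<close>

lemma ldp_upper_iff:
  assumes g: "\<And>n. 0 < \<gamma> n" and mu: "\<And>n. prob_space (\<mu> n)"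
  shows "ldp_upper T \<mu> \<gamma> I A \<longleftrightarrow>
    (\<forall>a b. 0 \<le> b \<longrightarrow> b < a \<longrightarrow> (\<forall>x\<in>A. ennreal a \<le> I x) \<longrightarrow>
       (\<forall>\<^sub>F n in sequentially. measure (\<mu> n) A \<le> exp (- (\<gamma> n * b))))" (is "_ \<longleftrightarrow> ?R")
proof
  assume U: "ldp_upper T \<mu> \<gamma> I A"
  show ?R
  proof (intro allI impI)
    fix a b :: real assume b: "0 \<le> b" "b < a" and "\<forall>x\<in>A. ennreal a \<le> I x"
    then have "ennreal a \<le> (INF x\<in>A. I x)" by (simp add: le_INF_iff)
    then have "ereal a \<le> enn2ereal (INF x\<in>A. I x)"
      using b by (subst (asm) ennreal_le_iff_ereal_le) auto
    then have "- enn2ereal (INF x\<in>A. I x) \<le> ereal (- a)" 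
      by (metis ereal_minus_le_minus uminus_ereal.simps(1))
    also have "\<dots> < ereal (- b)" using b by simp
    finally have "\<forall>\<^sub>F n in sequentially. ereal (1 / \<gamma> n) * log_prob (measure (\<mu> n) A) < ereal (- b)"
      using U unfolding ldp_upper_def Limsup_le_iff by blast
    then show "\<forall>\<^sub>F n in sequentially. measure (\<mu> n) A \<le> exp (- (\<gamma> n * b))"
      by eventually_elim (use g in \<open>auto simp: scaled_log_prob_less_iff\<close>)
  qed
next
  assume R: ?R
  show "ldp_upper T \<mu> \<gamma> I A"
    unfolding ldp_upper_def Limsup_le_iff
  proof (intro allI impI)
    fix y assume y: "y > - enn2ereal (INF x\<in>A. I x)"
    have p1: "measure (\<mu> n) A \<le> 1" for n
      using mu by (simp add: prob_space.prob_le_1)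
    show "\<forall>\<^sub>F n in sequentially. ereal (1 / \<gamma> n) * log_prob (measure (\<mu> n) A) < y"
    proof (cases y)
      case PInf
      have "ereal (1 / \<gamma> n) * log_prob (measure (\<mu> n) A) < \<infinity>" for n
        using g[of n] by (auto simp: log_prob_def)
      then show ?thesis using PInf by simp
    next
      case MInf
      then show ?thesis using y by simp
    next
      case (real r)
      show ?thesis
      proof (cases "r > 0")
        case True
        have "measure (\<mu> n) A < exp (\<gamma> n * r)" for n
          using p1[of n] g[of n] True by (smt (verit) mult_pos_pos one_less_exp_iff)
        then show ?thesis using real g by (simp add: scaled_log_prob_less_iff)
      next
        case False
        have "ereal (- r) < enn2ereal (INF x\<in>A. I x)"
          using y real by (metis ereal_uminus_less_reorder uminus_ereal.simps(1))
        then obtain a where a: "ereal (- r) < ereal a" "ereal a < enn2ereal (INF x\<in>A. I x)"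
          using ereal_dense2 by blast
        then have "ennreal a \<le> (INF x\<in>A. I x)"
          using False by (subst ennreal_le_iff_ereal_le) auto
        then have "\<forall>x\<in>A. ennreal a \<le> I x" by (simp add: le_INF_iff)
        \<comment> \<open>The exponent is the midpoint of -r and a, which turns the eventual bound
          into the strict inequality required at r.\<close>
        then have "\<forall>\<^sub>F n in sequentially. measure (\<mu> n) A \<le> exp (- (\<gamma> n * ((a - r) / 2)))"
          using R[rule_format, of "(a - r) / 2" a] a False by (auto simp del: minus_divide_left)
        then show ?thesis
        proof eventually_elim
          case (elim n)
          have "- ((a - r) / 2) < r" using a(1) by (simp add: field_simps)
          then have "\<gamma> n * - ((a - r) / 2) < \<gamma> n * r"
            using g[of n] by (intro mult_strict_left_mono) auto
          then have "exp (- (\<gamma> n * ((a - r) / 2))) < exp (\<gamma> n * r)" by simp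
          with elim have "measure (\<mu> n) A < exp (\<gamma> n * r)" by linarith
          then show ?case using real g by (simp add: scaled_log_prob_less_iff)
        qed
      qed
    qed
  qed
qed

text \<open>The infimum is tested point by point: points of infinite rate impose nothing, and a
  finite rate is approached by real a strictly above it.\<close>

lemma ldp_lower_iff:
  assumes g: "\<And>n. 0 < \<gamma> n"
  shows "ldp_lower T \<mu> \<gamma> I A \<longleftrightarrow>
    (\<forall>x\<in>A. \<forall>a>0. I x < ennreal a \<longrightarrow>
       (\<forall>\<^sub>F n in sequentially. exp (- (\<gamma> n * a)) \<le> measure (\<mu> n) A))" (is "_ \<longleftrightarrow> ?R")
proof
  assume L: "ldp_lower T \<mu> \<gamma> I A"
  show ?R
  proof (intro ballI allI impI)
    fix x and a :: real assume x: "x \<in> A" "a > 0" "I x < ennreal a"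
    then have "(INF x\<in>A. I x) < ennreal a" by (meson INF_lower le_less_trans)
    then have "enn2ereal (INF x\<in>A. I x) < ereal a" using x by (simp add: ennreal_less_iff_ereal_less)
    then have "ereal (- a) < - enn2ereal (INF x\<in>A. I x)"
      by (metis ereal_minus_less_minus uminus_ereal.simps(1))
    then have "\<forall>\<^sub>F n in sequentially. ereal (- a) < ereal (1 / \<gamma> n) * log_prob (measure (\<mu> n) A)"
      using L unfolding ldp_lower_def le_Liminf_iff by blast
    then show "\<forall>\<^sub>F n in sequentially. exp (- (\<gamma> n * a)) \<le> measure (\<mu> n) A"
      by eventually_elim (use g in \<open>auto simp: less_scaled_log_prob_iff\<close>)
  qed
next
  assume R: ?R
  show "ldp_lower T \<mu> \<gamma> I A"
    unfolding ldp_lower_def le_Liminf_iff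
  proof (intro allI impI)
    fix y assume y: "y < - enn2ereal (INF x\<in>A. I x)"
    then have "enn2ereal (INF x\<in>A. I x) < - y" by (simp add: ereal_less_uminus_reorder)
    then obtain a where a: "enn2ereal (INF x\<in>A. I x) < ereal a" "ereal a < - y"
      using ereal_dense2 by blast
    have "0 \<le> enn2ereal (INF x\<in>A. I x)" by simp
    then have a0: "a > 0" using a(1) by (metis le_less_trans ereal_less(2))
    then have "(INF x\<in>A. I x) < ennreal a" using a by (simp add: ennreal_less_iff_ereal_less)
    then obtain x where "x \<in> A" "I x < ennreal a" by (auto simp: INF_less_iff)
    then obtain "\<forall>\<^sub>F n in sequentially. exp (- (\<gamma> n * a)) \<le> measure (\<mu> n) A"
      using R a0 by blast
    then show "\<forall>\<^sub>F n in sequentially. y < ereal (1 / \<gamma> n) * log_prob (measure (\<mu> n) A)"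
    proof eventually_elim
      case (elim n)
      then have pos: "0 < measure (\<mu> n) A" by (meson exp_gt_zero less_le_trans)
      then have "exp (\<gamma> n * - a) \<le> measure (\<mu> n) A" using elim by simp
      then have "ereal (- a) \<le> ereal (1 / \<gamma> n) * log_prob (measure (\<mu> n) A)"
        using g[of n] pos by (subst not_less[symmetric], subst scaled_log_prob_less_iff) auto
      moreover have "y < ereal (- a)" using a by (metis ereal_less_uminus_reorder uminus_ereal.simps(1))
      ultimately show ?case by simp
    qed
  qed
qed

lemma eventually_sum_exp_le:
  fixes p :: "'i \<Rightarrow> nat \<Rightarrow> real"
  assumes g: "filterlim \<gamma> at_top sequentially" and "finite J"
    and p: "\<And>i. i \<in> J \<Longrightarrow> \<forall>\<^sub>F n in sequentially. p i n \<le> exp (- (\<gamma> n * b))"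
    and "b' < b"
  shows "\<forall>\<^sub>F n in sequentially. (\<Sum>i\<in>J. p i n) \<le> exp (- (\<gamma> n * b'))"
proof -
  have "\<forall>\<^sub>F n in sequentially. \<forall>i\<in>J. p i n \<le> exp (- (\<gamma> n * b))"
    using assms by (simp add: eventually_ball_finite)
  \<comment> \<open>The prefactor \<open>card J\<close> is paid for by the gap b - b'; the added 1
    keeps the argument of the logarithm positive when J is empty.\<close>
  moreover have "\<forall>\<^sub>F n in sequentially. \<gamma> n \<ge> ln (real (card J) + 1) / (b - b')"
    using g by (simp add: filterlim_at_top)
  ultimately show ?thesis
  proof eventually_elim
    case (elim n)
    have "ln (real (card J) + 1) \<le> \<gamma> n * (b - b')"
      using elim(2) \<open>b' < b\<close> by (simp add: pos_divide_le_eq)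
    then have *: "real (card J) + 1 \<le> exp (\<gamma> n * (b - b'))"
      by (metis add_nonneg_pos exp_le_cancel_iff exp_ln of_nat_0_le_iff zero_less_one)
    have "(\<Sum>i\<in>J. p i n) \<le> real (card J) * exp (- (\<gamma> n * b))"
      using elim(1) by (metis sum_bounded_above)
    also have "\<dots> \<le> exp (\<gamma> n * (b - b')) * exp (- (\<gamma> n * b))"
      using * by (intro mult_right_mono) auto
    also have "\<dots> = exp (- (\<gamma> n * b'))" by (simp add: exp_add[symmetric] algebra_simps)
    finally show ?case .
  qed
qed

subsection \<open>Borel measurability in topological spaces\<close>

lemma space_borel_of [simp]: "space (borel_of T) = topspace T"
  unfolding borel_of_def by (rule space_measure_of) (use openin_subset in auto)

lemma sets_borel_of: "sets (borel_of T) = sigma_sets (topspace T) {U. openin T U}"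
  unfolding borel_of_def by (rule sets_measure_of) (use openin_subset in auto)

lemma openin_in_borel_of: "openin T U \<Longrightarrow> U \<in> sets (borel_of T)"
  by (simp add: sets_borel_of)

lemma closedin_in_borel_of: "closedin T C \<Longrightarrow> C \<in> sets (borel_of T)"
proof -
  assume C: "closedin T C"
  then have "space (borel_of T) - (topspace T - C) \<in> sets (borel_of T)"
    by (intro sets.compl_sets openin_in_borel_of) blast
  moreover have "space (borel_of T) - (topspace T - C) = C"
    using closedin_subset[OF C] by (simp add: double_diff)
  ultimately show ?thesis by simp
qed

lemma measurable_borel_ofI:
  assumes "f \<in> space M \<rightarrow> topspace T"
    and "\<And>U. openin T U \<Longrightarrow> f -` U \<inter> space M \<in> sets M"
  shows "f \<in> measurable M (borel_of T)"
  unfolding borel_of_def using assms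
  by (intro measurable_measure_of) (auto dest: openin_subset)

lemma continuous_map_measurable_borel_of:
  assumes "continuous_map S T f"
  shows "f \<in> measurable (borel_of S) (borel_of T)"
proof (rule measurable_borel_ofI)
  show "f \<in> space (borel_of S) \<rightarrow> topspace T"
    using continuous_map_funspace[OF assms] by simp
  fix U assume "openin T U"
  then have "openin S {x \<in> topspace S. f x \<in> U}"
    using assms openin_continuous_map_preimage by blast
  moreover have "{x \<in> topspace S. f x \<in> U} = f -` U \<inter> space (borel_of S)" by auto
  ultimately show "f -` U \<inter> space (borel_of S) \<in> sets (borel_of S)"
    by (metis openin_in_borel_of)
qed

text \<open>Second countability writes every open set of the product as a countable union of open
  rectangles; without countability the union could leave the sigma-algebra.\<close>

lemma measurable_Pair_borel_of:
  assumes "second_countable S" "second_countable T"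
    and f: "f \<in> measurable M (borel_of S)" and g: "g \<in> measurable M (borel_of T)"
  shows "(\<lambda>x. (f x, g x)) \<in> measurable M (borel_of (prod_topology S T))"
proof (rule measurable_borel_ofI)
  show "(\<lambda>x. (f x, g x)) \<in> space M \<rightarrow> topspace (prod_topology S T)"
    using measurable_space[OF f] measurable_space[OF g] by auto
  fix W assume W: "openin (prod_topology S T) W"
  obtain \<B> where B: "countable \<B>" "\<And>V. V \<in> \<B> \<Longrightarrow> openin S V"
    "\<And>U x. openin S U \<Longrightarrow> x \<in> U \<Longrightarrow> \<exists>V \<in> \<B>. x \<in> V \<and> V \<subseteq> U"
    using assms(1) unfolding second_countable_def by metis
  obtain \<C> where C: "countable \<C>" "\<And>V. V \<in> \<C> \<Longrightarrow> openin T V"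
    "\<And>U x. openin T U \<Longrightarrow> x \<in> U \<Longrightarrow> \<exists>V \<in> \<C>. x \<in> V \<and> V \<subseteq> U"
    using assms(2) unfolding second_countable_def by metis
  define \<R> where "\<R> = {(U, V) \<in> \<B> \<times> \<C>. U \<times> V \<subseteq> W}"
  have "countable \<R>"
    by (rule countable_subset[of _ "\<B> \<times> \<C>"]) (auto simp: \<R>_def B C)
  have "\<exists>(U, V)\<in>\<R>. x \<in> U \<and> y \<in> V" if xy: "(x, y) \<in> W" for x y
  proof -
    obtain U V where UV: "openin S U" "openin T V" "x \<in> U" "y \<in> V" "U \<times> V \<subseteq> W"
      using W xy unfolding openin_prod_topology_alt by meson
    obtain U' V' where "U' \<in> \<B>" "x \<in> U'" "U' \<subseteq> U" "V' \<in> \<C>" "y \<in> V'" "V' \<subseteq> V"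
      using B(3)[OF UV(1,3)] C(3)[OF UV(2,4)] by blast
    with UV(5) have "(U', V') \<in> \<R>" "x \<in> U' \<and> y \<in> V'" by (auto simp: \<R>_def)
    then show ?thesis by blast
  qed
  then have "(\<lambda>x. (f x, g x)) -` W \<inter> space M =
      (\<Union>(U, V)\<in>\<R>. (f -` U \<inter> space M) \<inter> (g -` V \<inter> space M))"
    by (fastforce simp: \<R>_def)
  also have "\<dots> \<in> sets M"
    using \<open>countable \<R>\<close> f g
    by (intro sets.countable_UN'')
       (auto simp: \<R>_def intro!: sets.Int measurable_sets[of _ M] openin_in_borel_of B C)
  finally show "(\<lambda>x. (f x, g x)) -` W \<inter> space M \<in> sets M" .
qed

subsection \<open>Large deviations of products and images\<close>

text \<open>The clause c = 0 stands for the trivial lower bound 0 on the rate. Without it a point of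
  rate 0 would lie in none of these neighbourhoods with c \<ge> 0.\<close>

lemma openin_rate_function_above:
  assumes "rate_function T I"
  shows "openin T {x \<in> topspace T. c = 0 \<or> ennreal c < I x}"
proof (cases "c = 0")
  case False
  have "openin T (topspace T - {x \<in> topspace T. I x \<le> ennreal c})"
    using assms unfolding rate_function_def by blast
  moreover have "topspace T - {x \<in> topspace T. I x \<le> ennreal c} =
      {x \<in> topspace T. c = 0 \<or> ennreal c < I x}"
    using False by (auto simp: not_le)
  ultimately show ?thesis by simp
qed simp

text \<open>No nonnegative number lies strictly below a summand 0, hence the alternatives c = 0 and
  d = 0. An infinite summand can supply a + 1 on its own.\<close>

lemma ennreal_less_add_split:
  fixes u v :: ennreal
  assumes "ennreal a < u + v" "0 \<le> a"
  obtains c d where "0 \<le> c" "0 \<le> d" "c = 0 \<or> ennreal c < u" "d = 0 \<or> ennreal d < v" "a < c + d"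
proof -
  consider "u = \<infinity>" | "v = \<infinity>" | u' v' where "u = ennreal u'" "v = ennreal v'" "0 \<le> u'" "0 \<le> v'"
    by (metis ennreal_cases infinity_ennreal_def)
  then show thesis
  proof cases
    case 1
    then show ?thesis using assms by (intro that[of "a + 1" 0]) auto
  next
    case 2
    then show ?thesis using assms by (intro that[of 0 "a + 1"]) auto
  next
    case 3
    \<comment> \<open>Each summand gives up at most e, so 2 e of the excess 3 e is lost. Taking the
      minimum with u' or v' keeps both bounds nonnegative.\<close>
    define e where "e = (u' + v' - a) / 3"
    have "a < u' + v'" using assms 3 by (metis ennreal_less_iff ennreal_plus)
    then have e: "0 < e" by (simp add: e_def)
    show ?thesis
    proof (rule that[of "u' - min u' e" "v' - min v' e"])
      show "a < u' - min u' e + (v' - min v' e)"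
        using \<open>a < u' + v'\<close> by (simp add: e_def min_def field_simps)
    qed (use 3 e in \<open>auto simp: min_def ennreal_less_iff\<close>)
  qed
qed

text \<open>Splitting a strict lower bound on the sum puts an open rectangle around every point
  above the level. Compactness follows because a level set of the sum is a closed part of the
  product of the two level sets.\<close>

lemma good_rate_function_add:
  assumes I: "good_rate_function S I" and J: "good_rate_function T J"
  shows "good_rate_function (prod_topology S T) (\<lambda>(x, y). I x + J y)"
proof -
  have cl: "closedin (prod_topology S T) {p \<in> topspace (prod_topology S T). (case p of (x, y) \<Rightarrow> I x + J y) \<le> a}"
    (is "closedin _ ?L") for a
  proof (cases a)
    case top
    then show ?thesis by (auto simp: closedin_def)
  next
    case (real r)
    have "\<exists>D. openin (prod_topology S T) D \<and> p \<in> D \<and> D \<subseteq> topspace (prod_topology S T) - ?L"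
      if p: "p \<in> topspace (prod_topology S T) - ?L" for p
    proof -
      obtain x y where xy: "p = (x, y)" by (cases p)
      then have "ennreal r < I x + J y" using p real by auto
      then obtain c d where cd: "0 \<le> c" "0 \<le> d" "c = 0 \<or> ennreal c < I x"
          "d = 0 \<or> ennreal d < J y" "r < c + d"
        using ennreal_less_add_split real by blast
      let ?D = "{x \<in> topspace S. c = 0 \<or> ennreal c < I x} \<times> {y \<in> topspace T. d = 0 \<or> ennreal d < J y}"
      have "openin (prod_topology S T) ?D"
        using I J by (auto simp: openin_prod_Times_iff good_rate_function_def
            intro!: openin_rate_function_above)
      moreover have "p \<in> ?D" using p xy cd by auto
      moreover have "?D \<subseteq> topspace (prod_topology S T) - ?L"
      proof -
        have "ennreal r < I x' + J y'"
          if "c = 0 \<or> ennreal c < I x'" "d = 0 \<or> ennreal d < J y'" for x' y'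
        proof -
          have "ennreal r < ennreal c + ennreal d"
            using cd real by (metis ennreal_less_iff ennreal_plus)
          also have "\<dots> \<le> I x' + J y'"
            using that by (intro add_mono) auto
          finally show ?thesis .
        qed
        then have "ennreal r < I (fst q) + J (snd q)" if "q \<in> ?D" for q
          using that by auto
        then show ?thesis using real by (fastforce simp: not_le[symmetric])
      qed
      ultimately show ?thesis by blast
    qed
    then have "openin (prod_topology S T) (topspace (prod_topology S T) - ?L)"
      by (subst openin_subopen) blast
    then show ?thesis by (auto simp: closedin_def)
  qed
  moreover have "compactin (prod_topology S T)
      {p \<in> topspace (prod_topology S T). (case p of (x, y) \<Rightarrow> I x + J y) \<le> a}" if "a < \<infinity>" for a
  proof (rule closed_compactin[OF _ _ cl])
    show "compactin (prod_topology S T) ({x \<in> topspace S. I x \<le> a} \<times> {y \<in> topspace T. J y \<le> a})"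
      using I J that by (auto simp: compactin_Times good_rate_function_def)
  next
    show "{p \<in> topspace (prod_topology S T). (case p of (x, y) \<Rightarrow> I x + J y) \<le> a}
      \<subseteq> {x \<in> topspace S. I x \<le> a} \<times> {y \<in> topspace T. J y \<le> a}"
      by (auto intro: order_trans[rotated])
  qed
  ultimately show ?thesis
    by (simp add: good_rate_function_def rate_function_def)
qed

text \<open>The upper bound speaks of closed sets, whereas a compactness argument needs open
  neighbourhoods. Regularity separates x from a closed level set, so U lies in a closed set on which
  the rate is still large.\<close>

lemma LDP_local_upper:
  assumes g: "\<And>n. 0 < \<gamma> n" and ldp: "LDP T \<mu> \<gamma> I" and "regular_space T" "x \<in> topspace T"
    and c: "0 \<le> c" "c = 0 \<or> ennreal c < I x"
  obtains U where "openin T U" "x \<in> U"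
    "\<forall>\<^sub>F n in sequentially. measure (\<mu> n) U \<le> exp (- (\<gamma> n * c))"
proof (cases "c = 0")
  case True
  have "prob_space (\<mu> n)" for n using ldp by (simp add: LDP_def borel_probability_def)
  then have "measure (\<mu> n) (topspace T) \<le> 1" for n by (simp add: prob_space.prob_le_1)
  then show ?thesis using True assms that[of "topspace T"] by simp
next
  case False
  have mu: "prob_space (\<mu> n)" "sets (\<mu> n) = sets (borel_of T)" for n
    using ldp by (auto simp: LDP_def borel_probability_def)
  have "ennreal c < I x" using False c by simp
  \<comment> \<open>The upper bound at exponent c needs rates bounded below by some real number
    strictly above c.\<close>
  then obtain a' where a': "ennreal c < a'" "a' < I x" using dense by blast
  then obtain a where a: "a' = ennreal a" "0 \<le> a"
    by (metis ennreal_cases not_le top_greatest)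
  have "c < a" using a a' c by (simp add: ennreal_less_iff)
  have "closedin T {x \<in> topspace T. I x \<le> a'} \<and> x \<in> topspace T - {x \<in> topspace T. I x \<le> a'}"
    using ldp a' assms by (auto simp: LDP_def rate_function_def)
  then have "\<exists>U V. openin T U \<and> openin T V \<and> x \<in> U \<and> {x \<in> topspace T. I x \<le> a'} \<subseteq> V \<and> disjnt U V"
    using \<open>regular_space T\<close> unfolding regular_space_def by (elim allE) (erule mp)
  then obtain U V where UV: "openin T U" "openin T V" "x \<in> U" "{x \<in> topspace T. I x \<le> a'} \<subseteq> V" "disjnt U V"
    by blast
  let ?D = "topspace T - V"
  have D: "closedin T ?D" using UV by blast
  have "\<forall>x\<in>?D. ennreal a \<le> I x" 
  proof
    fix x assume "x \<in> ?D"
    then have "\<not> I x \<le> a'" using UV(4) by blast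
    then show "ennreal a \<le> I x" using a(1) by simp
  qed
  moreover have "ldp_upper T \<mu> \<gamma> I ?D" using ldp D by (simp add: LDP_def)
  ultimately have "\<forall>\<^sub>F n in sequentially. measure (\<mu> n) ?D \<le> exp (- (\<gamma> n * c))"
    using \<open>c < a\<close> c by (auto simp: ldp_upper_iff[OF g mu(1)])
  then have "\<forall>\<^sub>F n in sequentially. measure (\<mu> n) U \<le> exp (- (\<gamma> n * c))"
  proof eventually_elim
    case (elim n)
    interpret prob_space "\<mu> n" by (rule mu)
    have "measure (\<mu> n) U \<le> measure (\<mu> n) ?D"
      using UV D openin_subset[OF UV(1)]
      by (intro finite_measure_mono) (auto simp: mu disjnt_iff intro!: closedin_in_borel_of)
    with elim show ?case by simp
  qed
  with UV that show ?thesis by blast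
qed

lemma eventually_measure_finite_cover_le:
  assumes g: "filterlim \<gamma> at_top sequentially" and mu: "\<And>n. prob_space (\<mu> n)"
    and D: "finite D" "\<And>d n. d \<in> D \<Longrightarrow> d \<in> sets (\<mu> n)"
      "\<And>d. d \<in> D \<Longrightarrow> \<forall>\<^sub>F n in sequentially. measure (\<mu> n) d \<le> exp (- (\<gamma> n * b'))"
    and "C \<subseteq> \<Union>D" "b < b'"
  shows "\<forall>\<^sub>F n in sequentially. measure (\<mu> n) C \<le> exp (- (\<gamma> n * b))"
proof -
  have "\<forall>\<^sub>F n in sequentially. (\<Sum>d\<in>D. measure (\<mu> n) d) \<le> exp (- (\<gamma> n * b))"
    by (rule eventually_sum_exp_le[OF g D(1) _ \<open>b < b'\<close>]) (rule D(3))
  then show ?thesis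
  proof eventually_elim
    case (elim n)
    interpret prob_space "\<mu> n" by (rule mu)
    have "measure (\<mu> n) C \<le> measure (\<mu> n) (\<Union>d\<in>D. d)"
      using D assms(6) by (intro finite_measure_mono) auto
    also have "\<dots> \<le> (\<Sum>d\<in>D. measure (\<mu> n) d)"
      using D by (intro finite_measure_subadditive_finite) auto
    finally show ?case using elim by simp
  qed
qed

theorem LDP_product:
  assumes g: "\<And>n. 0 < \<gamma> n" "filterlim \<gamma> at_top sequentially"
    and S: "LDP S \<mu> \<gamma> I" "good_rate_function S I" "regular_space S"
    and T: "LDP T \<nu> \<gamma> J" "good_rate_function T J" "regular_space T"
    and rho: "\<And>n. borel_probability (prod_topology S T) (\<rho> n)"
    and rect: "\<And>n U V. U \<in> sets (borel_of S) \<Longrightarrow> V \<in> sets (borel_of T) \<Longrightarrow>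
      measure (\<rho> n) (U \<times> V) = measure (\<mu> n) U * measure (\<nu> n) V"
  shows "LDP (prod_topology S T) \<rho> \<gamma> (\<lambda>(x, y). I x + J y)"
proof -
  let ?P = "prod_topology S T" and ?I = "\<lambda>(x, y). I x + J y"
  have prob: "prob_space (\<mu> n)" "prob_space (\<nu> n)" "prob_space (\<rho> n)"
    and sets_rho: "sets (\<rho> n) = sets (borel_of ?P)" for n
    using S T rho by (auto simp: LDP_def borel_probability_def)
  have topS: "measure (\<mu> n) (topspace S) = 1" and topT: "measure (\<nu> n) (topspace T) = 1" for n
    using S T prob_space.prob_space[OF prob(1)[of n]] prob_space.prob_space[OF prob(2)[of n]]
    by (metis LDP_def borel_probability_def sets_eq_imp_space_eq space_borel_of)+
  have "ldp_lower ?P \<rho> \<gamma> ?I W" if W: "openin ?P W" for W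
    unfolding ldp_lower_iff[OF g(1)]
  proof (intro ballI allI impI)
    fix p and a :: real assume "p \<in> W" "0 < a" "?I p < ennreal a"
    then obtain x y where xy: "(x, y) \<in> W" "I x + J y < ennreal a" by (cases p) auto
    obtain U V where UV: "openin S U" "openin T V" "x \<in> U" "y \<in> V" "U \<times> V \<subseteq> W"
      using W xy(1) unfolding openin_prod_topology_alt by meson
    have "I x < \<top>" "J y < \<top>"
      using xy(2) by (metis ennreal_add_eq_top ennreal_less_top less_trans not_less_iff_gr_or_eq top.not_eq_extremum)+
    then obtain i j where ij: "I x = ennreal i" "J y = ennreal j" "0 \<le> i" "0 \<le> j"
      by (metis ennreal_cases less_irrefl)
    then have "i + j < a" using xy(2) by (metis add_nonneg_nonneg ennreal_less_iff ennreal_plus)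
    \<comment> \<open>Half of the slack in the exponent goes to each factor.\<close>
    define e where "e = (a - i - j) / 2"
    have e: "0 < e" using \<open>i + j < a\<close> by (simp add: e_def)
    have "ldp_lower S \<mu> \<gamma> I U" "ldp_lower T \<nu> \<gamma> J V" using S T UV by (auto simp: LDP_def)
    then have "\<forall>\<^sub>F n in sequentially. exp (- (\<gamma> n * (i + e))) \<le> measure (\<mu> n) U"
      "\<forall>\<^sub>F n in sequentially. exp (- (\<gamma> n * (j + e))) \<le> measure (\<nu> n) V"
      using UV ij e by (auto simp: ldp_lower_iff[OF g(1)] ennreal_less_iff)
    then show "\<forall>\<^sub>F n in sequentially. exp (- (\<gamma> n * a)) \<le> measure (\<rho> n) W"
    proof eventually_elim
      case (elim n)
      interpret prob_space "\<rho> n" by (rule prob)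
      have "exp (- (\<gamma> n * a)) = exp (- (\<gamma> n * (i + e))) * exp (- (\<gamma> n * (j + e)))"
        by (simp add: exp_add[symmetric] e_def field_simps)
      also have "\<dots> \<le> measure (\<mu> n) U * measure (\<nu> n) V"
        using elim by (intro mult_mono) auto
      also have "\<dots> = measure (\<rho> n) (U \<times> V)" using UV by (simp add: rect openin_in_borel_of)
      also have "\<dots> \<le> measure (\<rho> n) W"
        using UV W by (intro finite_measure_mono) (auto simp: sets_rho openin_in_borel_of)
      finally show ?case .
    qed
  qed
  moreover have "ldp_upper ?P \<rho> \<gamma> ?I C" if C: "closedin ?P C" for C
    unfolding ldp_upper_iff[OF g(1) prob(3)]
  proof (intro allI impI)
    fix a b :: real assume b: "0 \<le> b" "b < a" and a: "\<forall>p\<in>C. ennreal a \<le> ?I p"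
    \<comment> \<open>Local bounds hold with the midpoint b'; the remaining gap b' - b pays for the
      number of sets in the cover.\<close>
    define b' where "b' = (a + b) / 2"
    have b': "0 \<le> b'" "b < b'" "b' < a" using b by (auto simp: b'_def)
    let ?good = "\<lambda>d. d \<in> sets (borel_of ?P) \<and>
      (\<forall>\<^sub>F n in sequentially. measure (\<rho> n) d \<le> exp (- (\<gamma> n * b')))"
    \<comment> \<open>The whole of K \<times> L must be covered, not only its part in C, so that a
      rectangle fits inside the cover. Intersecting with C afterwards makes the neighbourhoods of
      points outside C harmless: there the intersection is empty.\<close>
    have local: "\<exists>W. openin ?P W \<and> p \<in> W \<and> ?good (W \<inter> C)"
      if p: "p \<in> topspace ?P" for p
    proof (cases "p \<in> C")
      case False
      have "openin ?P (topspace ?P - C)" using C by blast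
      moreover have "(topspace ?P - C) \<inter> C = {}" by blast
      ultimately show ?thesis using p False by (metis (no_types, lifting) DiffI sets.empty_sets
          eventually_sequentiallyI exp_ge_zero measure_empty)
    next
      case True
      obtain x y where xy: "p = (x, y)" by (cases p)
      have "ennreal b' < ennreal a" using b' by (simp add: ennreal_less_iff)
      also have "\<dots> \<le> I x + J y" using a True xy by auto
      finally obtain c d where cd: "0 \<le> c" "0 \<le> d" "c = 0 \<or> ennreal c < I x"
          "d = 0 \<or> ennreal d < J y" "b' < c + d"
        using ennreal_less_add_split b' by blast
      have x: "x \<in> topspace S" "y \<in> topspace T" using p xy by auto
      obtain U where U: "openin S U" "x \<in> U"
        "\<forall>\<^sub>F n in sequentially. measure (\<mu> n) U \<le> exp (- (\<gamma> n * c))"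
        using LDP_local_upper[where I = I, OF g(1) S(1,3) x(1) cd(1,3)] .
      obtain V where V: "openin T V" "y \<in> V"
        "\<forall>\<^sub>F n in sequentially. measure (\<nu> n) V \<le> exp (- (\<gamma> n * d))"
        using LDP_local_upper[where I = J, OF g(1) T(1,3) x(2) cd(2,4)] .
      have op: "openin ?P (U \<times> V)" using U V by (simp add: openin_prod_Times_iff)
      have m: "U \<times> V \<inter> C \<in> sets (borel_of ?P)"
        using op C by (intro sets.Int openin_in_borel_of closedin_in_borel_of)
      have "\<forall>\<^sub>F n in sequentially. measure (\<rho> n) (U \<times> V \<inter> C) \<le> exp (- (\<gamma> n * b'))"
        using U(3) V(3)
      proof eventually_elim
        case (elim n)
        interpret prob_space "\<rho> n" by (rule prob)
        have "measure (\<rho> n) (U \<times> V \<inter> C) \<le> measure (\<rho> n) (U \<times> V)"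
          using op by (intro finite_measure_mono) (auto simp: sets_rho openin_in_borel_of)
        also have "\<dots> = measure (\<mu> n) U * measure (\<nu> n) V"
          using U V by (simp add: rect openin_in_borel_of)
        also have "\<dots> \<le> exp (- (\<gamma> n * c)) * exp (- (\<gamma> n * d))"
          using elim by (intro mult_mono) auto
        also have "\<dots> = exp (- (\<gamma> n * (c + d)))"
          by (simp add: exp_add[symmetric] field_simps)
        also have "\<dots> \<le> exp (- (\<gamma> n * b'))" using cd g(1)[of n] by simp
        finally show ?case .
      qed
      then show ?thesis using op U V m xy by blast
    qed
    then have "\<forall>p\<in>topspace ?P. \<exists>W. openin ?P W \<and> p \<in> W \<and> ?good (W \<inter> C)" by (rule ballI)
    from bchoice[OF this] obtain W
      where W: "\<And>p. p \<in> topspace ?P \<Longrightarrow> openin ?P (W p) \<and> p \<in> W p \<and> ?good (W p \<inter> C)"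
      by (elim exE) (rule that, erule bspec)
    define K where "K = {x \<in> topspace S. I x \<le> ennreal a}"
    define L where "L = {y \<in> topspace T. J y \<le> ennreal a}"
    have KL: "compactin S K" "compactin T L" using S T by (auto simp: K_def L_def good_rate_function_def)
    then have "compactin ?P (K \<times> L)" by (simp add: compactin_Times)
    moreover have KLt: "K \<times> L \<subseteq> topspace ?P" by (auto simp: K_def L_def)
    ultimately obtain \<F> where F: "finite \<F>" "\<F> \<subseteq> W ` (K \<times> L)" "K \<times> L \<subseteq> \<Union>\<F>"
      using W unfolding compactin_def by (smt (verit, best) UN_I imageE subset_iff)
    have "openin ?P (\<Union>\<F>)" using F W KLt by (intro openin_Union) blast
    \<comment> \<open>The tube lemma fits an open rectangle between K \<times> L and the finite
      cover. Its complement is the union of two closed cylinders; outside A, respectively B, the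
      marginal rate is at least a.\<close>
    then obtain A B where AB: "openin S A" "openin T B" "K \<subseteq> A" "L \<subseteq> B" "A \<times> B \<subseteq> \<Union>\<F>"
      using Wallace_theorem_prod_topology[OF KL _ F(3)] by metis
    define D where "D = (\<lambda>w. w \<inter> C) ` \<F> \<union> {(topspace S - A) \<times> topspace T, topspace S \<times> (topspace T - B)}"
    have 1: "?good ((topspace S - A) \<times> topspace T)"
    proof -
      have cl: "closedin S (topspace S - A)" using AB by blast
      then have "ldp_upper S \<mu> \<gamma> I (topspace S - A)" using S by (simp add: LDP_def)
      moreover have "\<forall>x\<in>topspace S - A. ennreal a \<le> I x"
        using AB(3) by (force simp: K_def)
      ultimately have "\<forall>\<^sub>F n in sequentially. measure (\<mu> n) (topspace S - A) \<le> exp (- (\<gamma> n * b'))"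
        using b' unfolding ldp_upper_iff[OF g(1) prob(1)] by blast
      moreover have "measure (\<rho> n) ((topspace S - A) \<times> topspace T) = measure (\<mu> n) (topspace S - A)" for n
        using cl by (simp add: rect closedin_in_borel_of topT)
      moreover have "closedin ?P ((topspace S - A) \<times> topspace T)"
        using cl by (simp add: closedin_prod_Times_iff)
      ultimately show ?thesis by (simp add: closedin_in_borel_of)
    qed
    have 2: "?good (topspace S \<times> (topspace T - B))"
    proof -
      have cl: "closedin T (topspace T - B)" using AB by blast
      then have "ldp_upper T \<nu> \<gamma> J (topspace T - B)" using T by (simp add: LDP_def)
      moreover have "\<forall>y\<in>topspace T - B. ennreal a \<le> J y"
        using AB(4) by (force simp: L_def)
      ultimately have "\<forall>\<^sub>F n in sequentially. measure (\<nu> n) (topspace T - B) \<le> exp (- (\<gamma> n * b'))"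
        using b' unfolding ldp_upper_iff[OF g(1) prob(2)] by blast
      moreover have "measure (\<rho> n) (topspace S \<times> (topspace T - B)) = measure (\<nu> n) (topspace T - B)" for n
        using cl by (simp add: rect closedin_in_borel_of topS)
      moreover have "closedin ?P (topspace S \<times> (topspace T - B))"
        using cl by (simp add: closedin_prod_Times_iff)
      ultimately show ?thesis by (simp add: closedin_in_borel_of)
    qed
    have "?good (w \<inter> C)" if w: "w \<in> \<F>" for w
    proof -
      obtain p where "p \<in> K \<times> L" "w = W p" using F(2) w by blast
      then show ?thesis using W[of p] KLt by blast
    qed
    then have D: "finite D" "\<And>d. d \<in> D \<Longrightarrow> ?good d"
      using F(1) 1 2 unfolding D_def by blast+
    show "\<forall>\<^sub>F n in sequentially. measure (\<rho> n) C \<le> exp (- (\<gamma> n * b))"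
    proof (rule eventually_measure_finite_cover_le[OF g(2) prob(3) D(1) _ _ _ b'(2)])
      show "d \<in> sets (\<rho> n)" "\<forall>\<^sub>F n in sequentially. measure (\<rho> n) d \<le> exp (- (\<gamma> n * b'))"
        if "d \<in> D" for d n
        using D(2)[OF that] by (auto simp: sets_rho)
      show "C \<subseteq> \<Union>D"
        using closedin_subset[OF C] AB(5) by (fastforce simp: D_def)
    qed
  qed
  ultimately show ?thesis
    using good_rate_function_add[OF S(2) T(2)] rho by (simp add: LDP_def good_rate_function_def)
qed

theorem contraction_principle:
  assumes g: "\<And>n. 0 < \<gamma> n" and ldp: "LDP S \<mu> \<gamma> I" and good: "good_rate_function S I"
    and f: "continuous_map S T f" and T: "Hausdorff_space T"
  shows "LDP T (\<lambda>n. distr (\<mu> n) (borel_of T) f) \<gamma> (\<lambda>y. INF x\<in>{x \<in> topspace S. f x = y}. I x)"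
proof -
  let ?J = "\<lambda>y. INF x\<in>{x \<in> topspace S. f x = y}. I x"
  let ?\<nu> = "\<lambda>n. distr (\<mu> n) (borel_of T) f"
  have mu: "prob_space (\<mu> n)" and sets_mu: "sets (\<mu> n) = sets (borel_of S)" for n
    using ldp by (auto simp: LDP_def borel_probability_def)
  have meas: "f \<in> measurable (\<mu> n) (borel_of T)" for n
    using continuous_map_measurable_borel_of[OF f] sets_mu measurable_cong_sets by blast
  then have nu: "prob_space (?\<nu> n)" for n
    using mu prob_space.prob_space_distr by blast
  have space_mu: "space (\<mu> n) = topspace S" for n
    using sets_eq_imp_space_eq[OF sets_mu] by simp
  have meas_nu: "measure (?\<nu> n) A = measure (\<mu> n) {x \<in> topspace S. f x \<in> A}"
    if "A \<in> sets (borel_of T)" for A n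
    using that meas by (subst measure_distr) (auto simp: space_mu intro!: arg_cong[of _ _ "measure _"])
  have "closedin T {y \<in> topspace T. ?J y \<le> a}" for a
  proof (cases "a = \<infinity>")
    case True
    then show ?thesis by simp
  next
    case False
    \<comment> \<open>Intersecting over levels b > a avoids showing that the infimum over a fibre is
      attained. The levels stay finite because goodness gives compactness only there; compact images
      are closed in a Hausdorff space.\<close>
    have "{y \<in> topspace T. ?J y \<le> a} = (\<Inter>b\<in>{a<..<\<infinity>}. f ` {x \<in> topspace S. I x \<le> b})" (is "?A = ?B")
    proof (intro equalityI subsetI)
      fix y assume y: "y \<in> ?A"
      show "y \<in> ?B"
      proof
        fix b assume "b \<in> {a<..<\<infinity>}"
        then have "?J y < b" using y by auto
        then obtain x where "x \<in> topspace S" "f x = y" "I x < b" by (auto simp: INF_less_iff)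
        then show "y \<in> f ` {x \<in> topspace S. I x \<le> b}" by force
      qed
    next
      fix y assume y: "y \<in> ?B"
      have "?J y \<le> b" if "b \<in> {a<..<\<infinity>}" for b
        using y that by (force intro: INF_lower2)
      then have "?J y \<le> a"
        using False by (intro dense_ge_bounded[of a \<infinity>]) (auto simp: top.not_eq_extremum)
      moreover obtain b where "b \<in> {a<..<\<infinity>}"
        using False dense[of a \<infinity>] by (auto simp: top.not_eq_extremum)
      then have "y \<in> topspace T"
        using y continuous_map_image_subset_topspace[OF f] by fast
      ultimately show "y \<in> ?A" by simp
    qed
    also have "closedin T \<dots>"
    proof (rule closedin_INT)
      show "{a<..<\<infinity>} \<noteq> {}" using False dense[of a \<infinity>] by (auto simp: top.not_eq_extremum)
      fix b assume "b \<in> {a<..<\<infinity>}"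
      then have "compactin S {x \<in> topspace S. I x \<le> b}" using good by (auto simp: good_rate_function_def)
      then show "closedin T (f ` {x \<in> topspace S. I x \<le> b})"
        using image_compactin[OF _ f] compactin_imp_closedin[OF T] by blast
    qed
    finally show ?thesis .
  qed
  moreover have "ldp_lower T ?\<nu> \<gamma> ?J A" if A: "openin T A" for A
    unfolding ldp_lower_iff[OF g]
  proof (intro ballI allI impI)
    fix y and a :: real assume "y \<in> A" "0 < a" "?J y < ennreal a"
    then obtain x where x: "x \<in> topspace S" "f x = y" "I x < ennreal a" by (auto simp: INF_less_iff)
    have op: "openin S {x \<in> topspace S. f x \<in> A}" using f A openin_continuous_map_preimage by blast
    then have "ldp_lower S \<mu> \<gamma> I {x \<in> topspace S. f x \<in> A}" using ldp by (simp add: LDP_def)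
    then show "\<forall>\<^sub>F n in sequentially. exp (- (\<gamma> n * a)) \<le> measure (?\<nu> n) A"
      unfolding ldp_lower_iff[OF g] meas_nu[OF openin_in_borel_of[OF A]]
      using x \<open>y \<in> A\<close> \<open>0 < a\<close> by auto
  qed
  moreover have "ldp_upper T ?\<nu> \<gamma> ?J A" if A: "closedin T A" for A
    unfolding ldp_upper_iff[OF g nu]
  proof (intro allI impI)
    fix a b :: real assume ab: "0 \<le> b" "b < a" "\<forall>y\<in>A. ennreal a \<le> ?J y"
    have cl: "closedin S {x \<in> topspace S. f x \<in> A}" using f A closedin_continuous_map_preimage by blast
    then have "ldp_upper S \<mu> \<gamma> I {x \<in> topspace S. f x \<in> A}" using ldp by (simp add: LDP_def)
    moreover have "\<forall>x\<in>{x \<in> topspace S. f x \<in> A}. ennreal a \<le> I x"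
      using ab(3) by (auto simp: le_INF_iff)
    ultimately show "\<forall>\<^sub>F n in sequentially. measure (?\<nu> n) A \<le> exp (- (\<gamma> n * b))"
      unfolding ldp_upper_iff[OF g mu] meas_nu[OF closedin_in_borel_of[OF A]]
      using ab by blast
  qed
  ultimately show ?thesis
    using nu by (simp add: LDP_def rate_function_def borel_probability_def)
qed

section \<open>Passage from laws to random elements\<close>

lemma LDP_imp_weak_LDP: "Hausdorff_space T \<Longrightarrow> LDP T \<mu> \<gamma> I \<Longrightarrow> weak_LDP T \<mu> \<gamma> I"
  by (auto simp: LDP_def weak_LDP_def compactin_imp_closedin)

lemma random_LDP_product:
  assumes "prob_space M" and g: "\<And>n. 0 < \<gamma> n" "filterlim \<gamma> at_top sequentially"
    and S: "second_countable S" "regular_space S" "random_LDP M S V \<gamma> I" "good_rate_function S I"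
    and T: "second_countable T" "regular_space T" "random_LDP M T W \<gamma> J" "good_rate_function T J"
    and indep: "indep_families M S V T W"
  shows "random_LDP M (prod_topology S T) (\<lambda>n \<omega>. (V n \<omega>, W n \<omega>)) \<gamma> (\<lambda>(x, y). I x + J y)"
proof -
  interpret prob_space M by fact
  have V: "V n \<in> measurable M (borel_of S)" and W: "W n \<in> measurable M (borel_of T)" for n
    using S T by (auto simp: random_LDP_def)
  have VW: "(\<lambda>\<omega>. (V n \<omega>, W n \<omega>)) \<in> measurable M (borel_of (prod_topology S T))" for n
    by (intro measurable_Pair_borel_of S T V W)
  have "LDP (prod_topology S T) (\<lambda>n. distr M (borel_of (prod_topology S T)) (\<lambda>\<omega>. (V n \<omega>, W n \<omega>)))
      \<gamma> (\<lambda>(x, y). I x + J y)"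
  proof (rule LDP_product[OF g])
    show "LDP S (\<lambda>n. distr M (borel_of S) (V n)) \<gamma> I" "LDP T (\<lambda>n. distr M (borel_of T) (W n)) \<gamma> J"
      using S T by (auto simp: random_LDP_def)
    show "borel_probability (prod_topology S T) (distr M (borel_of (prod_topology S T)) (\<lambda>\<omega>. (V n \<omega>, W n \<omega>)))" for n
      unfolding borel_probability_def using prob_space_distr[OF VW] by simp
    fix n A B assume A: "A \<in> sets (borel_of S)" and B: "B \<in> sets (borel_of T)"
    have AB: "A \<times> B \<in> sets (borel_of (prod_topology S T))"
    proof -
      have "fst \<in> measurable (borel_of (prod_topology S T)) (borel_of S)"
        "snd \<in> measurable (borel_of (prod_topology S T)) (borel_of T)"
        by (intro continuous_map_measurable_borel_of continuous_map_fst continuous_map_snd)+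
      then have "(fst -` A \<inter> space (borel_of (prod_topology S T))) \<inter>
          (snd -` B \<inter> space (borel_of (prod_topology S T))) \<in> sets (borel_of (prod_topology S T))"
        by (rule sets.Int[OF measurable_sets[OF _ A] measurable_sets[OF _ B]])
      moreover have "(fst -` A \<inter> space (borel_of (prod_topology S T))) \<inter>
          (snd -` B \<inter> space (borel_of (prod_topology S T))) = A \<times> B"
        using sets.sets_into_space[OF A] sets.sets_into_space[OF B] by auto
      ultimately show ?thesis by simp
    qed
    have "prob ((V n -` A \<inter> space M) \<inter> (W n -` B \<inter> space M)) = prob (V n -` A \<inter> space M) * prob (W n -` B \<inter> space M)"
      using indep A B unfolding indep_families_def
      by (intro indep_setD[where A = "sigma_sets (space M) {V n -` A \<inter> space M |n A. A \<in> sets (borel_of S)}"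
            and B = "sigma_sets (space M) {W n -` A \<inter> space M |n A. A \<in> sets (borel_of T)}"])
         (auto intro!: sigma_sets.Basic)
    moreover have "(\<lambda>\<omega>. (V n \<omega>, W n \<omega>)) -` (A \<times> B) \<inter> space M = (V n -` A \<inter> space M) \<inter> (W n -` B \<inter> space M)"
      by auto
    ultimately show "measure (distr M (borel_of (prod_topology S T)) (\<lambda>\<omega>. (V n \<omega>, W n \<omega>))) (A \<times> B) =
        measure (distr M (borel_of S) (V n)) A * measure (distr M (borel_of T) (W n)) B"
      by (simp add: measure_distr V W VW A B AB)
  qed (use S T in auto)
  then show ?thesis using VW by (simp add: random_LDP_def)
qed

text \<open>J is constrained only on the target space and Z only on the sample space, so that an
  explicit formula can replace the infimum over fibres.\<close>

lemma random_contraction_principle: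
  assumes g: "\<And>n. 0 < \<gamma> n" and V: "random_LDP M S V \<gamma> I" and good: "good_rate_function S I"
    and f: "continuous_map S T f" and T: "Hausdorff_space T"
    and Z: "\<And>n \<omega>. \<omega> \<in> space M \<Longrightarrow> Z n \<omega> = f (V n \<omega>)"
    and J: "\<And>y. y \<in> topspace T \<Longrightarrow> J y = (INF x\<in>{x \<in> topspace S. f x = y}. I x)"
  shows "random_LDP M T Z \<gamma> J"
proof -
  let ?J = "\<lambda>y. INF x\<in>{x \<in> topspace S. f x = y}. I x"
  have Vm: "V n \<in> measurable M (borel_of S)" for n using V by (simp add: random_LDP_def)
  have fm: "f \<in> measurable (borel_of S) (borel_of T)" by (rule continuous_map_measurable_borel_of[OF f])
  have Zm: "Z n \<in> measurable M (borel_of T)" for n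
    using measurable_comp[OF Vm fm, of n] by (simp cong: measurable_cong add: Z)
  have "distr (distr M (borel_of S) (V n)) (borel_of T) f = distr M (borel_of T) (Z n)" for n
    by (simp add: distr_distr[OF fm Vm]) (intro distr_cong; simp add: Z)
  then have ldp: "LDP T (\<lambda>n. distr M (borel_of T) (Z n)) \<gamma> ?J"
    using contraction_principle[where \<gamma> = \<gamma> and \<mu> = "\<lambda>n. distr M (borel_of S) (V n)", OF g _ good f T] V by (simp add: random_LDP_def)
  have "LDP T (\<lambda>n. distr M (borel_of T) (Z n)) \<gamma> J"
  proof -
    have "{y \<in> topspace T. J y \<le> a} = {y \<in> topspace T. ?J y \<le> a}" for a using J by auto
    then have "rate_function T J" using ldp unfolding LDP_def rate_function_def by simp
    moreover have "(INF y\<in>A. J y) = (INF y\<in>A. ?J y)" if "A \<subseteq> topspace T" for A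
      using J that by (intro INF_cong) auto
    then have "ldp_lower T \<mu> \<gamma> J A = ldp_lower T \<mu> \<gamma> ?J A" "ldp_upper T \<mu> \<gamma> J A = ldp_upper T \<mu> \<gamma> ?J A"
      if "A \<subseteq> topspace T" for A \<mu>
      using that by (simp_all add: ldp_lower_def ldp_upper_def)
    ultimately show ?thesis using ldp unfolding LDP_def by (meson closedin_subset openin_subset)
  qed
  with Zm show ?thesis by (simp add: random_LDP_def)
qed

subsection \<open>Continuous functions on the unit interval\<close>

lemma Bcontfun_unit_ivl_inverse:
  fixes f :: "unit_ivl \<Rightarrow> real"
  shows "continuous_on UNIV f \<Longrightarrow> apply_bcontfun (Bcontfun f) = f"
  by (simp add: Bcontfun_inverse bcontfun_unit_ivl_iff)

lemma continuous_on_time_of: "continuous_on S time_of"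
  by (auto simp: continuous_on_iff dist_unit_ivl_def)

text \<open>Bernstein polynomials with rational coefficients are dense. A list of n + 1 rationals
  encodes one of them, its length fixing the degree n.\<close>

lemma ex_countable_dense_C01: "\<exists>D :: C01 set. countable D \<and> (\<forall>f. \<forall>e>0. \<exists>d\<in>D. dist f d < e)"
proof -
  define P :: "rat list \<Rightarrow> unit_ivl \<Rightarrow> real" where
    "P qs = (\<lambda>t. \<Sum>k\<le>length qs - 1. real_of_rat (qs ! k) * Bernstein (length qs - 1) k (time_of t))" for qs
  have contP: "continuous_on UNIV (P qs)" for qs
    unfolding P_def Bernstein_def
    by (intro continuous_intros continuous_on_compose2[OF continuous_on_time_of[of UNIV]]) auto
  define D where "D = range (\<lambda>qs. Bcontfun (P qs) :: C01)"
  have "\<exists>d\<in>D. dist f d < e" if e: "e > 0" for f :: C01 and e :: real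
  proof -
    \<comment> \<open>The approximation theorem concerns functions of a real variable. Outside [0,1]
      the values of g are unspecified, but only its restriction to [0,1] matters.\<close>
    define g where "g = (\<lambda>x. f (Abs_unit_ivl x))"
    have "continuous_on {0..1} Abs_unit_ivl"
      by (auto simp: continuous_on_iff dist_unit_ivl_def Abs_unit_ivl_inverse)
    then have "continuous_on {0..1} g"
      unfolding g_def by (rule continuous_on_compose2[OF continuous_on_apply_bcontfun]) auto
    then obtain n where n: "\<And>x. x \<in> {0..1} \<Longrightarrow> \<bar>g x - (\<Sum>k\<le>n. g (k / n) * Bernstein n k x)\<bar> < e / 3"
      using Bernstein_Weierstrass[of g "e / 3"] e by fastforce
    have "\<exists>q::rat. \<bar>g (k / n) - real_of_rat q\<bar> < e / 3" for k :: nat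
    proof -
      obtain q where "g (k / n) - e / 3 < real_of_rat q" "real_of_rat q < g (k / n) + e / 3"
        using of_rat_dense[of "g (k / n) - e / 3" "g (k / n) + e / 3"] e by auto
      then have "\<bar>g (k / n) - real_of_rat q\<bar> < e / 3" by linarith
      then show ?thesis by blast
    qed
    then obtain q where q: "\<And>k::nat. \<bar>g (k / n) - real_of_rat (q k)\<bar> < e / 3"
      by metis
    define qs where "qs = map q [0..<Suc n]"
    have P: "P qs t = (\<Sum>k\<le>n. real_of_rat (q k) * Bernstein n k (time_of t))" for t
      unfolding P_def qs_def by (intro sum.cong) (auto simp del: upt_Suc)
    \<comment> \<open>One third of e is spent on the Bernstein approximation and one third on
      rounding. The rounding errors do not accumulate, since the Bernstein weights are nonnegative
      with sum 1. The last third makes the supremum strictly smaller than e.\<close>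
    have "dist f (Bcontfun (P qs)) \<le> 2 * e / 3"
    proof (rule dist_bound)
      fix t :: unit_ivl
      define x where "x = time_of t"
      have x: "x \<in> {0..1}" "g x = f t" using time_of[of t] by (auto simp: x_def g_def time_of_inverse)
      have "\<bar>(\<Sum>k\<le>n. g (k / n) * Bernstein n k x) - P qs t\<bar>
          = \<bar>\<Sum>k\<le>n. (g (k / n) - real_of_rat (q k)) * Bernstein n k x\<bar>"
        by (simp add: P x_def sum_subtractf left_diff_distrib)
      also have "\<dots> \<le> (\<Sum>k\<le>n. \<bar>(g (k / n) - real_of_rat (q k)) * Bernstein n k x\<bar>)"
        by (rule sum_abs)
      also have "\<dots> \<le> (\<Sum>k\<le>n. e / 3 * Bernstein n k x)"
      proof (rule sum_mono)
        fix k
        show "\<bar>(g (k / n) - real_of_rat (q k)) * Bernstein n k x\<bar> \<le> e / 3 * Bernstein n k x"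
          using mult_right_mono[OF less_imp_le[OF q[of k]], of "Bernstein n k x"] x
          by (simp add: abs_mult Bernstein_nonneg)
      qed
      also have "\<dots> = e / 3 * (\<Sum>k\<le>n. Bernstein n k x)" by (rule sum_distrib_left[symmetric])
      also have "\<dots> = e / 3" by simp
      finally show "dist (f t) (Bcontfun (P qs) t) \<le> 2 * e / 3"
        using n[OF x(1)] unfolding Bcontfun_unit_ivl_inverse[OF contP] dist_real_def x(2) by linarith
    qed
    also have "\<dots> < e" using e by simp
    finally show ?thesis by (auto simp: D_def)
  qed
  then show ?thesis by (intro exI[of _ D]) (auto simp: D_def)
qed

text \<open>Closed balls are used because \<open>dist d f \<le> r\<close> is an intersection of
  conditions on single coordinates, which fails for the strict inequality. The interiors carry the
  topology.\<close>

lemma ex_countable_cball_base_C01: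
  "\<exists>\<B> :: C01 set set. countable \<B> \<and> (\<forall>B\<in>\<B>. \<exists>d r. B = cball d r \<and> 0 < r) \<and>
     (\<forall>U x. open U \<longrightarrow> x \<in> U \<longrightarrow> (\<exists>B\<in>\<B>. x \<in> interior B \<and> B \<subseteq> U))"
proof -
  obtain D :: "C01 set" where D: "countable D" "\<And>f e. e > 0 \<Longrightarrow> \<exists>d\<in>D. dist f d < e"
    using ex_countable_dense_C01 by blast
  define \<B> where "\<B> = (\<lambda>(d, m). cball d (inverse (real (Suc m)))) ` (D \<times> UNIV)"
  have "\<exists>B\<in>\<B>. x \<in> interior B \<and> B \<subseteq> U" if U: "open U" "x \<in> U" for U x
  proof -
    obtain e where e: "e > 0" "ball x e \<subseteq> U" using openE[OF U] .
    obtain m where m: "inverse (real (Suc m)) < e / 2" using reals_Archimedean[of "e / 2"] e by auto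
    let ?r = "inverse (real (Suc m))"
    obtain d where d: "d \<in> D" "dist x d < ?r" using D(2)[of ?r x] by auto
    have "ball d ?r \<subseteq> interior (cball d ?r)" by (simp add: interior_maximal ball_subset_cball)
    then have "x \<in> interior (cball d ?r)" using d by (auto simp: dist_commute)
    moreover have "cball d ?r \<subseteq> ball x e"
    proof
      fix z assume "z \<in> cball d ?r"
      then have "dist x z \<le> dist x d + ?r" using dist_triangle[of x z d] by simp
      then show "z \<in> ball x e" using d m by simp
    qed
    ultimately show ?thesis using e d by (force simp: \<B>_def)
  qed
  moreover have "countable \<B>" using D(1) by (simp add: \<B>_def)
  moreover have "\<forall>B\<in>\<B>. \<exists>d r. B = cball d r \<and> 0 < r"
    by (force simp: \<B>_def)
  ultimately show ?thesis by blast
qed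

lemma second_countable_C01: "second_countable (euclidean :: C01 topology)"
proof -
  obtain \<B> :: "C01 set set" where B: "countable \<B>"
    "\<And>U x. open U \<Longrightarrow> x \<in> U \<Longrightarrow> \<exists>B\<in>\<B>. x \<in> interior B \<and> B \<subseteq> U"
    using ex_countable_cball_base_C01 by blast
  show ?thesis
    unfolding second_countable_def
  proof (intro exI[of _ "interior ` \<B>"] conjI ballI allI impI)
    fix U and x :: C01 assume "openin euclidean U \<and> x \<in> U"
    then obtain C where "C \<in> \<B>" "x \<in> interior C" "C \<subseteq> U" using B(2)[of U x] by auto
    then show "\<exists>V\<in>interior ` \<B>. x \<in> V \<and> V \<subseteq> U" using interior_subset[of C] by blast
  qed (use B(1) in auto)
qed

lemma ex_countable_dense_unit_ivl: "\<exists>Q :: unit_ivl set. countable Q \<and> closure Q = UNIV"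
proof -
  have "\<exists>k. finite k \<and> (\<forall>t::unit_ivl. \<exists>q\<in>k. dist q t < inverse (real (Suc n)))" for n
    using seq_compact_imp_totally_bounded[OF compact_UNIV_unit_ivl[unfolded compact_eq_seq_compact_metric],
        rule_format, of "inverse (real (Suc n))"]
    by (force simp: subset_iff)
  then obtain k where k: "\<And>n. finite (k n)"
    "\<And>n (t::unit_ivl). \<exists>q\<in>k n. dist q t < inverse (real (Suc n))" by metis
  have "t \<in> closure (\<Union>n. k n)" for t
    unfolding closure_approachable
    by (meson k(2) reals_Archimedean less_trans UN_I UNIV_I)
  then show ?thesis
    using k(1) by (intro exI[of _ "\<Union>n. k n"]) (auto intro: countable_finite)
qed

text \<open>By continuity a closed ball is cut out by the coordinates at a countable dense set of
  times, and an open set is a countable union of such balls. Hence evaluations generate the Borel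
  sets of the uniform topology.\<close>

lemma borel_measurable_C01I:
  fixes X :: "'w \<Rightarrow> C01"
  assumes X: "\<And>t. (\<lambda>\<omega>. X \<omega> t) \<in> borel_measurable M"
  shows "X \<in> measurable M (borel_of euclidean)"
proof (rule measurable_borel_ofI)
  fix U :: "C01 set" assume U: "openin euclidean U"
  obtain \<B> :: "C01 set set" where B: "countable \<B>" "\<And>B. B \<in> \<B> \<Longrightarrow> \<exists>d r. B = cball d r \<and> 0 < r"
    "\<And>U x. open U \<Longrightarrow> x \<in> U \<Longrightarrow> \<exists>B\<in>\<B>. x \<in> interior B \<and> B \<subseteq> U"
    using ex_countable_cball_base_C01 by metis
  obtain Q :: "unit_ivl set" where Q: "countable Q" "closure Q = UNIV"
    using ex_countable_dense_unit_ivl by blast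
  have "X -` cball d r \<inter> space M \<in> sets M" for d r
  proof (cases "0 \<le> r")
    case True
    have "dist d f \<le> r \<longleftrightarrow> (\<forall>q\<in>Q. dist (d q) (f q) \<le> r)" for f :: C01
    proof
      assume "\<forall>q\<in>Q. dist (d q) (f q) \<le> r"
      then have "Q \<subseteq> {t. dist (d t) (f t) \<le> r}" by auto
      moreover have "closed {t. dist (d t) (f t) \<le> r}"
        by (intro closed_Collect_le continuous_intros continuous_on_apply_bcontfun)
      ultimately have "UNIV \<subseteq> {t. dist (d t) (f t) \<le> r}" using Q by (metis closure_minimal)
      then show "dist d f \<le> r" by (intro dist_bound) auto
    qed (use dist_bounded order_trans in blast)
    moreover have "Q \<noteq> {}" using Q(2) by auto
    ultimately have "X -` cball d r \<inter> space M = (\<Inter>q\<in>Q. {\<omega> \<in> space M. dist (d q) (X \<omega> q) \<le> r})"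
      by auto
    also have "\<dots> \<in> sets M"
      using Q(1) \<open>Q \<noteq> {}\<close> X by (intro sets.countable_INT') auto
    finally show ?thesis .
  qed auto
  then have "(\<Union>B\<in>{B \<in> \<B>. B \<subseteq> U}. X -` B \<inter> space M) \<in> sets M"
    using B(1,2) by (intro sets.countable_UN'') (auto dest!: B(2))
  also have "(\<Union>B\<in>{B \<in> \<B>. B \<subseteq> U}. X -` B \<inter> space M) = X -` U \<inter> space M"
  proof (intro equalityI subsetI)
    fix \<omega> assume "\<omega> \<in> X -` U \<inter> space M"
    moreover then obtain B where "B \<in> \<B>" "X \<omega> \<in> interior B" "B \<subseteq> U" using B(3)[of U "X \<omega>"] U by auto
    ultimately show "\<omega> \<in> (\<Union>B\<in>{B \<in> \<B>. B \<subseteq> U}. X -` B \<inter> space M)" using interior_subset[of B] by blast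
  qed blast
  finally show "X -` U \<inter> space M \<in> sets M" .
qed auto

section \<open>The pointwise product and the environment space\<close>

definition times_C01 :: "C01 \<Rightarrow> C01 \<Rightarrow> C01" where
  "times_C01 f g = Bcontfun (\<lambda>t. f t * g t)"

lemma times_C01_apply [simp]: "times_C01 f g t = f t * g t"
proof -
  have "continuous_on UNIV (\<lambda>t. f t * g t)" by (intro continuous_on_mult continuous_on_apply_bcontfun)
  then show ?thesis by (simp add: times_C01_def Bcontfun_unit_ivl_inverse)
qed

lemma norm_times_C01_le: "norm (times_C01 f g) \<le> norm f * norm g"
  by (rule norm_bound) (auto simp: norm_mult simp del: real_norm_def intro!: mult_mono norm_bounded)

text \<open>This yields joint continuity of the product in the uniform topology, the analytic input
  to the contraction map.\<close>

lemma bounded_bilinear_times_C01: "bounded_bilinear times_C01"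
proof
  show "\<exists>K. \<forall>a b. norm (times_C01 a b) \<le> norm a * norm b * K"
    by (rule exI[of _ 1]) (simp add: norm_times_C01_le)
qed (auto intro!: bcontfun_eqI simp: algebra_simps)

lemma topspace_env_space [simp]: "topspace (env_space \<alpha>) = C_ge \<alpha> \<times> UNIV"
  by (simp add: env_space_def)

lemma metrizable_env_space: "metrizable_space (env_space \<alpha>)"
  unfolding env_space_def
  by (auto simp: metrizable_space_prod_topology intro!: metrizable_space_subtopology metrizable_space_euclidean)

lemma second_countable_prod_topology:
  assumes "second_countable S" "second_countable T"
  shows "second_countable (prod_topology S T)"
proof -
  obtain \<B> where B: "countable \<B>" "\<And>V. V \<in> \<B> \<Longrightarrow> openin S V"
    "\<And>U x. openin S U \<Longrightarrow> x \<in> U \<Longrightarrow> \<exists>V \<in> \<B>. x \<in> V \<and> V \<subseteq> U"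
    using assms(1) unfolding second_countable_def by metis
  obtain \<C> where C: "countable \<C>" "\<And>V. V \<in> \<C> \<Longrightarrow> openin T V"
    "\<And>U x. openin T U \<Longrightarrow> x \<in> U \<Longrightarrow> \<exists>V \<in> \<C>. x \<in> V \<and> V \<subseteq> U"
    using assms(2) unfolding second_countable_def by metis
  show ?thesis
    unfolding second_countable_def
  proof (intro exI conjI ballI allI impI)
    show "countable ((\<lambda>(U, V). U \<times> V) ` (\<B> \<times> \<C>))" using B C by auto
    show "openin (prod_topology S T) W" if "W \<in> (\<lambda>(U, V). U \<times> V) ` (\<B> \<times> \<C>)" for W
      using that B C by (auto simp: openin_prod_Times_iff)
    fix W p assume W: "openin (prod_topology S T) W \<and> p \<in> W"
    obtain x y where p: "p = (x, y)" by (cases p)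
    obtain U V where UV: "openin S U" "openin T V" "x \<in> U" "y \<in> V" "U \<times> V \<subseteq> W"
      using W p unfolding openin_prod_topology_alt by meson
    obtain U' V' where "U' \<in> \<B>" "x \<in> U'" "U' \<subseteq> U" "V' \<in> \<C>" "y \<in> V'" "V' \<subseteq> V"
      using B(3)[OF UV(1,3)] C(3)[OF UV(2,4)] by blast
    with UV(5) p show "\<exists>V\<in>(\<lambda>(U, V). U \<times> V) ` (\<B> \<times> \<C>). p \<in> V \<and> V \<subseteq> W"
      by (intro bexI[of _ "U' \<times> V'"]) auto
  qed
qed

lemma second_countable_env_space: "second_countable (env_space \<alpha>)"
  unfolding env_space_def
  by (intro second_countable_prod_topology second_countable_subtopology second_countable_C01)

lemma continuous_map_affine_C01:
  "continuous_map (prod_topology euclidean (env_space \<alpha>)) euclidean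
     (\<lambda>(x, y1, y2). times_C01 x y1 + y2)"
proof -
  have "continuous_on UNIV (\<lambda>p :: C01 \<times> C01 \<times> C01. times_C01 (fst p) (fst (snd p)) + snd (snd p))"
    by (intro continuous_intros bounded_bilinear.continuous_on[OF bounded_bilinear_times_C01])
  then have "continuous_map euclidean euclidean (\<lambda>(x, y1, y2). times_C01 x y1 + y2)"
    by (simp add: case_prod_beta)
  moreover have "prod_topology euclidean (env_space \<alpha>) =
      subtopology euclidean (UNIV \<times> C_ge \<alpha> \<times> UNIV)"
    unfolding env_space_def
    by (simp add: subtopology_Times flip: prod_topology_euclidean)
  ultimately show ?thesis by (metis continuous_map_from_subtopology)
qed

subsection \<open>Gaussian processes\<close>

text \<open>Completing the square: an exponential tilt of a centered normal law shifts its mean by s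
  times the variance and leaves the Laplace transform as a factor.\<close>

lemma normal_density_mult_exp:
  assumes "0 < \<sigma>"
  shows "normal_density 0 \<sigma> x * exp (s * x) = exp (s\<^sup>2 * \<sigma>\<^sup>2 / 2) * normal_density (s * \<sigma>\<^sup>2) \<sigma> x"
proof -
  have "- (x - 0)\<^sup>2 / (2 * \<sigma>\<^sup>2) + s * x = s\<^sup>2 * \<sigma>\<^sup>2 / 2 + - (x - s * \<sigma>\<^sup>2)\<^sup>2 / (2 * \<sigma>\<^sup>2)"
    using assms by (simp add: field_simps power2_eq_square)
  then show ?thesis
    by (simp add: normal_density_def exp_add[symmetric] mult.assoc)
qed

lemma (in prob_space) centered_gaussian_rvD:
  assumes "centered_gaussian_rv M V"
  shows centered_gaussian_rv_measurable: "V \<in> borel_measurable M"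
    and centered_gaussian_rv_integrable_square: "integrable M (\<lambda>\<omega>. (V \<omega>)\<^sup>2)"
    and centered_gaussian_rv_expectation: "expectation V = 0"
    and centered_gaussian_rv_integrable_exp: "integrable M (\<lambda>\<omega>. exp (s * V \<omega>))"
    and centered_gaussian_rv_expectation_exp:
      "expectation (\<lambda>\<omega>. exp (s * V \<omega>)) = exp (s\<^sup>2 * expectation (\<lambda>\<omega>. (V \<omega>)\<^sup>2) / 2)"
proof -
  show V[measurable]: "V \<in> borel_measurable M" using assms by (simp add: centered_gaussian_rv_def)
  \<comment> \<open>The degenerate law has no density and is treated apart; its second moment is 0,
    so the exponential formula reads 1 = 1.\<close>
  consider "AE \<omega> in M. V \<omega> = 0" | \<sigma> where "0 < \<sigma>" "distributed M lborel V (normal_density 0 \<sigma>)"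
    using assms by (auto simp: centered_gaussian_rv_def)
  then have "integrable M (\<lambda>\<omega>. (V \<omega>)\<^sup>2) \<and> expectation V = 0 \<and> integrable M (\<lambda>\<omega>. exp (s * V \<omega>)) \<and>
    expectation (\<lambda>\<omega>. exp (s * V \<omega>)) = exp (s\<^sup>2 * expectation (\<lambda>\<omega>. (V \<omega>)\<^sup>2) / 2)"
  proof cases
    case 1
    have "integrable M (\<lambda>\<omega>. (V \<omega>)\<^sup>2) \<longleftrightarrow> integrable M (\<lambda>\<omega>. 0::real)"
      "integrable M (\<lambda>\<omega>. exp (s * V \<omega>)) \<longleftrightarrow> integrable M (\<lambda>\<omega>. 1::real)"
      by (rule integrable_cong_AE; use 1 in auto)+
    moreover have "expectation V = expectation (\<lambda>_. 0)"
      "expectation (\<lambda>\<omega>. (V \<omega>)\<^sup>2) = expectation (\<lambda>_. 0)"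
      "expectation (\<lambda>\<omega>. exp (s * V \<omega>)) = expectation (\<lambda>_. 1)"
      by (rule integral_cong_AE; use 1 in auto)+
    ultimately show ?thesis by (simp add: prob_space)
  next
    case (2 \<sigma>)
    have E: "expectation V = 0"
      by (rule normal_distributed_expectation[OF 2])
    moreover have "expectation (\<lambda>\<omega>. (V \<omega>)\<^sup>2) = \<sigma>\<^sup>2"
      using normal_distributed_variance[OF 2] E by simp
    moreover have "integrable M (\<lambda>\<omega>. (V \<omega>)\<^sup>2)"
      using integrable_normal_moment[OF 2(1), of 0 2]
      by (subst distributed_integrable[OF 2(2), symmetric]) auto
    moreover have "integrable M (\<lambda>\<omega>. exp (s * V \<omega>))"
      using 2(1) by (subst distributed_integrable[OF 2(2), symmetric]) (auto simp: normal_density_mult_exp)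
    moreover have "expectation (\<lambda>\<omega>. exp (s * V \<omega>)) = exp (s\<^sup>2 * \<sigma>\<^sup>2 / 2)"
      using 2(1) by (subst distributed_integral[OF 2(2), symmetric]) (auto simp: normal_density_mult_exp)
    ultimately show ?thesis by simp
  qed
  then show "integrable M (\<lambda>\<omega>. (V \<omega>)\<^sup>2)" "expectation V = 0" "integrable M (\<lambda>\<omega>. exp (s * V \<omega>))"
    "expectation (\<lambda>\<omega>. exp (s * V \<omega>)) = exp (s\<^sup>2 * expectation (\<lambda>\<omega>. (V \<omega>)\<^sup>2) / 2)" by auto
qed

lemma integrable_mult_of_squares:
  fixes f g :: "'a \<Rightarrow> real"
  assumes [measurable]: "f \<in> borel_measurable M" "g \<in> borel_measurable M"
    and "integrable M (\<lambda>x. (f x)\<^sup>2)" "integrable M (\<lambda>x. (g x)\<^sup>2)"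
  shows "integrable M (\<lambda>x. f x * g x)"
proof (rule Bochner_Integration.integrable_bound)
  show "integrable M (\<lambda>x. (f x)\<^sup>2 + (g x)\<^sup>2)" using assms by simp
  show "AE x in M. norm (f x * g x) \<le> norm ((f x)\<^sup>2 + (g x)\<^sup>2)"
  proof (rule AE_I2)
    fix x
    have "2 * (\<bar>f x\<bar> * \<bar>g x\<bar>) \<le> (f x)\<^sup>2 + (g x)\<^sup>2"
      using sum_squares_bound[of "\<bar>f x\<bar>" "\<bar>g x\<bar>"] by (simp add: mult.assoc)
    moreover have "0 \<le> \<bar>f x\<bar> * \<bar>g x\<bar>" by simp
    moreover have "norm (f x * g x) = \<bar>f x\<bar> * \<bar>g x\<bar>" "norm ((f x)\<^sup>2 + (g x)\<^sup>2) = (f x)\<^sup>2 + (g x)\<^sup>2"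
      by (simp_all add: abs_mult)
    ultimately show "norm (f x * g x) \<le> norm ((f x)\<^sup>2 + (g x)\<^sup>2)" by linarith
  qed
qed measurable

lemma integrable_square_add:
  fixes f g :: "'a \<Rightarrow> real"
  assumes "f \<in> borel_measurable M" "g \<in> borel_measurable M"
    and "integrable M (\<lambda>x. (f x)\<^sup>2)" "integrable M (\<lambda>x. (g x)\<^sup>2)"
  shows "integrable M (\<lambda>x. (f x + g x)\<^sup>2)"
  using assms integrable_mult_of_squares[OF assms] by (simp add: power2_sum mult.assoc)

lemma integrable_square_diff:
  fixes f g :: "'a \<Rightarrow> real"
  assumes "f \<in> borel_measurable M" "g \<in> borel_measurable M"
    and "integrable M (\<lambda>x. (f x)\<^sup>2)" "integrable M (\<lambda>x. (g x)\<^sup>2)"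
  shows "integrable M (\<lambda>x. (f x - g x)\<^sup>2)"
  using assms integrable_mult_of_squares[OF assms] by (simp add: power2_diff mult.assoc)

locale gaussian_process = prob_space M for M :: "'w measure" +
  fixes U :: "'w \<Rightarrow> C01"
  assumes gaussian: "continuous_centered_gaussian_process M U"
begin

text \<open>No means are subtracted because the process is centered;
  \<open>covariance_function_eq_cov\<close> records the agreement with the covariance
  function.\<close>

definition cov :: "unit_ivl \<Rightarrow> unit_ivl \<Rightarrow> real" where
  "cov t s = expectation (\<lambda>\<omega>. U \<omega> t * U \<omega> s)"

lemma gaussian_sum: "finite F \<Longrightarrow> centered_gaussian_rv M (\<lambda>\<omega>. \<Sum>t\<in>F. c t * U \<omega> t)"
  using gaussian by (simp add: continuous_centered_gaussian_process_def)

lemma gaussian_eval: "centered_gaussian_rv M (\<lambda>\<omega>. U \<omega> t)"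
  using gaussian_sum[of "{t}" "\<lambda>_. 1"] by simp

lemma eval_measurable [measurable]: "(\<lambda>\<omega>. U \<omega> t) \<in> borel_measurable M"
  by (rule centered_gaussian_rv_measurable[OF gaussian_eval])

lemma integrable_eval_square: "integrable M (\<lambda>\<omega>. (U \<omega> t)\<^sup>2)"
  by (rule centered_gaussian_rv_integrable_square[OF gaussian_eval])

lemma integrable_eval_mult: "integrable M (\<lambda>\<omega>. U \<omega> t * U \<omega> s)"
  by (intro integrable_mult_of_squares integrable_eval_square) auto

lemma covariance_function_eq_cov: "covariance_function M U = cov"
  by (intro ext) (simp add: covariance_function_def cov_def centered_gaussian_rv_expectation[OF gaussian_eval])

lemma cov_commute: "cov t s = cov s t"
  by (simp add: cov_def mult.commute)

lemma expectation_sum_mult_sum: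
  "expectation (\<lambda>\<omega>. (\<Sum>t\<in>F. c t * U \<omega> t) * (\<Sum>s\<in>G. d s * U \<omega> s))
    = (\<Sum>t\<in>F. \<Sum>s\<in>G. c t * d s * cov t s)"
proof -
  have "expectation (\<lambda>\<omega>. (\<Sum>t\<in>F. c t * U \<omega> t) * (\<Sum>s\<in>G. d s * U \<omega> s))
    = expectation (\<lambda>\<omega>. \<Sum>t\<in>F. \<Sum>s\<in>G. (c t * d s) * (U \<omega> t * U \<omega> s))"
    by (simp add: sum_product mult_ac)
  also have "\<dots> = (\<Sum>t\<in>F. \<Sum>s\<in>G. expectation (\<lambda>\<omega>. (c t * d s) * (U \<omega> t * U \<omega> s)))"
    by (subst Bochner_Integration.integral_sum; (intro Bochner_Integration.integrable_sum sum.cong refl Bochner_Integration.integral_sum integrable_mult_right integrable_eval_mult)?)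
  finally show ?thesis by (simp add: cov_def)
qed

lemma expectation_sum_square:
  "expectation (\<lambda>\<omega>. (\<Sum>t\<in>F. c t * U \<omega> t)\<^sup>2) = (\<Sum>t\<in>F. \<Sum>s\<in>F. c t * c s * cov t s)"
  using expectation_sum_mult_sum[where F = F and G = F and c = c and d = c] by (simp add: power2_eq_square)

lemma expectation_exp_sum:
  assumes "finite F"
  shows "expectation (\<lambda>\<omega>. exp (\<Sum>t\<in>F. c t * U \<omega> t)) = exp ((\<Sum>t\<in>F. \<Sum>s\<in>F. c t * c s * cov t s) / 2)"
    and "integrable M (\<lambda>\<omega>. exp (\<Sum>t\<in>F. c t * U \<omega> t))"
  using centered_gaussian_rv_expectation_exp[OF gaussian_sum[OF assms], of 1 c]
    centered_gaussian_rv_integrable_exp[OF gaussian_sum[OF assms], of 1 c]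
  by (simp_all add: expectation_sum_square)

end

section \<open>Signed integrals and convergence of covariances\<close>

lemma signed_borel_measure_measure:
  assumes "finite_measure p" "sets p = sets borel"
  shows "signed_borel_measure (measure p)"
  unfolding signed_borel_measure_def
  using finite_measure.finite_measure_UNION[OF assms(1)] assms(2) by simp

text \<open>The integral chooses a Jordan decomposition by \<open>SOME\<close>, so uniqueness has to
  be shown. Positivity of p on -P, where p' vanishes, forces q to vanish there too; q also vanishes
  on P, hence everywhere.\<close>

lemma signed_integral_measure:
  assumes p: "finite_measure p" "sets p = sets borel"
  shows "signed_integral (measure p) h = (\<integral>t. h t \<partial>p)"
proof -
  have J: "jordan_decomposition (measure p) (p, null_measure borel)"
    unfolding jordan_decomposition_def prod.case
  proof (intro conjI ballI bexI[of _ UNIV])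
    show "finite_measure (null_measure (borel :: unit_ivl measure))" by (intro finite_measureI) simp
  qed (use p in \<open>auto simp: measure_def\<close>)
  have "p' = p \<and> q = null_measure borel" if pq: "jordan_decomposition (measure p) (p', q)" for p' q
  proof -
    obtain P where p': "finite_measure p'" "sets p' = sets borel" and q: "finite_measure q" "sets q = sets borel"
      and A: "\<And>A. A \<in> sets borel \<Longrightarrow> measure p A = measure p' A - measure q A"
      and P: "P \<in> sets borel" "measure p' (- P) = 0" "measure q P = 0"
      using pq by (auto simp: jordan_decomposition_def)
    interpret p: finite_measure p by (rule p)
    interpret p': finite_measure p' by (rule p')
    interpret q: finite_measure q by (rule q)
    have "- P \<in> sets borel" using P(1) by auto
    then have "measure q (- P) \<le> 0" using A[of "- P"] P(2) measure_nonneg[of p "- P"] by linarith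
    moreover have "measure q (P \<union> - P) = measure q P + measure q (- P)"
      using P(1) \<open>- P \<in> sets borel\<close> q by (intro q.finite_measure_Union) auto
    ultimately have q0: "measure q UNIV = 0" using P(3) measure_nonneg[of q "- P"] by simp
    have qA: "measure q A = 0" if "A \<in> sets borel" for A
      using q.finite_measure_mono[of A UNIV] q0 measure_nonneg[of q A] q that by simp
    have "q = null_measure borel"
      using q qA by (intro measure_eqI) (auto simp: q.emeasure_eq_measure)
    moreover have "p' = p"
      using p p' A qA by (intro measure_eqI) (auto simp: p.emeasure_eq_measure p'.emeasure_eq_measure)
    ultimately show ?thesis by simp
  qed
  then have "(SOME pq. jordan_decomposition (measure p) pq) = (p, null_measure borel)"
    using J by (intro some_equality) (assumption, metis surj_pair)
  then show ?thesis
    by (simp add: signed_integral_def integral_null_measure)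
qed

text \<open>Finite sums of Dirac measures, written as images of counting measures so that points may
  be repeated.\<close>

lemma signed_integral_counting:
  fixes f :: "'i \<Rightarrow> unit_ivl"
  assumes "finite I"
  defines "\<nu> \<equiv> measure (distr (count_space I) borel f)"
  shows "signed_borel_measure \<nu>"
    and "h \<in> borel_measurable borel \<Longrightarrow> signed_integral \<nu> h = (\<Sum>i\<in>I. h (f i))"
proof -
  have fin: "finite_measure (distr (count_space I) borel f)"
    using assms by (intro finite_measure.finite_measure_distr finite_measure_count_space) auto
  show "signed_borel_measure \<nu>"
    unfolding \<nu>_def using fin by (rule signed_borel_measure_measure) simp
  assume "h \<in> borel_measurable borel"
  then show "signed_integral \<nu> h = (\<Sum>i\<in>I. h (f i))"
    unfolding \<nu>_def using assms(1)
    by (subst signed_integral_measure[OF fin]) (auto simp: integral_distr lebesgue_integral_count_space_finite)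
qed

lemma scaled_cov_tendsto:
  assumes g: "\<And>n. gaussian_process M (X n)"
    and lim: "\<And>\<nu>. signed_borel_measure \<nu> \<Longrightarrow>
      (\<lambda>n. \<gamma> n * prob_space.variance M (\<lambda>\<omega>. signed_integral \<nu> (X n \<omega>)))
        \<longlonglongrightarrow> signed_integral \<nu> (\<lambda>s. signed_integral \<nu> (\<lambda>t. k t s))"
    and k: "continuous_on UNIV (\<lambda>(t, s). k t s)" "\<And>t s. k t s = k s t"
  shows "(\<lambda>n. \<gamma> n * gaussian_process.cov M (X n) t s) \<longlonglongrightarrow> k t s"
proof -
  interpret gaussian_process M "X n" for n by (rule g)
  have k_cont: "continuous_on UNIV (\<lambda>t. k t s)" "continuous_on UNIV (\<lambda>t. k s t)" for s
    using continuous_on_compose2[OF k(1) continuous_on_Pair[OF continuous_on_id continuous_on_const]]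
      continuous_on_compose2[OF k(1) continuous_on_Pair[OF continuous_on_const continuous_on_id]]
    by simp_all
  \<comment> \<open>Indexing by booleans instead of a set of times allows a repeated point: for t =
    s the measure is twice a Dirac mass, and the polarization formula stays valid.\<close>
  have key: "(\<lambda>n. \<gamma> n * expectation (\<lambda>\<omega>. (\<Sum>i\<in>I. X n \<omega> (f i))\<^sup>2)) \<longlonglongrightarrow> (\<Sum>i\<in>I. \<Sum>j\<in>I. k (f j) (f i))"
    if "finite I" for I :: "bool set" and f
  proof -
    let ?\<nu> = "measure (distr (count_space I) borel f)"
    have 1: "signed_integral ?\<nu> (X n \<omega>) = (\<Sum>i\<in>I. X n \<omega> (f i))" for n \<omega>
      by (intro signed_integral_counting that borel_measurable_continuous_onI continuous_on_apply_bcontfun)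
    have "signed_integral ?\<nu> (\<lambda>t. k t s) = (\<Sum>j\<in>I. k (f j) s)" for s
      by (intro signed_integral_counting that borel_measurable_continuous_onI k_cont)
    then have 2: "signed_integral ?\<nu> (\<lambda>s. signed_integral ?\<nu> (\<lambda>t. k t s)) = (\<Sum>i\<in>I. \<Sum>j\<in>I. k (f j) (f i))"
      by (simp only:) (intro signed_integral_counting that borel_measurable_sum
          borel_measurable_continuous_onI k_cont)
    have int: "integrable M (\<lambda>\<omega>. X n \<omega> t)" for n t
      by (rule square_integrable_imp_integrable[OF eval_measurable integrable_eval_square])
    have "expectation (\<lambda>\<omega>. \<Sum>i\<in>I. X n \<omega> (f i)) = 0" for n
      using int by (simp add: centered_gaussian_rv_expectation[OF gaussian_eval])
    then show ?thesis
      using lim[OF signed_integral_counting(1)[OF that, of f]] by (simp add: 1 2)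
  qed
  have diag: "(\<lambda>n. \<gamma> n * cov n t t) \<longlonglongrightarrow> k t t" for t
    using key[of "{True}" "\<lambda>_. t"] by (simp add: cov_def power2_eq_square)
  have "expectation (\<lambda>\<omega>. (X n \<omega> t + X n \<omega> s)\<^sup>2) = cov n t t + 2 * cov n t s + cov n s s" for n
    using integrable_eval_mult[of n t s] integrable_eval_square[of n t] integrable_eval_square[of n s]
    by (simp add: power2_sum cov_def mult.assoc) (simp add: power2_eq_square)
  then have "(\<lambda>n. \<gamma> n * (cov n t t + 2 * cov n t s + cov n s s)) \<longlonglongrightarrow> k t t + k t s + k s t + k s s"
    using key[of UNIV "\<lambda>b. if b then t else s"] by (simp add: UNIV_bool add_ac)
  then have "(\<lambda>n. (\<gamma> n * (cov n t t + 2 * cov n t s + cov n s s) - \<gamma> n * cov n t t - \<gamma> n * cov n s s) / 2)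
     \<longlonglongrightarrow> (k t t + k t s + k s t + k s s - k t t - k s s) / 2"
    by (intro tendsto_intros diag) auto
  then show ?thesis using k(2)[of s t] by (simp add: algebra_simps)
qed

subsection \<open>The dual form of the reproducing kernel norm\<close>

text \<open>This is \<open>cond_rate\<close> freed from the environment. Its argument is a plain
  function because the quotient (z - y2) / y1 is formed pointwise.\<close>

definition rkhs_rate :: "'v measure \<Rightarrow> ('v \<Rightarrow> C01) \<Rightarrow> (unit_ivl \<Rightarrow> real) \<Rightarrow> ennreal" where
  "rkhs_rate N U h = (if h \<in> rkhs N U then ennreal (1 / 2 * (rkhs_norm N U h)\<^sup>2) else \<infinity>)"

lemma integral_Cauchy_Schwarz:
  fixes f g :: "'a \<Rightarrow> real"
  assumes meas: "f \<in> borel_measurable M" "g \<in> borel_measurable M"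
    and int: "integrable M (\<lambda>x. (f x)\<^sup>2)" "integrable M (\<lambda>x. (g x)\<^sup>2)"
  shows "(\<integral>x. f x * g x \<partial>M)\<^sup>2 \<le> (\<integral>x. (f x)\<^sup>2 \<partial>M) * (\<integral>x. (g x)\<^sup>2 \<partial>M)"
proof -
  define A B C where "A = (\<integral>x. (f x)\<^sup>2 \<partial>M)" and "B = (\<integral>x. f x * g x \<partial>M)" and "C = (\<integral>x. (g x)\<^sup>2 \<partial>M)"
  have fg: "integrable M (\<lambda>x. f x * g x)" by (rule integrable_mult_of_squares[OF meas int])
  have *: "0 \<le> A - 2 * r * B + r\<^sup>2 * C" for r
  proof -
    have "0 \<le> (\<integral>x. (f x - r * g x)\<^sup>2 \<partial>M)" by simp
    also have "\<dots> = (\<integral>x. (f x)\<^sup>2 - 2 * r * (f x * g x) + r\<^sup>2 * (g x)\<^sup>2 \<partial>M)"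
      by (intro Bochner_Integration.integral_cong) (auto simp: power2_eq_square algebra_simps)
    also have "\<dots> = A - 2 * r * B + r\<^sup>2 * C"
      using int fg by (simp add: A_def B_def C_def)
    finally show ?thesis .
  qed
  have "0 \<le> C" by (simp add: C_def)
  have "B\<^sup>2 \<le> A * C"
  proof (cases "C = 0")
    case True
    \<comment> \<open>With C = 0 the quadratic is linear in r, and this choice of r would give it
      the value -1.\<close>
    have "B = 0" using *[of "(A + 1) / (2 * B)"] True by (cases "B = 0") auto
    then show ?thesis using True by simp
  next
    case False
    then show ?thesis using *[of "B / C"] \<open>0 \<le> C\<close> by (simp add: power2_eq_square field_simps)
  qed
  then show ?thesis by (simp add: A_def B_def C_def)
qed

text \<open>Squared distances of order 4^-n give L1 distances of order 2^-n, which are summable, so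
  the sequence converges almost surely. Fatou's lemma carries the L2 bounds to the limit.\<close>

lemma (in prob_space) L2_Cauchy_imp_limit:
  fixes W :: "nat \<Rightarrow> 'a \<Rightarrow> real"
  assumes [measurable]: "\<And>n. W n \<in> borel_measurable M"
    and int: "\<And>n. integrable M (\<lambda>x. (W n x)\<^sup>2)"
    and cauchy: "\<And>n m. n \<le> m \<Longrightarrow> expectation (\<lambda>x. (W n x - W m x)\<^sup>2) \<le> (1 / 4) ^ n"
  obtains V where "V \<in> borel_measurable M"
    "\<And>n. integrable M (\<lambda>x. (V x - W n x)\<^sup>2)"
    "\<And>n. expectation (\<lambda>x. (V x - W n x)\<^sup>2) \<le> (1 / 4) ^ n"
proof -
  have int_diff: "integrable M (\<lambda>x. (W n x - W m x)\<^sup>2)" for n m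
    by (intro integrable_square_diff int) auto
  have L1: "expectation (\<lambda>x. \<bar>W n x - W (Suc n) x\<bar>) \<le> (1 / 2) ^ n"
    and int1: "integrable M (\<lambda>x. \<bar>W n x - W (Suc n) x\<bar>)" for n
  proof -
    show i: "integrable M (\<lambda>x. \<bar>W n x - W (Suc n) x\<bar>)"
      using square_integrable_imp_integrable[OF _ int_diff[of n "Suc n"]] by auto
    have "(expectation (\<lambda>x. \<bar>W n x - W (Suc n) x\<bar>))\<^sup>2 \<le> expectation (\<lambda>x. (W n x - W (Suc n) x)\<^sup>2)"
      using variance_eq[OF i] int_diff[of n "Suc n"] variance_positive[of "\<lambda>x. \<bar>W n x - W (Suc n) x\<bar>"]
      by simp
    also have "\<dots> \<le> (1 / 4) ^ n" by (rule cauchy) simp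
    also have "\<dots> = ((1 / 2) ^ n)\<^sup>2" by (simp add: power_even_eq[symmetric] power_mult[symmetric] power_divide power2_eq_square flip: power_mult_distrib)
    finally show "expectation (\<lambda>x. \<bar>W n x - W (Suc n) x\<bar>) \<le> (1 / 2) ^ n"
      by (rule power2_le_imp_le) simp
  qed
  have "(\<integral>\<^sup>+x. (\<Sum>n. ennreal \<bar>W n x - W (Suc n) x\<bar>) \<partial>M) = (\<Sum>n. \<integral>\<^sup>+x. ennreal \<bar>W n x - W (Suc n) x\<bar> \<partial>M)"
    by (rule nn_integral_suminf) measurable
  also have "\<dots> = (\<Sum>n. ennreal (expectation (\<lambda>x. \<bar>W n x - W (Suc n) x\<bar>)))"
    using int1 by (simp add: nn_integral_eq_integral)
  also have "\<dots> \<le> (\<Sum>n. ennreal ((1 / 2) ^ n))"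
    using L1 by (intro suminf_le ennreal_leI) auto
  also have "\<dots> = ennreal (\<Sum>n. (1 / 2) ^ n)"
    by (intro suminf_ennreal2) auto
  also have "\<dots> < \<infinity>" by simp
  finally have "(\<integral>\<^sup>+x. (\<Sum>n. ennreal \<bar>W n x - W (Suc n) x\<bar>) \<partial>M) \<noteq> \<infinity>" by simp
  then have "AE x in M. (\<Sum>n. ennreal \<bar>W n x - W (Suc n) x\<bar>) \<noteq> \<infinity>"
    by (intro nn_integral_PInf_AE) measurable
  then have conv: "AE x in M. convergent (\<lambda>n. W n x)"
  proof eventually_elim
    case (elim x)
    then have "summable (\<lambda>n. \<bar>W n x - W (Suc n) x\<bar>)"
      by (intro summable_suminf_not_top) auto
    then have "summable (\<lambda>n. W n x - W (Suc n) x)" by (rule summable_rabs_cancel)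
    then have "convergent (\<lambda>n. \<Sum>i<n. W i x - W (Suc i) x)" by (simp add: summable_iff_convergent)
    then have "convergent (\<lambda>n. W 0 x - W n x)" by (simp only: sum_lessThan_telescope'[of "\<lambda>i. W i x"])
    then have "convergent (\<lambda>n. W 0 x - (W 0 x - W n x))" by (rule convergent_diff[OF convergent_const])
    then show ?case by (simp only: diff_diff_eq2 add_diff_cancel_left')
  qed
  \<comment> \<open>On the null set where convergence may fail \<open>lim\<close> has an unspecified
    value; V is measurable all the same.\<close>
  define V where "V = (\<lambda>x. lim (\<lambda>n. W n x))"
  have V[measurable]: "V \<in> borel_measurable M"
    unfolding V_def by (rule borel_measurable_lim_metric) measurable
  have le: "(\<integral>\<^sup>+x. ennreal ((V x - W n x)\<^sup>2) \<partial>M) \<le> ennreal ((1 / 4) ^ n)" for n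
  proof -
    have "AE x in M. ennreal ((V x - W n x)\<^sup>2) = liminf (\<lambda>m. ennreal ((W m x - W n x)\<^sup>2))"
      using conv
    proof eventually_elim
      case (elim x)
      then have "(\<lambda>m. W m x) \<longlonglongrightarrow> V x" by (simp add: V_def convergent_LIMSEQ_iff)
      then have "(\<lambda>m. ennreal ((W m x - W n x)\<^sup>2)) \<longlonglongrightarrow> ennreal ((V x - W n x)\<^sup>2)"
        by (intro tendsto_intros tendsto_ennrealI)
      then show ?case using lim_imp_Liminf[OF trivial_limit_sequentially] by metis
    qed
    then have "(\<integral>\<^sup>+x. ennreal ((V x - W n x)\<^sup>2) \<partial>M) = (\<integral>\<^sup>+x. liminf (\<lambda>m. ennreal ((W m x - W n x)\<^sup>2)) \<partial>M)"
      by (rule nn_integral_cong_AE)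
    also have "\<dots> \<le> liminf (\<lambda>m. \<integral>\<^sup>+x. ennreal ((W m x - W n x)\<^sup>2) \<partial>M)"
      by (rule nn_integral_liminf) measurable
    also have "\<dots> \<le> ennreal ((1 / 4) ^ n)"
    proof (rule Liminf_le)
      show "\<forall>\<^sub>F m in sequentially. (\<integral>\<^sup>+x. ennreal ((W m x - W n x)\<^sup>2) \<partial>M) \<le> ennreal ((1 / 4) ^ n)"
        using eventually_ge_at_top[of n]
      proof eventually_elim
        case (elim m)
        have "(\<integral>\<^sup>+x. ennreal ((W m x - W n x)\<^sup>2) \<partial>M) = ennreal (expectation (\<lambda>x. (W n x - W m x)\<^sup>2))"
          using int_diff[of n m] by (simp add: nn_integral_eq_integral power2_commute)
        then show ?case using cauchy[OF elim] by (simp add: ennreal_leI)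
      qed
    qed simp
    finally show ?thesis .
  qed
  have "integrable M (\<lambda>x. (V x - W n x)\<^sup>2)" for n
    using le[of n] by (intro integrableI_nonneg) (auto intro: le_less_trans)
  moreover have "expectation (\<lambda>x. (V x - W n x)\<^sup>2) \<le> (1 / 4) ^ n" for n
    using le[of n] by (subst integral_eq_nn_integral) (auto intro: enn2real_leI)
  ultimately show ?thesis using V that by blast
qed

section \<open>The dual functional and Riesz representation\<close>

context gaussian_process
begin

definition lin :: "unit_ivl set \<Rightarrow> (unit_ivl \<Rightarrow> real) \<Rightarrow> 'w \<Rightarrow> real" where
  "lin F c \<omega> = (\<Sum>t\<in>F. c t * U \<omega> t)"

text \<open>The log-Laplace dual: its supremum over \<open>F\<close> and \<open>c\<close> is the rate of \<open>x\<close>.\<close>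

definition dual :: "unit_ivl set \<Rightarrow> (unit_ivl \<Rightarrow> real) \<Rightarrow> (unit_ivl \<Rightarrow> real) \<Rightarrow> real" where
  "dual F c x = (\<Sum>t\<in>F. c t * x t) - (\<Sum>t\<in>F. \<Sum>s\<in>F. c t * c s * cov t s) / 2"

lemma lin_measurable [measurable]: "lin F c \<in> borel_measurable M"
  unfolding lin_def by measurable

lemma integrable_lin_square:
  assumes "finite F" shows "integrable M (\<lambda>\<omega>. (lin F c \<omega>)\<^sup>2)"
  unfolding lin_def by (rule centered_gaussian_rv_integrable_square[OF gaussian_sum[OF assms]])

lemma dual_eq: "dual F c x = (\<Sum>t\<in>F. c t * x t) - expectation (\<lambda>\<omega>. (lin F c \<omega>)\<^sup>2) / 2"
  by (simp add: dual_def lin_def expectation_sum_square)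

lemma expectation_lin_mult:
  assumes "V \<in> borel_measurable M" "integrable M (\<lambda>\<omega>. (V \<omega>)\<^sup>2)"
  shows "expectation (\<lambda>\<omega>. lin F c \<omega> * V \<omega>) = (\<Sum>t\<in>F. c t * rkhs_map M U V t)"
proof -
  have "integrable M (\<lambda>\<omega>. U \<omega> t * V \<omega>)" for t
    using assms by (intro integrable_mult_of_squares integrable_eval_square) auto
  then show ?thesis
    by (simp add: lin_def rkhs_map_def sum_distrib_right mult.assoc)
qed

text \<open>Cauchy-Schwarz: evaluation at t is a bounded functional on the Hilbert space with
  constant \<open>sqrt (cov t t)\<close>, so L2 convergence implies pointwise convergence of the
  images.\<close>

lemma abs_rkhs_map_diff_le:
  assumes V: "V \<in> borel_measurable M" "integrable M (\<lambda>\<omega>. (V \<omega>)\<^sup>2)"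
    and W: "W \<in> borel_measurable M" "integrable M (\<lambda>\<omega>. (W \<omega>)\<^sup>2)"
  shows "\<bar>rkhs_map M U V t - rkhs_map M U W t\<bar> \<le> sqrt (cov t t * expectation (\<lambda>\<omega>. (V \<omega> - W \<omega>)\<^sup>2))"
proof -
  have i: "integrable M (\<lambda>\<omega>. (V \<omega> - W \<omega>)\<^sup>2)" by (rule integrable_square_diff[OF V(1) W(1) V(2) W(2)])
  have "integrable M (\<lambda>\<omega>. U \<omega> t * V \<omega>)" "integrable M (\<lambda>\<omega>. U \<omega> t * W \<omega>)"
    using V W by (intro integrable_mult_of_squares integrable_eval_square; simp)+
  then have "rkhs_map M U V t - rkhs_map M U W t = expectation (\<lambda>\<omega>. U \<omega> t * (V \<omega> - W \<omega>))"
    by (simp add: rkhs_map_def right_diff_distrib)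
  moreover have "(expectation (\<lambda>\<omega>. U \<omega> t * (V \<omega> - W \<omega>)))\<^sup>2
      \<le> expectation (\<lambda>\<omega>. (U \<omega> t)\<^sup>2) * expectation (\<lambda>\<omega>. (V \<omega> - W \<omega>)\<^sup>2)"
    using V W by (intro integral_Cauchy_Schwarz integrable_eval_square i) auto
  ultimately show ?thesis
    by (intro real_le_rsqrt) (simp add: cov_def power2_eq_square)
qed

text \<open>Completing the square in L2. The loss against half the squared norm of V is half the
  squared distance from V to the combination, so for V in the closed span the supremum of the dual
  is exactly half the squared norm.\<close>

lemma dual_rkhs_map:
  assumes V: "V \<in> borel_measurable M" "integrable M (\<lambda>\<omega>. (V \<omega>)\<^sup>2)" and "finite F"
  shows "dual F c (rkhs_map M U V) =
    expectation (\<lambda>\<omega>. (V \<omega>)\<^sup>2) / 2 - expectation (\<lambda>\<omega>. (V \<omega> - lin F c \<omega>)\<^sup>2) / 2"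
proof -
  have i: "integrable M (\<lambda>\<omega>. lin F c \<omega> * V \<omega>)"
    by (intro integrable_mult_of_squares V integrable_lin_square assms) auto
  have "(V \<omega> - lin F c \<omega>)\<^sup>2 = (V \<omega>)\<^sup>2 + (lin F c \<omega>)\<^sup>2 - 2 * (lin F c \<omega> * V \<omega>)" for \<omega>
    by (simp add: power2_diff)
  then have "expectation (\<lambda>\<omega>. (V \<omega> - lin F c \<omega>)\<^sup>2) = expectation (\<lambda>\<omega>. (V \<omega>)\<^sup>2)
      + expectation (\<lambda>\<omega>. (lin F c \<omega>)\<^sup>2) - 2 * expectation (\<lambda>\<omega>. lin F c \<omega> * V \<omega>)"
    using V integrable_lin_square[OF assms(3)] i by simp
  then show ?thesis using expectation_lin_mult[OF V, of F c] unfolding dual_eq by linarith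
qed

lemma dual_le_of_rkhs_map:
  assumes "V \<in> gaussian_space M U" "finite F"
  shows "dual F c (rkhs_map M U V) \<le> expectation (\<lambda>\<omega>. (V \<omega>)\<^sup>2) / 2"
proof -
  have "0 \<le> expectation (\<lambda>\<omega>. (V \<omega> - lin F c \<omega>)\<^sup>2)" by simp
  then show ?thesis using assms by (subst dual_rkhs_map) (auto simp: gaussian_space_def)
qed

lemma gaussian_space_approx:
  assumes "V \<in> gaussian_space M U" "0 < e"
  obtains F c where "finite F" "expectation (\<lambda>\<omega>. (V \<omega> - lin F c \<omega>)\<^sup>2) < e"
proof -
  have "\<forall>e>0. \<exists>F c. finite F \<and> L2_norm M (\<lambda>\<omega>. V \<omega> - (\<Sum>t\<in>F. c t * U \<omega> t)) < e"
    using assms(1) by (simp add: gaussian_space_def)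
  then obtain F c where F: "finite F" "L2_norm M (\<lambda>\<omega>. V \<omega> - (\<Sum>t\<in>F. c t * U \<omega> t)) < sqrt e"
    using real_sqrt_gt_zero[OF assms(2)] by meson
  then have "expectation (\<lambda>\<omega>. (V \<omega> - lin F c \<omega>)\<^sup>2) < e" by (simp add: L2_norm_def lin_def)
  with F that show thesis by blast
qed

text \<open>The dual sees V only through its image, and its supremum is half the squared norm. This
  makes the definite description in \<open>rkhs_norm\<close> proper.\<close>

lemma expectation_square_eq_of_rkhs_map_eq:
  assumes "V \<in> gaussian_space M U" "V' \<in> gaussian_space M U" "rkhs_map M U V = rkhs_map M U V'"
  shows "expectation (\<lambda>\<omega>. (V \<omega>)\<^sup>2) = expectation (\<lambda>\<omega>. (V' \<omega>)\<^sup>2)"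
proof -
  have *: "expectation (\<lambda>\<omega>. (V \<omega>)\<^sup>2) \<le> expectation (\<lambda>\<omega>. (V' \<omega>)\<^sup>2)"
    if V: "V \<in> gaussian_space M U" "V' \<in> gaussian_space M U" "rkhs_map M U V = rkhs_map M U V'" for V V'
  proof (rule field_le_epsilon)
    fix e :: real assume "0 < e"
    then obtain F c where F: "finite F" "expectation (\<lambda>\<omega>. (V \<omega> - lin F c \<omega>)\<^sup>2) < e"
      using gaussian_space_approx V(1) by blast
    have "dual F c (rkhs_map M U V) \<le> expectation (\<lambda>\<omega>. (V' \<omega>)\<^sup>2) / 2"
      using dual_le_of_rkhs_map[OF V(2) F(1)] V(3) by simp
    then show "expectation (\<lambda>\<omega>. (V \<omega>)\<^sup>2) \<le> expectation (\<lambda>\<omega>. (V' \<omega>)\<^sup>2) + e"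
      using F V(1) by (subst (asm) dual_rkhs_map) (auto simp: gaussian_space_def)
  qed
  show ?thesis using *[OF assms] *[OF assms(2,1) assms(3)[symmetric]] by simp
qed

lemma rkhs_rate_rkhs_map:
  assumes "V \<in> gaussian_space M U"
  shows "rkhs_rate M U (rkhs_map M U V) = ennreal (expectation (\<lambda>\<omega>. (V \<omega>)\<^sup>2) / 2)"
proof -
  have "rkhs_norm M U (rkhs_map M U V) = L2_norm M V"
    unfolding rkhs_norm_def L2_norm_def
  proof (rule the_equality)
    fix r assume "\<exists>V'\<in>gaussian_space M U. rkhs_map M U V' = rkhs_map M U V \<and> r = sqrt (expectation (\<lambda>\<omega>. (V' \<omega>)\<^sup>2))"
    then show "r = sqrt (expectation (\<lambda>\<omega>. (V \<omega>)\<^sup>2))"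
      using expectation_square_eq_of_rkhs_map_eq[OF _ assms] by auto
  qed (use assms in blast)
  then show ?thesis using assms by (simp add: rkhs_rate_def rkhs_def L2_norm_def)
qed

lemma lin_extend:
  assumes "finite G" "F \<subseteq> G"
  shows "lin F c = lin G (\<lambda>t. if t \<in> F then c t else 0)"
    "(\<Sum>t\<in>F. c t * x t) = (\<Sum>t\<in>G. (if t \<in> F then c t else 0) * x t)"
proof -
  have *: "(\<Sum>t\<in>F. c t * x t) = (\<Sum>t\<in>G. (if t \<in> F then c t else 0) * x t)" for x
    using assms by (intro sum.mono_neutral_cong_left) auto
  show "lin F c = lin G (\<lambda>t. if t \<in> F then c t else 0)" by (rule ext) (simp only: lin_def *)
  show "(\<Sum>t\<in>F. c t * x t) = (\<Sum>t\<in>G. (if t \<in> F then c t else 0) * x t)" by (rule *)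
qed

text \<open>The supports may overlap with different coefficients, so both families are extended by
  zero to the union before they are added.\<close>

lemma lin_combination:
  assumes "finite F" "finite G"
  obtains H e where "finite H" "lin H e = (\<lambda>\<omega>. a * lin F c \<omega> + b * lin G d \<omega>)"
    "(\<Sum>t\<in>H. e t * x t) = a * (\<Sum>t\<in>F. c t * x t) + b * (\<Sum>t\<in>G. d t * x t)"
proof -
  let ?H = "F \<union> G"
  let ?c = "\<lambda>t. if t \<in> F then c t else 0" and ?d = "\<lambda>t. if t \<in> G then d t else 0"
  have fin: "finite ?H" using assms by simp
  have *: "(\<Sum>t\<in>?H. (a * ?c t + b * ?d t) * x t) = a * (\<Sum>t\<in>?H. ?c t * x t) + b * (\<Sum>t\<in>?H. ?d t * x t)" for x
    unfolding sum_distrib_left sum.distrib[symmetric] by (intro sum.cong) (auto simp: algebra_simps)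
  show thesis
  proof (rule that[OF fin])
    show "lin ?H (\<lambda>t. a * ?c t + b * ?d t) = (\<lambda>\<omega>. a * lin F c \<omega> + b * lin G d \<omega>)"
      unfolding lin_extend(1)[OF fin Un_upper1, of c] lin_extend(1)[OF fin Un_upper2, of d]
      by (rule ext) (simp only: lin_def *)
    show "(\<Sum>t\<in>?H. (a * ?c t + b * ?d t) * x t) = a * (\<Sum>t\<in>F. c t * x t) + b * (\<Sum>t\<in>G. d t * x t)"
      unfolding lin_extend(2)[OF fin Un_upper1, of c] lin_extend(2)[OF fin Un_upper2, of d] by (rule *)
  qed
qed

text \<open>Riesz representation: by the parallelogram law a maximizing sequence of the dual
  functional is Cauchy in \<open>L\<^sup>2\<close>, and its limit represents \<open>x\<close> by first-order optimality.\<close>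

lemma rkhs_rate_le_of_dual_le:
  assumes "0 \<le> a" and dual: "\<And>F c. finite F \<Longrightarrow> dual F c x \<le> a"
  shows "rkhs_rate M U x \<le> ennreal a"
proof -
  define S where "S = {dual F c x |F c. finite F}"
  define m where "m = Sup S"
  have S: "bdd_above S" "S \<noteq> {}" using dual by (auto simp: S_def bdd_above_def)
  have le_m: "dual F c x \<le> m" if "finite F" for F c
    unfolding m_def using S that by (intro cSup_upper) (auto simp: S_def)
  have "m \<le> a" unfolding m_def using S dual by (intro cSup_least) (auto simp: S_def)
  \<comment> \<open>The parallelogram estimate below multiplies the defect by 8, so this tolerance
    produces exactly the bound 4^-n required for completeness.\<close>
  have "\<exists>F c. finite F \<and> m - (1 / 4) ^ n / 8 < dual F c x" for n :: nat
  proof -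
    have "m - (1 / 4) ^ n / 8 < m" by simp
    then obtain y where "y \<in> S" "m - (1 / 4) ^ n / 8 < y"
      unfolding m_def using less_cSup_iff[OF S(2,1)] by blast
    then show ?thesis by (auto simp: S_def)
  qed
  then obtain F c where F: "\<And>n. finite (F n)" and near: "\<And>n. m - (1 / 4) ^ n / 8 < dual (F n) (c n) x"
    by metis
  define W where "W = (\<lambda>n. lin (F n) (c n))"
  have W_eq: "lin (F n) (c n) = W n" for n by (simp add: W_def)
  have W[measurable]: "W n \<in> borel_measurable M" for n by (simp add: W_def)
  have intW: "integrable M (\<lambda>\<omega>. (W n \<omega>)\<^sup>2)" for n by (simp add: W_def integrable_lin_square F)
  have intWW: "integrable M (\<lambda>\<omega>. W n \<omega> * W l \<omega>)" for n l
    by (intro integrable_mult_of_squares intW) auto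
  have dualW: "dual (F n) (c n) x = (\<Sum>t\<in>F n. c n t * x t) - expectation (\<lambda>\<omega>. (W n \<omega>)\<^sup>2) / 2" for n
    by (simp add: dual_eq W_def)
  have cauchy: "expectation (\<lambda>\<omega>. (W n \<omega> - W l \<omega>)\<^sup>2) \<le> (1 / 4) ^ n" if "n \<le> l" for n l
  proof -
    \<comment> \<open>The midpoint of two near-maximizers is again a competitor; strict concavity of
      the dual turns its excess over the average into a bound on their distance.\<close>
    obtain H e where H: "finite H" "lin H e = (\<lambda>\<omega>. 1 / 2 * W n \<omega> + 1 / 2 * W l \<omega>)"
      "(\<Sum>t\<in>H. e t * x t) = 1 / 2 * (\<Sum>t\<in>F n. c n t * x t) + 1 / 2 * (\<Sum>t\<in>F l. c l t * x t)"
      by (rule lin_combination[OF F[of n] F[of l], where a = "1 / 2" and b = "1 / 2" and x = x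
          and c = "c n" and d = "c l", unfolded W_eq])
    let ?A = "expectation (\<lambda>\<omega>. (W n \<omega>)\<^sup>2)" and ?B = "expectation (\<lambda>\<omega>. (W l \<omega>)\<^sup>2)"
      and ?C = "expectation (\<lambda>\<omega>. W n \<omega> * W l \<omega>)"
    have "expectation (\<lambda>\<omega>. (1 / 2 * W n \<omega> + 1 / 2 * W l \<omega>)\<^sup>2) = ?A / 4 + ?B / 4 + ?C / 2"
    proof -
      have "(1 / 2 * W n \<omega> + 1 / 2 * W l \<omega>)\<^sup>2 = 1 / 4 * (W n \<omega>)\<^sup>2 + 1 / 4 * (W l \<omega>)\<^sup>2 + 1 / 2 * (W n \<omega> * W l \<omega>)" for \<omega>
        by (simp add: power2_eq_square field_simps)
      then show ?thesis using intW intWW by simp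
    qed
    then have "dual H e x = 1 / 2 * (\<Sum>t\<in>F n. c n t * x t) + 1 / 2 * (\<Sum>t\<in>F l. c l t * x t)
        - (?A / 4 + ?B / 4 + ?C / 2) / 2"
      by (simp only: dual_eq H)
    then have 1: "1 / 2 * dual (F n) (c n) x + 1 / 2 * dual (F l) (c l) x + (?A + ?B - 2 * ?C) / 8 \<le> m"
      using le_m[OF H(1), of e] by (simp add: dualW field_simps)
    have 2: "expectation (\<lambda>\<omega>. (W n \<omega> - W l \<omega>)\<^sup>2) = ?A + ?B - 2 * ?C"
      using intW intWW by (simp add: power2_diff mult.assoc)
    have 3: "(1 / 4 :: real) ^ l \<le> (1 / 4) ^ n" using that by (intro power_decreasing) auto
    have "E \<le> p"
      if "1 / 2 * a + 1 / 2 * b + E / 8 \<le> m" "m - p / 8 < a" "m - q / 8 < b" "q \<le> p" for a b E p q :: real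
      using that by linarith
    from this[OF 1 near near 3] show ?thesis by (simp only: 2)
  qed
  obtain V where V[measurable]: "V \<in> borel_measurable M"
    and intVW: "\<And>n. integrable M (\<lambda>\<omega>. (V \<omega> - W n \<omega>)\<^sup>2)"
    and VW: "\<And>n. expectation (\<lambda>\<omega>. (V \<omega> - W n \<omega>)\<^sup>2) \<le> (1 / 4) ^ n"
    by (rule L2_Cauchy_imp_limit[OF W intW cauchy]) (assumption, blast)
  have intV: "integrable M (\<lambda>\<omega>. (V \<omega>)\<^sup>2)"
    using integrable_square_add[OF _ _ intVW[of 0] intW[of 0]] by simp
  have lim0: "(\<lambda>n. (1 / 4 :: real) ^ n) \<longlonglongrightarrow> 0" by (intro LIMSEQ_power_zero) simp
  have V_space: "V \<in> gaussian_space M U"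
    unfolding gaussian_space_def
  proof (intro CollectI conjI V intV allI impI)
    fix e :: real assume "0 < e"
    then have "0 < e\<^sup>2" by simp
    then obtain n where "(1 / 4 :: real) ^ n < e\<^sup>2" using real_arch_pow_inv[of "e\<^sup>2" "1 / 4"] by auto
    then have "expectation (\<lambda>\<omega>. (V \<omega> - W n \<omega>)\<^sup>2) < e\<^sup>2" using VW[of n] by linarith
    then have "L2_norm M (\<lambda>\<omega>. V \<omega> - W n \<omega>) < e"
      unfolding L2_norm_def using \<open>0 < e\<close> real_sqrt_less_mono[of _ "e\<^sup>2"] by fastforce
    then show "\<exists>F c. finite F \<and> L2_norm M (\<lambda>\<omega>. V \<omega> - (\<Sum>t\<in>F. c t * U \<omega> t)) < e"
      using F by (intro exI[of _ "F n"] exI[of _ "c n"]) (simp add: W_def lin_def)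
  qed
  have "rkhs_map M U V = x"
  proof
    fix t
    define D where "D = x t - rkhs_map M U V t"
    \<comment> \<open>A near-maximizer is perturbed by r times the process at t. The gain cannot
      exceed the defect, which vanishes in the limit.\<close>
    have *: "r * D - r\<^sup>2 * cov t t / 2 \<le> 0" for r
    proof -
      have VWt: "(\<lambda>n. expectation (\<lambda>\<omega>. U \<omega> t * W n \<omega>)) \<longlonglongrightarrow> rkhs_map M U V t"
      proof (rule LIMSEQ_I)
        fix e :: real assume "0 < e"
        define C where "C = cov t t + 1"
        have "0 \<le> cov t t" by (simp add: cov_def)
        then have "0 < C" by (simp add: C_def)
        have "(\<lambda>n. sqrt (C * (1 / 4) ^ n)) \<longlonglongrightarrow> sqrt (C * 0)" by (intro tendsto_intros lim0)
        then have "\<forall>\<^sub>F n in sequentially. sqrt (C * (1 / 4) ^ n) < e"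
          using \<open>0 < e\<close> by (intro order_tendstoD(2)) auto
        moreover have "norm (expectation (\<lambda>\<omega>. U \<omega> t * W n \<omega>) - rkhs_map M U V t) \<le> sqrt (C * (1 / 4) ^ n)" for n
        proof -
          have "norm (expectation (\<lambda>\<omega>. U \<omega> t * W n \<omega>) - rkhs_map M U V t) = \<bar>rkhs_map M U V t - rkhs_map M U (W n) t\<bar>"
            by (simp add: rkhs_map_def abs_minus_commute)
          also have "\<dots> \<le> sqrt (cov t t * expectation (\<lambda>\<omega>. (V \<omega> - W n \<omega>)\<^sup>2))"
            by (rule abs_rkhs_map_diff_le[OF V intV W intW])
          also have "\<dots> \<le> sqrt (C * (1 / 4) ^ n)"
            using VW[of n] \<open>0 < C\<close> by (intro real_sqrt_le_mono mult_mono) (auto simp: C_def)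
          finally show ?thesis .
        qed
        ultimately show "\<exists>no. \<forall>n\<ge>no. norm (expectation (\<lambda>\<omega>. U \<omega> t * W n \<omega>) - rkhs_map M U V t) < e"
          unfolding eventually_sequentially by (meson le_less_trans)
      qed
      have "r * (x t - expectation (\<lambda>\<omega>. U \<omega> t * W n \<omega>)) - r\<^sup>2 * cov t t / 2 \<le> (1 / 4) ^ n / 8" for n
      proof -
        obtain H e where H: "finite H" "lin H e = (\<lambda>\<omega>. 1 * W n \<omega> + r * lin {t} (\<lambda>_. 1) \<omega>)"
          "(\<Sum>t\<in>H. e t * x t) = 1 * (\<Sum>t\<in>F n. c n t * x t) + r * (\<Sum>s\<in>{t}. 1 * x s)"
          by (rule lin_combination[OF F[of n], where G = "{t}" and a = 1 and b = r and x = x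
              and c = "c n" and d = "\<lambda>_. 1", unfolded W_eq]) auto
        have "expectation (\<lambda>\<omega>. (W n \<omega> + r * U \<omega> t)\<^sup>2) =
            expectation (\<lambda>\<omega>. (W n \<omega>)\<^sup>2) + 2 * r * expectation (\<lambda>\<omega>. U \<omega> t * W n \<omega>) + r\<^sup>2 * cov t t"
        proof -
          have "(W n \<omega> + r * U \<omega> t)\<^sup>2 = (W n \<omega>)\<^sup>2 + 2 * r * (U \<omega> t * W n \<omega>) + r\<^sup>2 * (U \<omega> t * U \<omega> t)" for \<omega>
            by (simp add: power2_eq_square algebra_simps)
          moreover have "integrable M (\<lambda>\<omega>. U \<omega> t * W n \<omega>)"
            by (intro integrable_mult_of_squares integrable_eval_square intW) auto
          ultimately show ?thesis using intW integrable_eval_mult by (simp add: cov_def)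
        qed
        then have "dual H e x = dual (F n) (c n) x
            + (r * (x t - expectation (\<lambda>\<omega>. U \<omega> t * W n \<omega>)) - r\<^sup>2 * cov t t / 2)"
          unfolding dual_eq[of H] H dualW by (simp add: lin_def field_simps)
        then show ?thesis using le_m[OF H(1), of e] near[of n] by linarith
      qed
      moreover have "(\<lambda>n. r * (x t - expectation (\<lambda>\<omega>. U \<omega> t * W n \<omega>)) - r\<^sup>2 * cov t t / 2)
          \<longlonglongrightarrow> r * D - r\<^sup>2 * cov t t / 2"
        unfolding D_def by (intro tendsto_intros VWt)
      moreover have "(\<lambda>n. (1 / 4 :: real) ^ n / 8) \<longlonglongrightarrow> 0 / 8" by (intro tendsto_intros lim0) auto
      ultimately show ?thesis by (metis (no_types, lifting) LIMSEQ_le div_0)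
    qed
    have "0 \<le> cov t t" by (simp add: cov_def)
    \<comment> \<open>The optimal r would be D divided by the variance at t, which may be 0; adding
      1 permits the division and still forces D = 0.\<close>
    define C where "C = cov t t + 1"
    have C: "0 < C" "cov t t \<le> C" using \<open>0 \<le> cov t t\<close> by (auto simp: C_def)
    have "(D / C) * D - (D / C)\<^sup>2 * C / 2 \<le> (D / C) * D - (D / C)\<^sup>2 * cov t t / 2"
      using C by (intro diff_left_mono divide_right_mono mult_left_mono) auto
    also have "\<dots> \<le> 0" by (rule *)
    finally have "D\<^sup>2 / (2 * C) \<le> 0" using C by (simp add: power2_eq_square field_simps)
    then have "D\<^sup>2 \<le> 0" using C by (simp add: divide_le_0_iff)
    then show "rkhs_map M U V t = x t" by (simp add: D_def)
  qed
  moreover have "expectation (\<lambda>\<omega>. (V \<omega>)\<^sup>2) / 2 \<le> a"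
  proof (rule LIMSEQ_le_const)
    show "(\<lambda>n. a + (1 / 4) ^ n / 2) \<longlonglongrightarrow> a"
      using tendsto_add[OF tendsto_const tendsto_divide[OF lim0 tendsto_const], of 2 a] by simp
    have "expectation (\<lambda>\<omega>. (V \<omega>)\<^sup>2) / 2 \<le> a + (1 / 4) ^ n / 2" for n
      using dual_rkhs_map[OF V intV F[of n], of "c n"] dual[OF F[of n], of "c n"] VW[of n]
        \<open>rkhs_map M U V = x\<close> by (simp add: W_def)
    then show "\<exists>N. \<forall>n\<ge>N. expectation (\<lambda>\<omega>. (V \<omega>)\<^sup>2) / 2 \<le> a + (1 / 4) ^ n / 2" by blast
  qed
  ultimately show ?thesis
    using rkhs_rate_rkhs_map[OF V_space] by (simp add: ennreal_leI)
qed

text \<open>Read forwards, this describes level sets as intersections of closed half spaces. Its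
  negation supplies, wherever the rate exceeds a, one finite combination that certifies it and
  drives the Chernoff bound.\<close>

lemma rkhs_rate_le_iff:
  assumes "0 \<le> a"
  shows "rkhs_rate M U x \<le> ennreal a \<longleftrightarrow> (\<forall>F c. finite F \<longrightarrow> dual F c x \<le> a)"
proof
  assume le: "rkhs_rate M U x \<le> ennreal a"
  then have "x \<in> rkhs M U" by (auto simp: rkhs_rate_def top_unique split: if_splits)
  then obtain V where V: "V \<in> gaussian_space M U" "x = rkhs_map M U V" by (auto simp: rkhs_def)
  then have "expectation (\<lambda>\<omega>. (V \<omega>)\<^sup>2) / 2 \<le> a" using le assms rkhs_rate_rkhs_map by simp
  then show "\<forall>F c. finite F \<longrightarrow> dual F c x \<le> a" using dual_le_of_rkhs_map[OF V(1)] V(2) by (meson order_trans)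
qed (use rkhs_rate_le_of_dual_le[OF assms] in blast)

end

subsection \<open>Large deviations of Gaussian processes\<close>

context gaussian_process
begin

text \<open>The L2 inner product of \<open>lin H c\<close> and \<open>lin H d\<close>. A common
  support H lets coefficients be added pointwise.\<close>

definition bil :: "unit_ivl set \<Rightarrow> (unit_ivl \<Rightarrow> real) \<Rightarrow> (unit_ivl \<Rightarrow> real) \<Rightarrow> real" where
  "bil H c d = (\<Sum>t\<in>H. \<Sum>s\<in>H. c t * d s * cov t s)"

lemma bil_commute: "bil H c d = bil H d c"
  unfolding bil_def by (subst sum.swap) (simp add: cov_commute mult_ac)

lemma bil_scale: "bil H (\<lambda>t. a * c t) (\<lambda>t. b * d t) = a * b * bil H c d"
  by (simp add: bil_def sum_distrib_left mult_ac)

lemma bil_add_square: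
  "bil H (\<lambda>t. c t + d t) (\<lambda>t. c t + d t) = bil H c c + 2 * bil H c d + bil H d d"
proof -
  have "bil H (\<lambda>t. c t + d t) (\<lambda>t. c t + d t) = bil H c c + bil H c d + (bil H d c + bil H d d)"
    by (simp add: bil_def sum.distrib algebra_simps)
  then show ?thesis by (simp add: bil_commute[of H d c])
qed

lemma bil_eq_expectation: "bil H c c = expectation (\<lambda>\<omega>. (lin H c \<omega>)\<^sup>2)"
  by (simp add: bil_def lin_def expectation_sum_square)

lemma expectation_exp_lin:
  "finite H \<Longrightarrow> expectation (\<lambda>\<omega>. exp (lin H c \<omega>)) = exp (bil H c c / 2)"
  "finite H \<Longrightarrow> integrable M (\<lambda>\<omega>. exp (lin H c \<omega>))"
  unfolding lin_def bil_def by (rule expectation_exp_sum; assumption)+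

lemma lin_scale: "lin H (\<lambda>t. a * c t) \<omega> = a * lin H c \<omega>"
  by (simp add: lin_def sum_distrib_left mult_ac)

lemma lin_add: "lin H (\<lambda>t. c t + d t) \<omega> = lin H c \<omega> + lin H d \<omega>"
  by (simp add: lin_def sum.distrib algebra_simps)

text \<open>On the event the weight \<open>exp (lin H d \<omega> - r)\<close> is at least 1, so the
  indicator can be replaced by it. The two exponentials merge into one Gaussian Laplace transform
  with coefficients c + d, known exactly.\<close>

lemma tilted_Chernoff:
  assumes "finite H"
  shows "integrable M (\<lambda>\<omega>. exp (lin H c \<omega>) * indicator {\<omega>. r < lin H d \<omega>} \<omega>)"
    and "expectation (\<lambda>\<omega>. exp (lin H c \<omega>) * indicator {\<omega>. r < lin H d \<omega>} \<omega>)
      \<le> exp (bil H c c / 2 - (r - bil H c d - bil H d d / 2))"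
proof -
  show i: "integrable M (\<lambda>\<omega>. exp (lin H c \<omega>) * indicator {\<omega>. r < lin H d \<omega>} \<omega>)"
    by (rule Bochner_Integration.integrable_bound[OF expectation_exp_lin(2)[OF assms, of c]])
       (auto simp: indicator_def)
  have i2: "integrable M (\<lambda>\<omega>. exp (- r) * exp (lin H (\<lambda>t. c t + d t) \<omega>))"
    using expectation_exp_lin(2)[OF assms] by simp
  have "expectation (\<lambda>\<omega>. exp (lin H c \<omega>) * indicator {\<omega>. r < lin H d \<omega>} \<omega>)
      \<le> expectation (\<lambda>\<omega>. exp (- r) * exp (lin H (\<lambda>t. c t + d t) \<omega>))"
  proof (rule integral_mono[OF i i2])
    fix \<omega>
    show "exp (lin H c \<omega>) * indicator {\<omega>. r < lin H d \<omega>} \<omega> \<le> exp (- r) * exp (lin H (\<lambda>t. c t + d t) \<omega>)"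
      by (simp add: lin_add indicator_def exp_add[symmetric])
  qed
  also have "\<dots> = exp (bil H c c / 2 - (r - bil H c d - bil H d d / 2))"
    unfolding integral_mult_right_zero expectation_exp_lin(1)[OF assms] bil_add_square
    by (simp add: exp_add[symmetric] field_simps)
  finally show "expectation (\<lambda>\<omega>. exp (lin H c \<omega>) * indicator {\<omega>. r < lin H d \<omega>} \<omega>)
      \<le> exp (bil H c c / 2 - (r - bil H c d - bil H d d / 2))" .
qed

lemma Chernoff_lin:
  assumes "finite H"
  shows "prob {\<omega> \<in> space M. r < lin H d \<omega>} \<le> exp (- (r - bil H d d / 2))"
proof -
  have "expectation (\<lambda>\<omega>. indicator {\<omega>. r < lin H d \<omega>} \<omega>) = prob {\<omega> \<in> space M. r < lin H d \<omega>}"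
    by (subst Bochner_Integration.integral_indicator) (auto intro!: arg_cong[of _ _ prob])
  then show ?thesis
    using tilted_Chernoff(2)[OF assms, of "\<lambda>_. 0" r d] by (simp add: lin_def bil_def)
qed

lemma rkhs_map_lin: "rkhs_map M U (lin H c) t = (\<Sum>s\<in>H. c s * cov s t)"
proof -
  have "rkhs_map M U (lin H c) t = expectation (\<lambda>\<omega>. \<Sum>s\<in>H. c s * (U \<omega> s * U \<omega> t))"
    by (simp add: rkhs_map_def lin_def sum_distrib_left mult_ac)
  then show ?thesis using integrable_eval_mult by (simp add: cov_def)
qed

text \<open>Tilting needs a finite combination, whereas a point of finite rate is represented by an
  element of the closure only. Strictness of the energy bound leaves room for the approximation
  error.\<close>

lemma ex_lin_approx:
  assumes V: "V \<in> gaussian_space M U" and a: "expectation (\<lambda>\<omega>. (V \<omega>)\<^sup>2) / 2 < a"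
    and "finite T" "0 < \<delta>"
  obtains F c where "finite F" "expectation (\<lambda>\<omega>. (lin F c \<omega>)\<^sup>2) / 2 < a"
    "\<And>t. t \<in> T \<Longrightarrow> \<bar>rkhs_map M U V t - rkhs_map M U (lin F c) t\<bar> < \<delta>"
proof -
  have Vm: "V \<in> borel_measurable M" and Vi: "integrable M (\<lambda>\<omega>. (V \<omega>)\<^sup>2)"
    using V by (auto simp: gaussian_space_def)
  define B where "B = expectation (\<lambda>\<omega>. (V \<omega>)\<^sup>2)"
  have lim: "(\<lambda>n. inverse (real (Suc n))) \<longlonglongrightarrow> 0" by (rule LIMSEQ_inverse_real_of_nat)
  \<comment> \<open>For a combination within squared distance e of V, Cauchy-Schwarz bounds its
    second moment by B + 2 sqrt (B e) + e. The sequence e = 1/(n+1) serves to find one e small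
    enough for this bound and for all points of T.\<close>
  have "(\<lambda>n. (B + 2 * sqrt (B * inverse (real (Suc n))) + inverse (real (Suc n))) / 2)
      \<longlonglongrightarrow> (B + 2 * sqrt (B * 0) + 0) / 2"
    by (intro tendsto_intros lim) auto
  then have "\<forall>\<^sub>F n in sequentially. (B + 2 * sqrt (B * inverse (real (Suc n))) + inverse (real (Suc n))) / 2 < a"
    using a by (intro order_tendstoD(2)) (auto simp: B_def)
  moreover have "\<forall>\<^sub>F n in sequentially. \<forall>t\<in>T. sqrt (cov t t * inverse (real (Suc n))) < \<delta>"
    using \<open>finite T\<close>
  proof (rule eventually_ball_finite, intro ballI)
    fix t
    have "(\<lambda>n. sqrt (cov t t * inverse (real (Suc n)))) \<longlonglongrightarrow> sqrt (cov t t * 0)"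
      by (intro tendsto_intros lim)
    then show "\<forall>\<^sub>F n in sequentially. sqrt (cov t t * inverse (real (Suc n))) < \<delta>"
      using \<open>0 < \<delta>\<close> by (intro order_tendstoD(2)) auto
  qed
  ultimately have "\<forall>\<^sub>F n in sequentially. (B + 2 * sqrt (B * inverse (real (Suc n))) + inverse (real (Suc n))) / 2 < a \<and>
      (\<forall>t\<in>T. sqrt (cov t t * inverse (real (Suc n))) < \<delta>)"
    by eventually_elim simp
  then obtain n where n: "(B + 2 * sqrt (B * inverse (real (Suc n))) + inverse (real (Suc n))) / 2 < a"
      "\<And>t. t \<in> T \<Longrightarrow> sqrt (cov t t * inverse (real (Suc n))) < \<delta>"
    unfolding eventually_sequentially by blast
  define e where "e = inverse (real (Suc n))"
  have "0 < e" by (simp add: e_def)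
  obtain F c where F: "finite F" and e: "expectation (\<lambda>\<omega>. (V \<omega> - lin F c \<omega>)\<^sup>2) < e"
    by (rule gaussian_space_approx[OF V \<open>0 < e\<close>])
  let ?D = "\<lambda>\<omega>. V \<omega> - lin F c \<omega>"
  have Di: "integrable M (\<lambda>\<omega>. (?D \<omega>)\<^sup>2)"
    by (intro integrable_square_diff Vm Vi integrable_lin_square F) auto
  have VDi: "integrable M (\<lambda>\<omega>. V \<omega> * ?D \<omega>)"
    by (intro integrable_mult_of_squares Vm Vi Di) (use Vm in auto)
  have "(lin F c \<omega>)\<^sup>2 = (V \<omega>)\<^sup>2 - 2 * (V \<omega> * ?D \<omega>) + (?D \<omega>)\<^sup>2" for \<omega>
    by (simp add: power2_eq_square algebra_simps)
  then have E: "expectation (\<lambda>\<omega>. (lin F c \<omega>)\<^sup>2) =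
      B - 2 * expectation (\<lambda>\<omega>. V \<omega> * ?D \<omega>) + expectation (\<lambda>\<omega>. (?D \<omega>)\<^sup>2)"
    using Vi Di VDi by (simp add: B_def)
  have "(- expectation (\<lambda>\<omega>. V \<omega> * ?D \<omega>))\<^sup>2 \<le> B * expectation (\<lambda>\<omega>. (?D \<omega>)\<^sup>2)"
    unfolding B_def power2_minus by (intro integral_Cauchy_Schwarz Vm Vi Di) (use Vm in auto)
  also have "\<dots> \<le> B * e" using e by (intro mult_left_mono) (auto simp: B_def)
  finally have "- expectation (\<lambda>\<omega>. V \<omega> * ?D \<omega>) \<le> sqrt (B * e)" by (rule real_le_rsqrt)
  then have "expectation (\<lambda>\<omega>. (lin F c \<omega>)\<^sup>2) \<le> B + 2 * sqrt (B * e) + e" using E e by linarith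
  then have "expectation (\<lambda>\<omega>. (lin F c \<omega>)\<^sup>2) / 2 \<le> (B + 2 * sqrt (B * e) + e) / 2" by simp
  also have "\<dots> < a" using n(1) by (simp only: e_def)
  finally have "expectation (\<lambda>\<omega>. (lin F c \<omega>)\<^sup>2) / 2 < a" .
  moreover have "\<bar>rkhs_map M U V t - rkhs_map M U (lin F c) t\<bar> < \<delta>" if t: "t \<in> T" for t
  proof -
    have "\<bar>rkhs_map M U V t - rkhs_map M U (lin F c) t\<bar> \<le> sqrt (cov t t * expectation (\<lambda>\<omega>. (?D \<omega>)\<^sup>2))"
      by (intro abs_rkhs_map_diff_le Vm Vi integrable_lin_square F) auto
    also have "\<dots> \<le> sqrt (cov t t * e)"
      using e by (intro real_sqrt_le_mono mult_left_mono) (auto simp: cov_def)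
    also have "\<dots> < \<delta>" using n(2)[OF t] by (simp add: e_def)
    finally show ?thesis .
  qed
  ultimately show thesis using F that by blast
qed

end

lemma continuous_on_eval_C01: "continuous_on S (\<lambda>x::C01. x t)"
  unfolding continuous_on_iff by (metis dist_fun_lt_imp_dist_val_lt)

text \<open>On a compact set the uniform topology agrees with that of pointwise convergence.\<close>

lemma compact_C01_pointwise_nbhd:
  fixes x :: C01 and K W :: "C01 set"
  assumes "compact K" "open W" "x \<in> W"
  obtains T \<delta> where "finite T" "0 < \<delta>"
    "\<And>z. z \<in> K \<Longrightarrow> (\<And>t. t \<in> T \<Longrightarrow> \<bar>apply_bcontfun z t - x t\<bar> \<le> \<delta>) \<Longrightarrow> z \<in> W"
proof -
  \<comment> \<open>Every z in K - W differs from x at some time by more than some 1/(m+1). A finite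
    subcover of these open conditions yields T and, through its largest m, the radius; the inserted
    0 covers an empty subcover.\<close>
  have "compact (K - W)" using assms by (simp add: compact_diff)
  moreover have "open {z::C01. \<bar>z (fst i) - x (fst i)\<bar> > inverse (real (Suc (snd i)))}" for i
    by (intro open_Collect_less continuous_intros continuous_on_eval_C01)
  moreover have "K - W \<subseteq> (\<Union>i\<in>UNIV. {z::C01. \<bar>z (fst i) - x (fst i)\<bar> > inverse (real (Suc (snd i)))})"
  proof
    fix z assume "z \<in> K - W"
    then have "z \<noteq> x" using assms(3) by auto
    then obtain t where "z t \<noteq> x t" by (metis bcontfun_eqI)
    then obtain m where "inverse (real (Suc m)) < \<bar>z t - x t\<bar>"
      using reals_Archimedean[of "\<bar>z t - x t\<bar>"] by auto
    then show "z \<in> (\<Union>i\<in>UNIV. {z::C01. \<bar>z (fst i) - x (fst i)\<bar> > inverse (real (Suc (snd i)))})"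
      by (intro UN_I[of "(t, m)"]) auto
  qed
  ultimately obtain I where I: "finite I"
    "K - W \<subseteq> (\<Union>i\<in>I. {z::C01. \<bar>z (fst i) - x (fst i)\<bar> > inverse (real (Suc (snd i)))})"
    by (rule compactE_image[where C = UNIV]) auto
  define m where "m = Max (insert 0 (snd ` I))"
  show thesis
  proof (rule that[of "fst ` I" "inverse (real (Suc m))"])
    fix z :: C01 assume z: "z \<in> K" "\<And>t. t \<in> fst ` I \<Longrightarrow> \<bar>z t - x t\<bar> \<le> inverse (real (Suc m))"
    show "z \<in> W"
    proof (rule ccontr)
      assume "z \<notin> W"
      then obtain i where i: "i \<in> I" "\<bar>z (fst i) - x (fst i)\<bar> > inverse (real (Suc (snd i)))"
        using I(2) z(1) by blast
      have "snd i \<le> m" unfolding m_def using I(1) i(1) by (intro Max_ge) auto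
      then have "inverse (real (Suc m)) \<le> inverse (real (Suc (snd i)))" by (simp add: field_simps)
      moreover have "\<bar>z (fst i) - x (fst i)\<bar> \<le> inverse (real (Suc m))" using i(1) by (intro z(2)) blast
      ultimately show False using i(2) by linarith
    qed
  qed (use I in auto)
qed

text \<open>The processes \<open>X n\<close> and the reference process U may live on different
  probability spaces; convergence of scaled covariances is their only link.\<close>

locale gaussian_family =
  fixes M :: "'w measure" and X :: "nat \<Rightarrow> 'w \<Rightarrow> C01" and \<gamma> :: "nat \<Rightarrow> real"
    and N :: "'v measure" and U :: "'v \<Rightarrow> C01"
  assumes gaussian_X: "\<And>n. gaussian_process M (X n)" and gaussian_U: "gaussian_process N U"
    and \<gamma>_pos: "\<And>n. 0 < \<gamma> n" and \<gamma>_lim: "filterlim \<gamma> at_top sequentially"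
    and tight: "exponentially_tight M X \<gamma>"
    and cov_lim: "\<And>t s. (\<lambda>n. \<gamma> n * gaussian_process.cov M (X n) t s) \<longlonglongrightarrow> gaussian_process.cov N U t s"
begin

sublocale X: gaussian_process M "X n" for n by (rule gaussian_X)
sublocale U: gaussian_process N U by (rule gaussian_U)

lemma bil_lim: "(\<lambda>n. \<gamma> n * X.bil n H c d) \<longlonglongrightarrow> U.bil H c d"
proof -
  have "(\<lambda>n. \<Sum>t\<in>H. \<Sum>s\<in>H. c t * d s * (\<gamma> n * X.cov n t s)) \<longlonglongrightarrow> U.bil H c d"
    unfolding U.bil_def by (intro tendsto_intros cov_lim)
  then show ?thesis by (simp add: X.bil_def sum_distrib_left mult_ac)
qed

lemma X_measurable: "X n \<in> measurable M (borel_of euclidean)"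
  by (rule borel_measurable_C01I) (rule X.eval_measurable)

lemma X_in_sets: "open A \<Longrightarrow> {\<omega> \<in> space M. X n \<omega> \<in> A} \<in> sets M"
  using measurable_sets[OF X_measurable, of A n] by (simp add: openin_in_borel_of vimage_def Int_def conj_commute)

lemma tight_compact:
  assumes "0 < b"
  obtains K where "compact K" "\<forall>\<^sub>F n in sequentially. measure M {\<omega> \<in> space M. X n \<omega> \<notin> K} \<le> exp (- (\<gamma> n * b))"
proof -
  \<comment> \<open>Tightness at b + 1 leaves the gap needed to turn the limsup into an eventual
    bound at b.\<close>
  have "0 < b + 1" using assms by simp
  then obtain K where K: "compact K"
    "limsup (\<lambda>n. ereal (1 / \<gamma> n) * log_prob (measure M {\<omega> \<in> space M. X n \<omega> \<notin> K})) \<le> ereal (- (b + 1))"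
    using tight unfolding exponentially_tight_def by blast
  have "ereal (- (b + 1)) < ereal (- b)" by simp
  then have "\<forall>\<^sub>F n in sequentially. ereal (1 / \<gamma> n) * log_prob (measure M {\<omega> \<in> space M. X n \<omega> \<notin> K}) < ereal (- b)"
    using K(2) unfolding Limsup_le_iff by blast
  then have "\<forall>\<^sub>F n in sequentially. measure M {\<omega> \<in> space M. X n \<omega> \<notin> K} \<le> exp (- (\<gamma> n * b))"
    by eventually_elim (use \<gamma>_pos in \<open>auto simp: scaled_log_prob_less_iff\<close>)
  with K(1) that show thesis by blast
qed

text \<open>The neighbourhood is an open half space. Variances are of order 1 / \<gamma>(n), so
  coefficients \<open>\<gamma> n * c t\<close> make the Chernoff exponent of order \<gamma>(n), with
  the limiting kernel appearing after division.\<close>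

lemma local_upper:
  fixes x :: C01
  assumes "finite F" "a < U.dual F c x"
  obtains B :: "C01 set" where "open B" "x \<in> B"
    "\<forall>\<^sub>F n in sequentially. measure M {\<omega> \<in> space M. X n \<omega> \<in> B} \<le> exp (- (\<gamma> n * a))"
proof -
  \<comment> \<open>Chosen so that the limiting exponent, r minus half the quadratic form, is the
    midpoint of a and the dual value at x.\<close>
  define r where "r = (a + U.dual F c x) / 2 + U.bil F c c / 2"
  define B where "B = {z::C01. r < (\<Sum>t\<in>F. c t * z t)}"
  have dual: "U.dual F c x = (\<Sum>t\<in>F. c t * x t) - U.bil F c c / 2"
    by (simp add: U.dual_def U.bil_def)
  have "open B" unfolding B_def by (intro open_Collect_less continuous_intros continuous_on_eval_C01)
  moreover have "x \<in> B" using assms(2) dual by (simp add: B_def r_def field_simps)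
  moreover have "(\<lambda>n. r - \<gamma> n * X.bil n F c c / 2) \<longlonglongrightarrow> r - U.bil F c c / 2"
    by (intro tendsto_intros bil_lim) auto
  then have "\<forall>\<^sub>F n in sequentially. a < r - \<gamma> n * X.bil n F c c / 2"
    by (rule order_tendstoD(1)) (use assms(2) in \<open>simp add: r_def field_simps\<close>)
  then have "\<forall>\<^sub>F n in sequentially. measure M {\<omega> \<in> space M. X n \<omega> \<in> B} \<le> exp (- (\<gamma> n * a))"
  proof eventually_elim
    case (elim n)
    have "{\<omega> \<in> space M. X n \<omega> \<in> B} = {\<omega> \<in> space M. \<gamma> n * r < X.lin n F (\<lambda>t. \<gamma> n * c t) \<omega>}"
      using \<gamma>_pos[of n] unfolding B_def X.lin_scale by (simp add: X.lin_def)
    also have "measure M \<dots> \<le> exp (- (\<gamma> n * r - X.bil n F (\<lambda>t. \<gamma> n * c t) (\<lambda>t. \<gamma> n * c t) / 2))"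
      by (rule X.Chernoff_lin[OF assms(1)])
    also have "\<dots> = exp (- (\<gamma> n * (r - \<gamma> n * X.bil n F c c / 2)))"
      by (simp add: X.bil_scale algebra_simps)
    also have "\<dots> \<le> exp (- (\<gamma> n * a))" using elim \<gamma>_pos[of n] by simp
    finally show ?case .
  qed
  ultimately show thesis using that by blast
qed

text \<open>The exponential on the right is the total tilted mass, so this is a tail bound under the
  tilted law. There \<open>lin H d\<close> has mean tending to \<open>U.bil H c d\<close> and
  variance of order 1 / \<gamma>(n), so exceeding r is exponentially unlikely.\<close>

lemma tilted_tail:
  assumes "finite H" "U.bil H c d < r" "0 < \<epsilon>"
  shows "\<forall>\<^sub>F n in sequentially.
    X.expectation (\<lambda>\<omega>. exp (X.lin n H (\<lambda>t. \<gamma> n * c t) \<omega>) * indicator {\<omega>. r < X.lin n H d \<omega>} \<omega>)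
      \<le> \<epsilon> * exp (X.bil n H (\<lambda>t. \<gamma> n * c t) (\<lambda>t. \<gamma> n * c t) / 2)"
proof -
  define B C where "B = U.bil H c d" and "C = U.bil H d d"
  have "0 \<le> C" by (simp add: C_def U.bil_eq_expectation)
  \<comment> \<open>The best Chernoff parameter would be (r - B) / C; using C + 1 avoids division by
    0 and still leaves the positive exponent \<theta> squared times C / 2 + 1.\<close>
  define \<theta> where "\<theta> = (r - B) / (C + 1)"
  have \<theta>: "0 < \<theta>" using assms(2) \<open>0 \<le> C\<close> by (simp add: \<theta>_def B_def)
  define e where "e = (\<lambda>n. \<theta> * r - \<theta> * (\<gamma> n * X.bil n H c d) - \<theta>\<^sup>2 * (\<gamma> n * X.bil n H d d) / 2)"
  have "e \<longlonglongrightarrow> \<theta> * r - \<theta> * B - \<theta>\<^sup>2 * C / 2"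
    unfolding e_def B_def C_def by (intro tendsto_intros bil_lim) auto
  moreover have "0 < \<theta> * r - \<theta> * B - \<theta>\<^sup>2 * C / 2"
  proof -
    have "r - B = \<theta> * (C + 1)" using \<open>0 \<le> C\<close> by (simp add: \<theta>_def)
    then have "\<theta> * r - \<theta> * B - \<theta>\<^sup>2 * C / 2 = \<theta> * (\<theta> * (C + 1)) - \<theta>\<^sup>2 * C / 2"
      by (metis right_diff_distrib)
    also have "\<dots> = \<theta>\<^sup>2 * (C / 2 + 1)" by (simp add: power2_eq_square field_simps)
    also have "\<dots> > 0" using \<theta> \<open>0 \<le> C\<close> by (intro mult_pos_pos) auto
    finally show ?thesis .
  qed
  ultimately have "filterlim (\<lambda>n. e n * \<gamma> n) at_top sequentially"
    using filterlim_tendsto_pos_mult_at_top \<gamma>_lim by blast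
  then have "\<forall>\<^sub>F n in sequentially. - ln \<epsilon> \<le> e n * \<gamma> n" by (simp add: filterlim_at_top)
  then show ?thesis
  proof eventually_elim
    case (elim n)
    let ?c = "\<lambda>t. \<gamma> n * c t" and ?d = "\<lambda>t. (\<gamma> n * \<theta>) * d t"
    have "\<gamma> n * \<theta> * r < \<gamma> n * \<theta> * y \<longleftrightarrow> r < y" for y
      using \<gamma>_pos[of n] \<theta> by (intro mult_less_cancel_left_pos) simp
    then have "{\<omega>. r < X.lin n H d \<omega>} = {\<omega>. \<gamma> n * \<theta> * r < X.lin n H ?d \<omega>}"
      unfolding X.lin_scale by simp
    then have "X.expectation (\<lambda>\<omega>. exp (X.lin n H ?c \<omega>) * indicator {\<omega>. r < X.lin n H d \<omega>} \<omega>)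
      \<le> exp (X.bil n H ?c ?c / 2 - (\<gamma> n * \<theta> * r - X.bil n H ?c ?d - X.bil n H ?d ?d / 2))"
      using X.tilted_Chernoff(2)[OF assms(1), of n ?c "\<gamma> n * \<theta> * r" ?d] by simp
    also have "\<gamma> n * \<theta> * r - X.bil n H ?c ?d - X.bil n H ?d ?d / 2 = e n * \<gamma> n"
      unfolding X.bil_scale e_def by (simp add: power2_eq_square algebra_simps)
    also have "exp (X.bil n H ?c ?c / 2 - e n * \<gamma> n) \<le> exp (X.bil n H ?c ?c / 2 + ln \<epsilon>)"
      using elim by simp
    also have "\<dots> = \<epsilon> * exp (X.bil n H ?c ?c / 2)" using \<open>0 < \<epsilon>\<close> by (simp add: exp_add)
    finally show ?case .
  qed
qed

text \<open>Under the law tilted by \<open>exp (\<gamma> n * lin H c)\<close> the combination \<open>lin H d\<close> concentrates at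
  \<open>bil H c d\<close>, so every half space containing these points keeps most of the tilted mass.\<close>

lemma tilting_lower:
  assumes H: "finite H" and J: "finite J" "\<And>d r. (d, r) \<in> J \<Longrightarrow> U.bil H c d < r"
    and a: "U.bil H c c / 2 < a"
  shows "\<forall>\<^sub>F n in sequentially. exp (- (\<gamma> n * a)) \<le>
    measure M {\<omega> \<in> space M. \<forall>(d, r)\<in>J. X.lin n H d \<omega> \<le> r}"
proof -
  define Q where "Q = U.bil H c c"
  \<comment> \<open>The slack is 4 \<eta>: one \<eta> for the convergence of the variance, one for
    the cap on the density, and two to absorb the factor 1/2 through ln 2.\<close>
  define \<eta> where "\<eta> = (a - Q / 2) / 4"
  have \<eta>: "0 < \<eta>" using a by (simp add: \<eta>_def Q_def)
  \<comment> \<open>The extra half space caps the tilting density by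
    \<open>exp (\<gamma> n * (Q + \<eta>))\<close> on the good event, so that tilted mass can be
    converted back into probability.\<close>
  define J' where "J' = insert (c, Q + \<eta>) J"
  have J': "finite J'" "\<And>d r. (d, r) \<in> J' \<Longrightarrow> U.bil H c d < r"
    using J \<eta> by (auto simp: J'_def Q_def)
  \<comment> \<open>All bad half spaces together then carry at most half of the tilted mass.\<close>
  define \<epsilon> where "\<epsilon> = 1 / (2 * real (card J'))"
  have card: "0 < real (card J')" using J'(1) by (simp add: J'_def card_gt_0_iff)
  then have "0 < \<epsilon>" by (simp add: \<epsilon>_def)
  define f where "f = (\<lambda>n j \<omega>. exp (X.lin n H (\<lambda>t. \<gamma> n * c t) \<omega>) * indicator {\<omega>. snd j < X.lin n H (fst j) \<omega>} \<omega>)"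
  define b where "b = (\<lambda>n. X.bil n H (\<lambda>t. \<gamma> n * c t) (\<lambda>t. \<gamma> n * c t) / 2)"
  have "\<forall>\<^sub>F n in sequentially. \<forall>j\<in>J'. X.expectation (f n j) \<le> \<epsilon> * exp (b n)"
    unfolding f_def b_def
    using J' \<open>0 < \<epsilon>\<close> by (intro eventually_ball_finite ballI tilted_tail H) auto
  moreover have "(\<lambda>n. \<gamma> n * X.bil n H c c / 2) \<longlonglongrightarrow> Q / 2"
    unfolding Q_def by (intro tendsto_intros bil_lim) auto
  then have "\<forall>\<^sub>F n in sequentially. Q / 2 - \<eta> < \<gamma> n * X.bil n H c c / 2"
    using \<eta> by (intro order_tendstoD(1)) auto
  moreover have "\<forall>\<^sub>F n in sequentially. ln 2 / (2 * \<eta>) \<le> \<gamma> n" using \<gamma>_lim by (simp add: filterlim_at_top)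
  ultimately show ?thesis
  proof eventually_elim
    case (elim n)
    let ?L = "X.lin n H (\<lambda>t. \<gamma> n * c t)"
    define G where "G = {\<omega> \<in> space M. \<forall>j\<in>J'. X.lin n H (fst j) \<omega> \<le> snd j}"
    have G[measurable]: "G \<in> sets M"
      unfolding G_def using J'(1) by (intro sets.sets_Collect_finite_All') (auto simp: J'_def)
    have fint: "integrable M (f n j)" for j
      unfolding f_def by (rule X.tilted_Chernoff(1)[OF H])
    have "exp (?L \<omega>) \<le> exp (\<gamma> n * (Q + \<eta>)) * indicator G \<omega> + (\<Sum>j\<in>J'. f n j \<omega>)"
      if \<omega>: "\<omega> \<in> space M" for \<omega>
    proof (cases "\<omega> \<in> G")
      case True
      then have "X.lin n H c \<omega> \<le> Q + \<eta>" by (auto simp: G_def J'_def)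
      then have "?L \<omega> \<le> \<gamma> n * (Q + \<eta>)"
        unfolding X.lin_scale using \<gamma>_pos[of n] by (intro mult_left_mono) auto
      moreover have "0 \<le> (\<Sum>j\<in>J'. f n j \<omega>)" by (intro sum_nonneg) (simp add: f_def)
      ultimately show ?thesis using True by (simp add: add_increasing2)
    next
      case False
      then obtain j where j: "j \<in> J'" "snd j < X.lin n H (fst j) \<omega>"
        using \<omega> by (auto simp: G_def not_le)
      then have "exp (?L \<omega>) = f n j \<omega>" by (simp add: f_def)
      also have "\<dots> \<le> (\<Sum>j\<in>J'. f n j \<omega>)" using j(1) J'(1) by (intro member_le_sum) (auto simp: f_def)
      finally show ?thesis using False by simp
    qed
    then have "X.expectation (\<lambda>\<omega>. exp (?L \<omega>))
        \<le> X.expectation (\<lambda>\<omega>. exp (\<gamma> n * (Q + \<eta>)) * indicator G \<omega> + (\<Sum>j\<in>J'. f n j \<omega>))"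
      using X.expectation_exp_lin(2)[OF H] fint G
      by (intro integral_mono Bochner_Integration.integrable_add Bochner_Integration.integrable_sum)
         (auto simp: X.emeasure_eq_measure)
    also have "\<dots> = exp (\<gamma> n * (Q + \<eta>)) * measure M G + (\<Sum>j\<in>J'. X.expectation (f n j))"
      using fint G by (subst Bochner_Integration.integral_add) (auto simp: X.emeasure_eq_measure)
    also have "(\<Sum>j\<in>J'. X.expectation (f n j)) \<le> real (card J') * (\<epsilon> * exp (b n))"
      using elim(1) by (intro sum_bounded_above) auto
    also have "\<dots> = exp (b n) / 2" using card by (simp add: \<epsilon>_def)
    finally have "exp (b n) / 2 \<le> exp (\<gamma> n * (Q + \<eta>)) * measure M G"
      using X.expectation_exp_lin(1)[OF H, of n] by (simp add: b_def)
    then have "exp (b n) / 2 / exp (\<gamma> n * (Q + \<eta>)) \<le> measure M G" by (simp add: field_simps)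
    moreover have "exp (- (\<gamma> n * a)) \<le> exp (b n) / 2 / exp (\<gamma> n * (Q + \<eta>))"
    proof -
      have "b n = \<gamma> n * (\<gamma> n * X.bil n H c c / 2)" by (simp add: b_def X.bil_scale)
      then have "\<gamma> n * (Q / 2 - \<eta>) \<le> b n"
        using elim(2) \<gamma>_pos[of n] by (simp only:) (intro mult_left_mono, auto)
      moreover have "ln 2 \<le> \<gamma> n * (2 * \<eta>)" using elim(3) \<eta> by (simp add: pos_divide_le_eq)
      moreover have "\<gamma> n * a = \<gamma> n * (Q / 2 + 4 * \<eta>)" by (simp add: \<eta>_def field_simps)
      ultimately have "- (\<gamma> n * a) \<le> b n - ln 2 - \<gamma> n * (Q + \<eta>)" by (simp add: algebra_simps)
      then have "exp (- (\<gamma> n * a)) \<le> exp (b n - ln 2 - \<gamma> n * (Q + \<eta>))" by simp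
      then show ?thesis by (simp add: exp_diff)
    qed
    moreover have "measure M G \<le> measure M {\<omega> \<in> space M. \<forall>(d, r)\<in>J. X.lin n H d \<omega> \<le> r}"
    proof (rule X.finite_measure_mono)
      show "G \<subseteq> {\<omega> \<in> space M. \<forall>(d, r)\<in>J. X.lin n H d \<omega> \<le> r}" by (force simp: G_def J'_def)
      have "{\<omega> \<in> space M. \<forall>j\<in>J. X.lin n H (fst j) \<omega> \<le> snd j} \<in> sets M"
        using J(1) by (cases "J = {}") (auto intro!: sets.sets_Collect_finite_All')
      then show "{\<omega> \<in> space M. \<forall>(d, r)\<in>J. X.lin n H d \<omega> \<le> r} \<in> sets M"
        by (simp add: case_prod_beta)
    qed
    ultimately show ?case by linarith
  qed
qed

lemma lower_at:
  fixes x :: C01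
  assumes W: "open W" "x \<in> W" and x: "rkhs_rate N U (apply_bcontfun x) < ennreal a"
  shows "\<forall>\<^sub>F n in sequentially. exp (- (\<gamma> n * a)) \<le> measure M {\<omega> \<in> space M. X n \<omega> \<in> W}"
proof -
  have "apply_bcontfun x \<in> rkhs N U" using x by (auto simp: rkhs_rate_def split: if_splits)
  then obtain V where V: "V \<in> gaussian_space N U" "apply_bcontfun x = rkhs_map N U V"
    by (auto simp: rkhs_def)
  have a: "U.expectation (\<lambda>\<omega>. (V \<omega>)\<^sup>2) / 2 < a"
    using x unfolding V(2) U.rkhs_rate_rkhs_map[OF V(1)] by (subst (asm) ennreal_less_iff) auto
  have "0 \<le> U.expectation (\<lambda>\<omega>. (V \<omega>)\<^sup>2)" by simp
  then have "0 < a" using a by linarith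
  then obtain K where K: "compact K"
    "\<forall>\<^sub>F n in sequentially. measure M {\<omega> \<in> space M. X n \<omega> \<notin> K} \<le> exp (- (\<gamma> n * a))"
    by (rule tight_compact)
  obtain T \<delta> where T: "finite T" "0 < \<delta>"
    and nbhd: "\<And>z :: C01. z \<in> K \<Longrightarrow> (\<And>t. t \<in> T \<Longrightarrow> \<bar>z t - x t\<bar> \<le> \<delta>) \<Longrightarrow> z \<in> W"
    by (rule compact_C01_pointwise_nbhd[OF K(1) W]) blast
  \<comment> \<open>Half of the radius is for approximating x by the image of a finite combination,
    half for the fluctuation of the process around that image.\<close>
  have "0 < \<delta> / 2" using T by simp
  obtain F c' where F: "finite F" and c': "U.expectation (\<lambda>\<omega>. (U.lin F c' \<omega>)\<^sup>2) / 2 < a"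
    and close: "\<And>t. t \<in> T \<Longrightarrow> \<bar>x t - rkhs_map N U (U.lin F c') t\<bar> < \<delta> / 2"
    unfolding V(2) by (rule U.ex_lin_approx[OF V(1) a T(1) \<open>0 < \<delta> / 2\<close>]) blast
  define H where "H = F \<union> T"
  define c where "c = (\<lambda>t. if t \<in> F then c' t else 0)"
  define xc where "xc = (\<lambda>t. rkhs_map N U (U.lin F c') t)"
  have H: "finite H" using F T by (simp add: H_def)
  have lin_eq: "U.lin F c' = U.lin H c"
    unfolding c_def by (rule U.lin_extend(1)[OF H]) (simp add: H_def)
  \<comment> \<open>Each condition of closeness at a time t becomes two half spaces, with
    coefficient 1 or -1 at t alone. By the reproducing property the tilted centers are the values of
    \<open>xc\<close> with that sign.\<close>
  define J where "J = (\<lambda>(t, \<sigma>). (\<lambda>s. if s = t then \<sigma> else 0, \<sigma> * xc t + \<delta> / 2)) ` (T \<times> {1, - 1 :: real})"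
  have sum_delta: "(\<Sum>s\<in>H. (if s = t then \<sigma> else 0) * g s) = \<sigma> * g t" if "t \<in> T" for t \<sigma> and g :: "unit_ivl \<Rightarrow> real"
  proof -
    have "(\<Sum>s\<in>H. (if s = t then \<sigma> else 0) * g s) = (\<Sum>s\<in>H. if s = t then \<sigma> * g s else 0)"
      by (intro sum.cong) auto
    then show ?thesis using H that by (simp add: H_def)
  qed
  have bilJ: "U.bil H c (\<lambda>s. if s = t then \<sigma> else 0) = \<sigma> * xc t" if "t \<in> T" for t \<sigma>
  proof -
    have "U.bil H c (\<lambda>s. if s = t then \<sigma> else 0) = (\<Sum>s\<in>H. c s * (\<Sum>r\<in>H. (if r = t then \<sigma> else 0) * U.cov s r))"
      by (simp add: U.bil_def sum_distrib_left mult.assoc)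
    also have "\<dots> = (\<Sum>s\<in>H. \<sigma> * (c s * U.cov s t))" 
      unfolding sum_delta[OF that] by (simp add: mult_ac)
    also have "\<dots> = \<sigma> * xc t"
      by (simp add: xc_def lin_eq U.rkhs_map_lin sum_distrib_left)
    finally show ?thesis .
  qed
  have "U.bil H c c / 2 < a" using c' by (simp add: lin_eq U.bil_eq_expectation)
  \<comment> \<open>The good event is at least \<open>exp (- (\<gamma> n * a'))\<close> while the
    part outside K is at most \<open>exp (- (\<gamma> n * a))\<close>; with a' < a the former is
    eventually twice the latter.\<close>
  then obtain a' where a': "U.bil H c c / 2 < a'" "a' < a" using dense by blast
  have "U.bil H c d < r" if "(d, r) \<in> J" for d r
    using that \<open>0 < \<delta> / 2\<close> by (auto simp: J_def bilJ)
  moreover have "finite J" using T by (simp add: J_def)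
  ultimately have "\<forall>\<^sub>F n in sequentially. exp (- (\<gamma> n * a')) \<le>
      measure M {\<omega> \<in> space M. \<forall>(d, r)\<in>J. X.lin n H d \<omega> \<le> r}"
    by (intro tilting_lower[where c = c] H a'(1)) auto
  moreover have "\<forall>\<^sub>F n in sequentially. ln 2 / (a - a') \<le> \<gamma> n" using \<gamma>_lim by (simp add: filterlim_at_top)
  ultimately show ?thesis using K(2)
  proof eventually_elim
    case (elim n)
    let ?G = "{\<omega> \<in> space M. \<forall>(d, r)\<in>J. X.lin n H d \<omega> \<le> r}"
    let ?K = "{\<omega> \<in> space M. X n \<omega> \<notin> K}" and ?W = "{\<omega> \<in> space M. X n \<omega> \<in> W}"
    have meas: "?K \<in> sets M" "?W \<in> sets M"
      using X_in_sets[of "- K" n] X_in_sets[of W n] W(1) K(1)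
      by (auto simp: compact_imp_closed open_Compl)
    have sub: "?G \<subseteq> ?W \<union> ?K"
    proof
      fix \<omega> assume \<omega>: "\<omega> \<in> ?G"
      have "\<bar>X n \<omega> t - x t\<bar> \<le> \<delta>" if t: "t \<in> T" for t
      proof -
        have "X.lin n H (\<lambda>s. if s = t then \<sigma> else 0) \<omega> = \<sigma> * X n \<omega> t" for \<sigma>
          by (simp only: X.lin_def sum_delta[OF t])
        moreover have "X.lin n H (\<lambda>s. if s = t then \<sigma> else 0) \<omega> \<le> \<sigma> * xc t + \<delta> / 2" if "\<sigma> \<in> {1, - 1}" for \<sigma>
          using \<omega> t that by (force simp: J_def)
        ultimately have "1 * X n \<omega> t \<le> 1 * xc t + \<delta> / 2" "- 1 * X n \<omega> t \<le> - 1 * xc t + \<delta> / 2"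
          by (metis insertCI)+
        then show ?thesis using close[OF t] unfolding xc_def by linarith
      qed
      then show "\<omega> \<in> ?W \<union> ?K" using nbhd[of "X n \<omega>"] \<omega> by auto
    qed
    have "measure M ?G \<le> measure M (?W \<union> ?K)" using meas by (intro X.finite_measure_mono sub) auto
    also have "\<dots> \<le> measure M ?W + measure M ?K" using meas by (intro measure_Un_le)
    finally have "exp (- (\<gamma> n * a')) \<le> measure M ?W + exp (- (\<gamma> n * a))" using elim by linarith
    moreover have "2 * exp (- (\<gamma> n * a)) \<le> exp (- (\<gamma> n * a'))"
    proof -
      have "ln 2 \<le> \<gamma> n * (a - a')" using elim(2) a'(2) by (simp add: pos_divide_le_eq)
      then have "exp (ln 2 - \<gamma> n * a) \<le> exp (- (\<gamma> n * a'))" by (simp add: algebra_simps)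
      then show ?thesis by (simp add: exp_diff exp_minus field_simps)
    qed
    ultimately show ?case by linarith
  qed
qed

lemma rate_function_rkhs_rate: "rate_function euclidean (\<lambda>x. rkhs_rate N U (apply_bcontfun x))"
  unfolding rate_function_def
proof
  fix a
  show "closedin euclidean {x \<in> topspace euclidean. rkhs_rate N U (apply_bcontfun x) \<le> a}"
  proof (cases a)
    case (real r)
    have "closed {x :: C01. U.dual F c x \<le> r}" for F c
      unfolding U.dual_def by (intro closed_Collect_le continuous_intros continuous_on_eval_C01)
    then have "closed (\<Inter>(F, c)\<in>{F. finite F} \<times> UNIV. {x :: C01. U.dual F c x \<le> r})"
      by (intro closed_INT) auto
    moreover have "{x. rkhs_rate N U (apply_bcontfun x) \<le> a} =
        (\<Inter>(F, c)\<in>{F. finite F} \<times> UNIV. {x :: C01. U.dual F c x \<le> r})"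
      using real by (auto simp: U.rkhs_rate_le_iff)
    ultimately show ?thesis by simp
  qed auto
qed

text \<open>A point of rate at most r outside the compact K would give the open complement of K
  probability at least \<open>exp (- (\<gamma> n * (r + 1)))\<close>, against the tightness bound
  with r + 2. So level sets lie in compact sets.\<close>

lemma good_rate_function_rkhs_rate: "good_rate_function euclidean (\<lambda>x. rkhs_rate N U (apply_bcontfun x))"
  unfolding good_rate_function_def
proof (intro conjI rate_function_rkhs_rate allI impI)
  fix a :: ennreal assume "a < \<infinity>"
  then obtain r where r: "a = ennreal r" "0 \<le> r" by (metis ennreal_cases infinity_ennreal_def less_irrefl)
  let ?L = "{x :: C01. rkhs_rate N U (apply_bcontfun x) \<le> a}"
  have "0 < r + 2" using r by simp
  then obtain K where K: "compact K"
    "\<forall>\<^sub>F n in sequentially. measure M {\<omega> \<in> space M. X n \<omega> \<notin> K} \<le> exp (- (\<gamma> n * (r + 2)))"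
    by (rule tight_compact)
  have "?L \<subseteq> K"
  proof (intro subsetI, rule ccontr)
    fix x :: C01 assume x: "x \<in> ?L" "x \<notin> K"
    then have "rkhs_rate N U (apply_bcontfun x) \<le> ennreal r" using r by simp
    also have "\<dots> < ennreal (r + 1)" using r by (simp add: ennreal_less_iff)
    finally have "\<forall>\<^sub>F n in sequentially. exp (- (\<gamma> n * (r + 1))) \<le> measure M {\<omega> \<in> space M. X n \<omega> \<in> - K}"
      using x(2) K(1) by (intro lower_at[of "- K" x]) (auto simp: compact_imp_closed open_Compl)
    then have "\<forall>\<^sub>F n :: nat in sequentially. False"
      using K(2)
    proof eventually_elim
      case (elim n)
      have "{\<omega> \<in> space M. X n \<omega> \<in> - K} = {\<omega> \<in> space M. X n \<omega> \<notin> K}" by auto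
      then have "exp (- (\<gamma> n * (r + 1))) \<le> measure M {\<omega> \<in> space M. X n \<omega> \<notin> K}" using elim(1) by simp
      from order_trans[OF this elim(2)] show ?case using \<gamma>_pos[of n] by (simp add: algebra_simps)
    qed
    then show False by simp
  qed
  moreover have "closed ?L" using rate_function_rkhs_rate by (simp add: rate_function_def)
  ultimately have "compact ?L" using K(1) by (metis compact_Int_closed inf.absorb_iff2)
  then show "compactin euclidean {x \<in> topspace euclidean. rkhs_rate N U (apply_bcontfun x) \<le> a}" by simp
qed

theorem random_LDP_gaussian: "random_LDP M euclidean X \<gamma> (\<lambda>x. rkhs_rate N U (apply_bcontfun x))"
proof -
  let ?\<mu> = "\<lambda>n. distr M (borel_of euclidean) (X n)" and ?I = "\<lambda>x :: C01. rkhs_rate N U (apply_bcontfun x)"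
  have prob: "prob_space (?\<mu> n)" for n by (rule X.prob_space_distr[OF X_measurable])
  have meas: "measure (?\<mu> n) A = measure M {\<omega> \<in> space M. X n \<omega> \<in> A}" if "A \<in> sets (borel_of euclidean)" for n A
    using that by (subst measure_distr[OF X_measurable]) (auto intro!: arg_cong[of _ _ "measure M"])
  have "ldp_lower euclidean ?\<mu> \<gamma> ?I W" if W: "open W" for W
    unfolding ldp_lower_iff[OF \<gamma>_pos]
    using W by (auto simp: meas openin_in_borel_of intro!: lower_at)
  moreover have "ldp_upper euclidean ?\<mu> \<gamma> ?I C" if C: "closed C" for C
    unfolding ldp_upper_iff[OF \<gamma>_pos prob]
  proof (intro allI impI)
    fix a b :: real assume ab: "0 \<le> b" "b < a" "\<forall>x\<in>C. ennreal a \<le> ?I x"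
    define b' where "b' = (a + b) / 2"
    have b': "0 < b'" "b < b'" "b' < a" using ab by (auto simp: b'_def)
    obtain K where K: "compact K"
      "\<forall>\<^sub>F n in sequentially. measure M {\<omega> \<in> space M. X n \<omega> \<notin> K} \<le> exp (- (\<gamma> n * b'))"
      by (rule tight_compact[OF b'(1)])
    \<comment> \<open>Restricting to open sets that already obey the exponential bound lets
      compactness of K \<inter> C pick finitely many of them; the complement of K joins the cover as
      one more member.\<close>
    define \<B> where "\<B> = {B :: C01 set. open B \<and>
      (\<forall>\<^sub>F n in sequentially. measure M {\<omega> \<in> space M. X n \<omega> \<in> B} \<le> exp (- (\<gamma> n * b')))}"
    have "K \<inter> C \<subseteq> \<Union>\<B>"
    proof
      fix x assume "x \<in> K \<inter> C"
      then have "ennreal a \<le> ?I x" using ab by auto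
      moreover have "ennreal b' < ennreal a" using b' by (simp add: ennreal_less_iff)
      ultimately have "\<not> ?I x \<le> ennreal b'" by (simp add: not_le less_le_trans)
      then obtain F c where "finite F" "b' < U.dual F c x"
        using b' by (auto simp: U.rkhs_rate_le_iff not_le)
      then obtain B where "open B" "x \<in> B"
          "\<forall>\<^sub>F n in sequentially. measure M {\<omega> \<in> space M. X n \<omega> \<in> B} \<le> exp (- (\<gamma> n * b'))"
        by (rule local_upper)
      then show "x \<in> \<Union>\<B>" by (auto simp: \<B>_def)
    qed
    moreover have "compact (K \<inter> C)" using K(1) C by (rule compact_Int_closed)
    moreover have "\<And>B. B \<in> \<B> \<Longrightarrow> open B" by (simp add: \<B>_def)
    ultimately obtain \<F> where F: "\<F> \<subseteq> \<B>" "finite \<F>" "K \<inter> C \<subseteq> \<Union>\<F>" by (meson compactE)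
    have op: "open B" if "B \<in> insert (- K) \<F>" for B
      using that F(1) K(1) by (auto simp: \<B>_def compact_imp_closed open_Compl)
    show "\<forall>\<^sub>F n in sequentially. measure (?\<mu> n) C \<le> exp (- (\<gamma> n * b))"
    proof (rule eventually_measure_finite_cover_le[OF \<gamma>_lim prob, where D = "insert (- K) \<F>"])
      show "B \<in> sets (?\<mu> n)" if "B \<in> insert (- K) \<F>" for B n
        using op[OF that] by (simp add: openin_in_borel_of)
      show "\<forall>\<^sub>F n in sequentially. measure (?\<mu> n) B \<le> exp (- (\<gamma> n * b'))" if B: "B \<in> insert (- K) \<F>" for B
        using B op[OF B] F(1) K(2) by (auto simp: meas openin_in_borel_of \<B>_def)
    qed (use F b' in auto)
  qed
  ultimately show ?thesis
    using prob rate_function_rkhs_rate X_measurable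
    by (simp add: random_LDP_def LDP_def borel_probability_def)
qed

end

subsection \<open>Affine images in a random environment\<close>

lemma cond_rate_eq:
  "cond_rate N U z (y1, y2) = rkhs_rate N U (\<lambda>t. (z t - y2 t) / y1 t)"
  by (simp add: cond_rate_def rkhs_rate_def)

text \<open>The bound \<alpha> keeps y1 away from 0, so the quotient is defined everywhere and
  continuous. Each pair (y, z) thus has exactly one preimage x, whether or not its rate is
  finite.\<close>

lemma affine_C01_eq_iff:
  assumes "0 < \<alpha>" "y1 \<in> C_ge \<alpha>"
  shows "times_C01 x y1 + y2 = z \<longleftrightarrow> apply_bcontfun x = (\<lambda>t. (z t - y2 t) / y1 t)"
    and "\<exists>x. apply_bcontfun x = (\<lambda>t. (z t - y2 t) / y1 t)"
proof -
  have pos: "y1 t \<noteq> 0" for t using assms by (auto simp: C_ge_def dest: spec[of _ t])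
  show "times_C01 x y1 + y2 = z \<longleftrightarrow> apply_bcontfun x = (\<lambda>t. (z t - y2 t) / y1 t)"
  proof
    assume "times_C01 x y1 + y2 = z"
    then have "z t = x t * y1 t + y2 t" for t by auto
    then show "apply_bcontfun x = (\<lambda>t. (z t - y2 t) / y1 t)" using pos by (intro ext) simp
  next
    assume "apply_bcontfun x = (\<lambda>t. (z t - y2 t) / y1 t)"
    then show "times_C01 x y1 + y2 = z" using pos by (intro bcontfun_eqI) simp
  qed
  show "\<exists>x. apply_bcontfun x = (\<lambda>t. (z t - y2 t) / y1 t)"
    using pos by (intro exI[of _ "Bcontfun (\<lambda>t. (z t - y2 t) / y1 t)"] Bcontfun_unit_ivl_inverse
        continuous_intros continuous_on_apply_bcontfun) auto
qed

theorem theorem4: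
  fixes \<alpha> :: real
    and \<gamma> :: "nat \<Rightarrow> real"
    and M :: "'w measure"
    and X :: "nat \<Rightarrow> 'w \<Rightarrow> C01"
    and Y :: "nat \<Rightarrow> 'w \<Rightarrow> C01 \<times> C01"
    and Z :: "nat \<Rightarrow> 'w \<Rightarrow> C01"
    and k :: "unit_ivl \<Rightarrow> unit_ivl \<Rightarrow> real"
    and N :: "'v measure"
    and U :: "'v \<Rightarrow> C01"
    and I_Y :: "C01 \<times> C01 \<Rightarrow> ennreal"
  assumes "\<alpha> > 0"
    and "\<forall>n. \<gamma> n > 0"
    and "filterlim \<gamma> at_top sequentially"
    and "prob_space M"
    and "\<forall>n. continuous_centered_gaussian_process M (X n)"
    and "exponentially_tight M X \<gamma>"
    and "\<forall>\<nu>. signed_borel_measure \<nu> \<longrightarrow>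
           (\<lambda>n. \<gamma> n * prob_space.variance M (\<lambda>\<omega>. signed_integral \<nu> (X n \<omega>)))
             \<longlonglongrightarrow> signed_integral \<nu> (\<lambda>s. signed_integral \<nu> (\<lambda>t. k t s))"
    and "continuous_on UNIV (\<lambda>(t, s). k t s)"
    and "\<forall>t s. k t s = k s t"
    and "positive_definite k"
    and "prob_space N"
    and "continuous_centered_gaussian_process N U"
    and "k = covariance_function N U"
    and "indep_families M euclidean X (env_space \<alpha>) Y"
    and "good_rate_function (env_space \<alpha>) I_Y"
    and "random_LDP M (env_space \<alpha>) Y \<gamma> I_Y"
    and "\<forall>n. \<forall>\<omega>\<in>space M. \<forall>t. Z n \<omega> t = X n \<omega> t * fst (Y n \<omega>) t + snd (Y n \<omega>) t"
  shows "random_weak_LDP M (prod_topology (env_space \<alpha>) euclidean) (\<lambda>n \<omega>. (Y n \<omega>, Z n \<omega>)) \<gamma>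
           (\<lambda>(y, z). I_Y y + cond_rate N U z y)
       \<and> random_LDP M euclidean Z \<gamma>
           (\<lambda>z. INF y\<in>C_ge \<alpha> \<times> UNIV. I_Y y + cond_rate N U z y)"
proof -
  have gX: "gaussian_process M (X n)" for n
    using assms(4,5) by (simp add: gaussian_process_def gaussian_process_axioms_def)
  have gU: "gaussian_process N U"
    using assms(11,12) by (simp add: gaussian_process_def gaussian_process_axioms_def)
  have \<gamma>: "0 < \<gamma> n" for n using assms(2) by simp
  have k: "k = gaussian_process.cov N U"
    using assms(13) gaussian_process.covariance_function_eq_cov[OF gU] by simp
  have cov_lim: "(\<lambda>n. \<gamma> n * gaussian_process.cov M (X n) t s) \<longlonglongrightarrow> gaussian_process.cov N U t s" for t s
    unfolding k[symmetric] by (rule scaled_cov_tendsto[OF gX]) (use assms in blast)+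
  interpret gaussian_family M X \<gamma> N U
    by (rule gaussian_family.intro; fact gX gU \<gamma> assms(3) assms(6) cov_lim)
  let ?P = "prod_topology euclidean (env_space \<alpha>)"
  let ?I = "\<lambda>(x, y). rkhs_rate N U (apply_bcontfun x) + I_Y y"
  let ?\<Psi> = "\<lambda>(x, y1, y2). times_C01 x y1 + y2"
  have met: "metrizable_space (euclidean :: C01 topology)" by (rule metrizable_space_euclidean)
  have ldp: "random_LDP M ?P (\<lambda>n \<omega>. (X n \<omega>, Y n \<omega>)) \<gamma> ?I"
    by (intro random_LDP_product \<gamma> assms(3,4,14,15,16) second_countable_C01 second_countable_env_space
        metrizable_imp_regular_space met metrizable_env_space random_LDP_gaussian good_rate_function_rkhs_rate)
  have good: "good_rate_function ?P ?I"
    by (intro good_rate_function_add good_rate_function_rkhs_rate assms(15))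
  have Z: "Z n \<omega> = ?\<Psi> (X n \<omega>, Y n \<omega>)" if "\<omega> \<in> space M" for n \<omega>
    using assms(17) that by (intro bcontfun_eqI) (simp add: case_prod_beta)
  have cont: "continuous_map ?P euclidean ?\<Psi>" by (rule continuous_map_affine_C01)
  have fibre: "?\<Psi> (x, y) = z \<longleftrightarrow> apply_bcontfun x = (\<lambda>t. (z t - snd y t) / fst y t)"
    "\<exists>x. apply_bcontfun x = (\<lambda>t. (z t - snd y t) / fst y t)"
    "cond_rate N U z y = rkhs_rate N U (\<lambda>t. (z t - snd y t) / fst y t)"
    if y': "y \<in> C_ge \<alpha> \<times> UNIV" for x y z
  proof -
    obtain y1 y2 where y: "y = (y1, y2)" "y1 \<in> C_ge \<alpha>" using y' by auto
    show "?\<Psi> (x, y) = z \<longleftrightarrow> apply_bcontfun x = (\<lambda>t. (z t - snd y t) / fst y t)"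
      using affine_C01_eq_iff(1)[OF assms(1) y(2)] by (simp only: y prod.case fst_conv snd_conv)
    show "\<exists>x. apply_bcontfun x = (\<lambda>t. (z t - snd y t) / fst y t)"
      using affine_C01_eq_iff(2)[OF assms(1) y(2)] by (simp only: y fst_conv snd_conv)
    show "cond_rate N U z y = rkhs_rate N U (\<lambda>t. (z t - snd y t) / fst y t)"
      by (simp only: y cond_rate_eq fst_conv snd_conv)
  qed
  \<comment> \<open>For fixed y the fibre in x is a single point, so the infimum of the contraction
    principle collapses to one value.\<close>
  have rate: "(\<lambda>x. ?I (x, y)) ` {x. ?\<Psi> (x, y) = z} = {I_Y y + cond_rate N U z y}"
    if y: "y \<in> C_ge \<alpha> \<times> UNIV" for y z
  proof -
    obtain x0 where x0: "apply_bcontfun x0 = (\<lambda>t. (z t - snd y t) / fst y t)" using fibre(2)[OF y] by blast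
    then have "{x. ?\<Psi> (x, y) = z} = {x0}" using fibre(1)[OF y] by (auto intro!: bcontfun_eqI)
    then show ?thesis by (simp add: fibre(3)[OF y] x0 add.commute)
  qed
  have "random_LDP M (prod_topology (env_space \<alpha>) euclidean) (\<lambda>n \<omega>. (Y n \<omega>, Z n \<omega>)) \<gamma>
      (\<lambda>(y, z). I_Y y + cond_rate N U z y)"
  proof (rule random_contraction_principle[OF \<gamma> ldp good])
    show "continuous_map ?P (prod_topology (env_space \<alpha>) euclidean) (\<lambda>p. (snd p, ?\<Psi> p))"
      by (intro continuous_map_pairedI continuous_map_snd cont)
    show "Hausdorff_space (prod_topology (env_space \<alpha>) (euclidean :: C01 topology))"
      by (simp add: Hausdorff_space_prod_topology metrizable_imp_Hausdorff_space metrizable_env_space)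
    show "(Y n \<omega>, Z n \<omega>) = (snd (X n \<omega>, Y n \<omega>), ?\<Psi> (X n \<omega>, Y n \<omega>))" if "\<omega> \<in> space M" for n \<omega>
      using Z[OF that] by simp
    fix w assume "w \<in> topspace (prod_topology (env_space \<alpha>) (euclidean :: C01 topology))"
    then obtain y z where w: "w = (y, z)" and y: "y \<in> C_ge \<alpha> \<times> UNIV" by auto
    have "{p \<in> topspace ?P. (snd p, ?\<Psi> p) = w} = (\<lambda>x. (x, y)) ` {x. ?\<Psi> (x, y) = z}"
      using y by (auto simp: w)
    then have "?I ` {p \<in> topspace ?P. (snd p, ?\<Psi> p) = w} = {I_Y y + cond_rate N U z y}"
      by (simp only: image_image rate[OF y])
    then show "(case w of (y, z) \<Rightarrow> I_Y y + cond_rate N U z y) = (INF p\<in>{p \<in> topspace ?P. (snd p, ?\<Psi> p) = w}. ?I p)"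
      by (simp only: w prod.case) simp
  qed
  \<comment> \<open>Compact sets are closed in this Hausdorff space, so the full principle just
    obtained contains the weak one.\<close>
  then have "random_weak_LDP M (prod_topology (env_space \<alpha>) euclidean) (\<lambda>n \<omega>. (Y n \<omega>, Z n \<omega>)) \<gamma>
      (\<lambda>(y, z). I_Y y + cond_rate N U z y)"
    by (auto simp: random_LDP_def random_weak_LDP_def Hausdorff_space_prod_topology
        metrizable_imp_Hausdorff_space metrizable_env_space intro!: LDP_imp_weak_LDP)
  moreover have "random_LDP M euclidean Z \<gamma> (\<lambda>z. INF y\<in>C_ge \<alpha> \<times> UNIV. I_Y y + cond_rate N U z y)"
  proof (rule random_contraction_principle[OF \<gamma> ldp good cont _ Z])
    show "Hausdorff_space (euclidean :: C01 topology)" by simp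
    fix z
    \<comment> \<open>Over z alone the fibre contains one point for each y, so the infimum over the
      fibre becomes the infimum over environments.\<close>
    have "{p \<in> topspace ?P. ?\<Psi> p = z} = (\<Union>y\<in>C_ge \<alpha> \<times> UNIV. (\<lambda>x. (x, y)) ` {x. ?\<Psi> (x, y) = z})"
      by auto
    then have "?I ` {p \<in> topspace ?P. ?\<Psi> p = z} = (\<Union>y\<in>C_ge \<alpha> \<times> UNIV. (\<lambda>x. ?I (x, y)) ` {x. ?\<Psi> (x, y) = z})"
      by (simp only: image_UN image_image)
    also have "\<dots> = (\<lambda>y. I_Y y + cond_rate N U z y) ` (C_ge \<alpha> \<times> UNIV)"
      using rate by (subst SUP_cong[OF refl rate]) auto
    finally show "(INF y\<in>C_ge \<alpha> \<times> UNIV. I_Y y + cond_rate N U z y) = (INF p\<in>{p \<in> topspace ?P. ?\<Psi> p = z}. ?I p)"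
      by simp
  qed
  ultimately show ?thesis by blast
qed

end
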